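(* Assume (R) and (Q) from the context. Let $L\ge1$ be an integer, let $\beta>0$ be sufficiently small so that $\Sigma_L(\theta^\star;\beta)$ is invertible, let $y_1,y_2,\dots$ be i.i.d. with density $p_{\theta^\star,\beta}$, $\mathcal Y=\{y_i\}_{i=1}^n$, let $\widehat\theta_{\mathrm{GMoM}}\in\arg\min_{\theta\in\Theta}Q_n(\theta;\mathcal Y)$, and suppose that the positive semidefinite weighting matrices $\Omega_n$ satisfy $\Omega_n\to\Sigma_L(\theta^\star;\beta)^{-1}$ in probability. Assume that $L\ge r_{\mathrm{loc}}(\theta^\star)$. Then, after choosing a representative of $\widehat\theta_{\mathrm{GMoM}}$ (in its equivalence class) that converges to $\theta^\star$, $$\sqrt n\,\Pi_W\bigl(\widehat\theta_{\mathrm{GMoM}}-\theta^\star\bigr)\xrightarrow{\ \mathcal D\ }\mathcal N\bigl(0,\Sigma_{\mathrm{GMoM}}(\theta^\star;\beta)\bigr),\qquad \Sigma_{\mathrm{GMoM}}(\theta^\star;\beta)=\bigl(\mathcal I_{\mathrm{GMoM}}^{(W)}(\theta^\star;\beta)\bigr)^{-1}.$$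
   Context: Model. Fix integers $d,m\ge 1$ and $\sigma>0$. Let $(\mathcal Z,\mathcal F,\mu)$ be a probability space, $A:\mathcal Z\to\mathbb R^{d\times m}$ measurable with $\mathbb E_{Z\sim\mu}\|A(Z)\|_{\mathrm{op}}^2<\infty$, $\Theta\subseteq\mathbb R^m$ a $C^2$ embedded submanifold of dimension $m$, and $\theta^\star\in\Theta$. For $\theta\in\Theta$, $\beta\ge0$ let $p_{\theta,\beta}(y)=\int_{\mathcal Z}\varphi_\sigma(y-\beta A(z)\theta)\,\mu(dz)$, where $\varphi_\sigma$ is the density of $\mathcal N(0,\sigma^2I_d)$. (R) $\Theta$ is compact; there is $a_{\max}<\infty$ with $\|A(z)\|_{\mathrm{op}}\le a_{\max}$ for a.e. $z$; and $\mathbb E_{Z\sim\mu}[A(Z)^\top A(Z)]$ is positive definite. Equivalence. For $\theta,\theta'\in\Theta$, $\theta\sim\theta'$ if $p_{\theta,\beta}=p_{\theta',\beta}$ a.e. (equivalently, for $\beta>0$, $A(Z)\theta$ and $A(Z)\theta'$ have the same law under $Z\sim\mu$). $[\theta]=\{\theta'\in\Theta:\theta'\sim\theta\}$. (Q) There is an open neighborhood $U_\star\subset\Theta$ of $\theta^\star$ such that $U_\star/{\sim}$ admits a $C^2$ manifold structure for which the canonical projection $U_\star\to U_\star/{\sim}$ is a $C^2$ submersion. $T(\theta^\star)$ is the tangent space at $\theta^\star$ to $[\theta^\star]$ (velocities at $0$ of $C^1$ curves in $[\theta^\star]$ through $\theta^\star$ at time $0$), $W=T(\theta^\star)^\perp\subset\mathbb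 R^m$ (Euclidean orthogonal complement), $\Pi_W$ the orthogonal projector onto $W$. Signal moments. $T_k(\theta)=\mathbb E_{Z\sim\mu}[(A(Z)\theta)^{\otimes k}]$, $k\ge1$; $DT_k(\theta^\star)[h]$ is its derivative at $\theta^\star$ in direction $h$. For $h\in W\setminus\{0\}$, $r(h)=\min\{j\ge1:DT_j(\theta^\star)[h]\ne0\}$ ($=\infty$ if none), and $r_{\mathrm{loc}}(\theta^\star)=\max_{h\in W\setminus\{0\}}r(h)$. Features. Hermite tensors: $H_k(x)=(-1)^ke^{\|x\|^2/2}\nabla_x^{\otimes k}e^{-\|x\|^2/2}$, a symmetric tensor in $(\mathbb R^d)^{\otimes k}$. Symmetric order-$j$ tensors are identified with their coordinate vectors in a fixed Frobenius-orthonormal basis of the space of symmetric order-$j$ tensors. $\psi(y)=(H_1(y/\sigma),\dots,H_L(y/\sigma))$ (stacked); $M_n(\mathcal Y)=\frac1n\sum_{i=1}^n\psi(y_i)$; $M(\theta;\beta)=\mathbb E_{Y\sim p_{\theta,\beta}}[\psi(Y)]=((\beta/\sigma)T_1(\theta),\dots,(\beta/\sigma)^LT_L(\theta))$; $\Sigma_L(\theta^\star;\beta)=\mathrm{Cov}_{Y\sim p_{\theta^\star,\beta}}(\psi(Y))$. GMoM. $Q_n(\theta;\mathcal Y)=(M_n(\mathcal Y)-M(\theta;\beta))^\top\Omega_n(M_n(\mathcal Y)-M(\theta;\beta))$. With $D_WM(\theta^\star;\beta)=DM(\theta^\star;\beta)|_W$ (derivative in $\theta$ restricted to $W$), $\mathcal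 I_{\mathrm{GMoM}}^{(W)}(\theta^\star;\beta)=D_WM(\theta^\star;\beta)^\top\Sigma_L(\theta^\star;\beta)^{-1}D_WM(\theta^\star;\beta):W\to W$.
   Formalization: Existence of a measurable representative of the estimator converging to θ* in probability is assumed (it can fail, as L ≥ r_loc is only local); the limit is proved for a suitable such representative. Θ may have boundary, and U⋆ is open in R^m, so θ* is interior. *)

theory Defs
  imports "HOL-Probability.Probability"
begin

section \<open>Convergence of random vectors and normal laws\<close>

definition conv_in_prob ::
    "'w measure \<Rightarrow> (nat \<Rightarrow> 'w \<Rightarrow> 'b::metric_space) \<Rightarrow> 'b \<Rightarrow> bool" where
  "conv_in_prob P X c \<longleftrightarrow>
     (\<forall>\<epsilon>>0. (\<lambda>n. measure P {\<omega> \<in> space P. \<epsilon> < dist (X n \<omega>) c}) \<longlonglongrightarrow> 0)"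

text \<open>The library's \<open>weak_conv_m\<close> only covers laws on the real line.\<close>

definition weak_conv_vec :: "(nat \<Rightarrow> 'b::euclidean_space measure) \<Rightarrow> 'b measure \<Rightarrow> bool" where
  "weak_conv_vec N \<nu> \<longleftrightarrow>
     (\<forall>f :: 'b \<Rightarrow> real. continuous_on UNIV f \<and> bounded (range f) \<longrightarrow>
        (\<lambda>n. integral\<^sup>L (N n) f) \<longlonglongrightarrow> integral\<^sup>L \<nu> f)"

definition normal_law :: "real \<Rightarrow> real \<Rightarrow> real measure" where
  "normal_law a v =
     (if v = 0 then return borel a else density lborel (\<lambda>x. ennreal (normal_density a (sqrt v) x)))"

text \<open>Possibly degenerate normal law with mean \<open>a\<close> and covariance operator \<open>C\<close>: every linear
  functional \<open>x \<mapsto> t \<bullet> x\<close> is normal with mean \<open>t \<bullet> a\<close> and variance \<open>t \<bullet> C t\<close>.\<close>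

definition is_normal_vec :: "'b::euclidean_space \<Rightarrow> ('b \<Rightarrow> 'b) \<Rightarrow> 'b measure \<Rightarrow> bool" where
  "is_normal_vec a C \<nu> \<longleftrightarrow> prob_space \<nu> \<and> sets \<nu> = sets borel \<and>
     (\<forall>t. distr \<nu> borel (\<lambda>x. t \<bullet> x) = normal_law (t \<bullet> a) (t \<bullet> C t))"

definition conv_to_normal ::
    "'w measure \<Rightarrow> (nat \<Rightarrow> 'w \<Rightarrow> 'b::euclidean_space) \<Rightarrow> 'b \<Rightarrow> ('b \<Rightarrow> 'b) \<Rightarrow> bool" where
  "conv_to_normal P X a C \<longleftrightarrow>
     (\<exists>\<nu>. is_normal_vec a C \<nu> \<and> weak_conv_vec (\<lambda>n. distr P borel (X n)) \<nu>)"


section \<open>Linear algebra\<close>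

definition psd_matrix :: "real^'n^'n \<Rightarrow> bool" where
  "psd_matrix M \<longleftrightarrow> transpose M = M \<and> (\<forall>x. 0 \<le> x \<bullet> (M *v x))"

definition pd_matrix :: "real^'n^'n \<Rightarrow> bool" where
  "pd_matrix M \<longleftrightarrow> transpose M = M \<and> (\<forall>x. x \<noteq> 0 \<longrightarrow> 0 < x \<bullet> (M *v x))"

definition orth_proj :: "'b::euclidean_space set \<Rightarrow> 'b \<Rightarrow> 'b" where
  "orth_proj W x = (THE p. p \<in> W \<and> x - p \<in> W\<^sup>\<bottom>)"


section \<open>Twice continuously differentiable maps and manifolds\<close>

text \<open>For \<open>S\<close> open this is \<open>C\<^sup>2\<close> regularity on \<open>S\<close>. For \<open>S\<close> relatively open in a linear subspace
  \<open>V\<close> it is \<open>C\<^sup>2\<close> regularity of \<open>f\<close> as a map on an open subset of \<open>V\<close> (the values of \<open>f'\<close> and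
  \<open>f''\<close> in directions outside \<open>V\<close> are irrelevant, and can be taken to be zero).\<close>

definition C2_on :: "'b::euclidean_space set \<Rightarrow> ('b \<Rightarrow> 'c::euclidean_space) \<Rightarrow> bool" where
  "C2_on S f \<longleftrightarrow>
     (\<exists>(f' :: 'b \<Rightarrow> 'b \<Rightarrow>\<^sub>L 'c) (f'' :: 'b \<Rightarrow> 'b \<Rightarrow>\<^sub>L ('b \<Rightarrow>\<^sub>L 'c)).
        (\<forall>x\<in>S. (f has_derivative blinfun_apply (f' x)) (at x within S)) \<and>
        (\<forall>x\<in>S. (f' has_derivative blinfun_apply (f'' x)) (at x within S)) \<and>
        continuous_on S f'')"

text \<open>\<open>C\<^sup>2\<close> embedded submanifolds of full dimension, with a possibly empty boundary: around each
  point a \<open>C\<^sup>2\<close> diffeomorphism of open sets straightens the set to the whole space or to a closed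
  half-space. The boundary has to be allowed, since a nonempty full-dimensional submanifold without
  boundary is open in \<open>\<real>\<^sup>m\<close> and hence not compact.\<close>

definition C2_full_submanifold :: "(real^'m) set \<Rightarrow> bool" where
  "C2_full_submanifold \<Theta> \<longleftrightarrow>
     (\<forall>x\<in>\<Theta>. \<exists>V (\<Phi> :: real^'m \<Rightarrow> real^'m).
        open V \<and> x \<in> V \<and> inj_on \<Phi> V \<and> open (\<Phi> ` V) \<and>
        C2_on V \<Phi> \<and> C2_on (\<Phi> ` V) (inv_into V \<Phi>) \<and>
        (\<Phi> ` (\<Theta> \<inter> V) = \<Phi> ` V \<or> (\<exists>i. \<Phi> ` (\<Theta> \<inter> V) = \<Phi> ` V \<inter> {u. 0 \<le> u $ i})))"

text \<open>\<open>C\<^sup>2\<close> manifold structure, without boundary, on a topological space \<open>X\<close>: an atlas of pairs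
  (domain, chart). The model space is a linear subspace \<open>V\<close> of a Euclidean space, so that every
  dimension from \<open>0\<close> up to that of the ambient space is covered.\<close>

definition C2_manifold ::
    "'b::euclidean_space set \<Rightarrow> 'x topology \<Rightarrow> ('x set \<times> ('x \<Rightarrow> 'b)) set \<Rightarrow> bool" where
  "C2_manifold V X \<A> \<longleftrightarrow>
     subspace V \<and> Hausdorff_space X \<and> second_countable X \<and>
     topspace X = (\<Union>(D, \<phi>)\<in>\<A>. D) \<and>
     (\<forall>(D, \<phi>)\<in>\<A>. openin X D \<and> openin (top_of_set V) (\<phi> ` D) \<and>
        homeomorphic_map (subtopology X D) (top_of_set (\<phi> ` D)) \<phi>) \<and>
     (\<forall>(D, \<phi>)\<in>\<A>. \<forall>(D', \<phi>')\<in>\<A>. C2_on (\<phi> ` (D \<inter> D')) (\<phi>' \<circ> inv_into D \<phi>))"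

definition C2_submersion ::
    "'b::euclidean_space set \<Rightarrow> 'c::euclidean_space set \<Rightarrow> 'x topology \<Rightarrow>
     ('x set \<times> ('x \<Rightarrow> 'c)) set \<Rightarrow> ('b \<Rightarrow> 'x) \<Rightarrow> bool" where
  "C2_submersion U V X \<A> \<pi> \<longleftrightarrow>
     continuous_map (top_of_set U) X \<pi> \<and>
     (\<forall>(D, \<phi>)\<in>\<A>. C2_on {\<theta>\<in>U. \<pi> \<theta> \<in> D} (\<phi> \<circ> \<pi>) \<and>
        (\<forall>\<theta>\<in>U. \<pi> \<theta> \<in> D \<longrightarrow> range (frechet_derivative (\<phi> \<circ> \<pi>) (at \<theta>)) = V))"


section \<open>The model\<close>

text \<open>Throughout, \<open>A z\<close> is a matrix with rows indexed by \<open>'d\<close> and columns indexed by \<open>'m\<close>.\<close>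

definition gauss_density :: "real \<Rightarrow> real^'d \<Rightarrow> real" where
  "gauss_density \<sigma> x =
     exp (- (norm x)\<^sup>2 / (2 * \<sigma>\<^sup>2)) / sqrt (2 * pi * \<sigma>\<^sup>2) ^ CARD('d)"

definition obs_density ::
    "'z measure \<Rightarrow> ('z \<Rightarrow> real^'m^'d) \<Rightarrow> real \<Rightarrow> real \<Rightarrow> real^'m \<Rightarrow> real^'d \<Rightarrow> real" where
  "obs_density \<mu> A \<sigma> \<beta> \<theta> y = (LINT z|\<mu>. gauss_density \<sigma> (y - \<beta> *\<^sub>R (A z *v \<theta>)))"

definition obs_law ::
    "'z measure \<Rightarrow> ('z \<Rightarrow> real^'m^'d) \<Rightarrow> real \<Rightarrow> real \<Rightarrow> real^'m \<Rightarrow> (real^'d) measure" where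
  "obs_law \<mu> A \<sigma> \<beta> \<theta> = density lborel (\<lambda>y. ennreal (obs_density \<mu> A \<sigma> \<beta> \<theta> y))"

definition model_assms ::
    "'z measure \<Rightarrow> ('z \<Rightarrow> real^'m^'d) \<Rightarrow> real \<Rightarrow> (real^'m) set \<Rightarrow> real^'m \<Rightarrow> bool" where
  "model_assms \<mu> A \<sigma> \<Theta> \<theta>s \<longleftrightarrow>
     0 < \<sigma> \<and> prob_space \<mu> \<and> A \<in> borel_measurable \<mu> \<and>
     integrable \<mu> (\<lambda>z. (onorm ((*v) (A z)))\<^sup>2) \<and>
     C2_full_submanifold \<Theta> \<and> \<theta>s \<in> \<Theta>"

definition condition_R ::
    "'z measure \<Rightarrow> ('z \<Rightarrow> real^'m^'d) \<Rightarrow> (real^'m) set \<Rightarrow> bool" where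
  "condition_R \<mu> A \<Theta> \<longleftrightarrow>
     compact \<Theta> \<and>
     (\<exists>amax. AE z in \<mu>. onorm ((*v) (A z)) \<le> amax) \<and>
     pd_matrix (LINT z|\<mu>. transpose (A z) ** A z)"

definition param_equiv ::
    "'z measure \<Rightarrow> ('z \<Rightarrow> real^'m^'d) \<Rightarrow> real \<Rightarrow> real \<Rightarrow> real^'m \<Rightarrow> real^'m \<Rightarrow> bool" where
  "param_equiv \<mu> A \<sigma> \<beta> \<theta> \<theta>' \<longleftrightarrow>
     (AE y in lborel. obs_density \<mu> A \<sigma> \<beta> \<theta> y = obs_density \<mu> A \<sigma> \<beta> \<theta>' y)"

definition equiv_on ::
    "'z measure \<Rightarrow> ('z \<Rightarrow> real^'m^'d) \<Rightarrow> real \<Rightarrow> real \<Rightarrow> (real^'m) set \<Rightarrow>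
     ((real^'m) \<times> (real^'m)) set" where
  "equiv_on \<mu> A \<sigma> \<beta> U = {(\<theta>, \<theta>'). \<theta> \<in> U \<and> \<theta>' \<in> U \<and> param_equiv \<mu> A \<sigma> \<beta> \<theta> \<theta>'}"

definition param_class ::
    "'z measure \<Rightarrow> ('z \<Rightarrow> real^'m^'d) \<Rightarrow> real \<Rightarrow> real \<Rightarrow> (real^'m) set \<Rightarrow> real^'m \<Rightarrow> (real^'m) set"
  where
  "param_class \<mu> A \<sigma> \<beta> \<Theta> \<theta> = {\<theta>'\<in>\<Theta>. param_equiv \<mu> A \<sigma> \<beta> \<theta>' \<theta>}"

text \<open>A \<open>C\<^sup>2\<close> manifold structure making the projection a submersion induces the quotient topology,
  so this need not be required separately; and the dimension of the quotient is at most that of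
  \<open>\<real>\<^sup>m\<close>, so taking the model space \<open>V\<close> inside \<open>\<real>\<^sup>m\<close> is no restriction.\<close>

definition condition_Q ::
    "'z measure \<Rightarrow> ('z \<Rightarrow> real^'m^'d) \<Rightarrow> real \<Rightarrow> real \<Rightarrow> (real^'m) set \<Rightarrow> real^'m \<Rightarrow> bool" where
  "condition_Q \<mu> A \<sigma> \<beta> \<Theta> \<theta>s \<longleftrightarrow>
     (\<exists>U. open U \<and> \<theta>s \<in> U \<and> U \<subseteq> \<Theta> \<and>
        (\<exists>(V :: (real^'m) set) X \<A>.
           topspace X = U // equiv_on \<mu> A \<sigma> \<beta> U \<and>
           C2_manifold V X \<A> \<and>
           C2_submersion U V X \<A> (\<lambda>\<theta>. equiv_on \<mu> A \<sigma> \<beta> U `` {\<theta>})))"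

definition class_tangent ::
    "'z measure \<Rightarrow> ('z \<Rightarrow> real^'m^'d) \<Rightarrow> real \<Rightarrow> real \<Rightarrow> (real^'m) set \<Rightarrow> real^'m \<Rightarrow> (real^'m) set"
  where
  "class_tangent \<mu> A \<sigma> \<beta> \<Theta> \<theta>s =
     {v. \<exists>\<epsilon>>0. \<exists>\<gamma> :: real \<Rightarrow> real^'m.
           \<gamma> C1_differentiable_on {-\<epsilon><..<\<epsilon>} \<and>
           \<gamma> ` {-\<epsilon><..<\<epsilon>} \<subseteq> param_class \<mu> A \<sigma> \<beta> \<Theta> \<theta>s \<and>
           \<gamma> 0 = \<theta>s \<and> (\<gamma> has_vector_derivative v) (at 0)}"

definition transversal_space ::
    "'z measure \<Rightarrow> ('z \<Rightarrow> real^'m^'d) \<Rightarrow> real \<Rightarrow> real \<Rightarrow> (real^'m) set \<Rightarrow> real^'m \<Rightarrow> (real^'m) set"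
  where
  "transversal_space \<mu> A \<sigma> \<beta> \<Theta> \<theta>s = (class_tangent \<mu> A \<sigma> \<beta> \<Theta> \<theta>s)\<^sup>\<bottom>"


section \<open>Tensors, signal moments and the local order\<close>

text \<open>An order-\<open>k\<close> tensor over \<open>\<real>\<^sup>d\<close> is given by its entries, indexed by the lists of length \<open>k\<close>
  over \<open>'d\<close>; the entries at lists of any other length are \<open>0\<close>.\<close>

type_synonym 'd tensor = "'d list \<Rightarrow> real"

definition frob_inner :: "nat \<Rightarrow> 'd::finite tensor \<Rightarrow> 'd tensor \<Rightarrow> real" where
  "frob_inner k t u = (\<Sum>is | length is = k. t is * u is)"

definition sym_tensor :: "nat \<Rightarrow> 'd tensor \<Rightarrow> bool" where
  "sym_tensor k t \<longleftrightarrow>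
     (\<forall>is. length is \<noteq> k \<longrightarrow> t is = 0) \<and> (\<forall>is js. mset is = mset js \<longrightarrow> t is = t js)"

definition signal_moment ::
    "'z measure \<Rightarrow> ('z \<Rightarrow> real^'m^'d) \<Rightarrow> nat \<Rightarrow> real^'m \<Rightarrow> 'd tensor" where
  "signal_moment \<mu> A k \<theta> is =
     (if length is = k then (LINT z|\<mu>. prod_list (map (\<lambda>i. (A z *v \<theta>) $ i) is)) else 0)"

definition D_signal_moment ::
    "'z measure \<Rightarrow> ('z \<Rightarrow> real^'m^'d) \<Rightarrow> nat \<Rightarrow> real^'m \<Rightarrow> real^'m \<Rightarrow> 'd tensor" where
  "D_signal_moment \<mu> A k \<theta>s h is =
     frechet_derivative (\<lambda>\<theta>. signal_moment \<mu> A k \<theta> is) (at \<theta>s) h"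

text \<open>The infimum of the empty set in \<open>enat\<close> is \<open>\<infinity>\<close>.\<close>

definition moment_order ::
    "'z measure \<Rightarrow> ('z \<Rightarrow> real^'m^'d) \<Rightarrow> real^'m \<Rightarrow> real^'m \<Rightarrow> enat" where
  "moment_order \<mu> A \<theta>s h =
     Inf (enat ` {j. 1 \<le> j \<and> D_signal_moment \<mu> A j \<theta>s h \<noteq> (\<lambda>is. 0)})"

text \<open>The supremum is a maximum: for each \<open>j\<close> the directions of order greater than \<open>j\<close>, together
  with \<open>0\<close>, form a linear subspace, so only finitely many orders occur.\<close>

definition local_order ::
    "'z measure \<Rightarrow> ('z \<Rightarrow> real^'m^'d) \<Rightarrow> real \<Rightarrow> real \<Rightarrow> (real^'m) set \<Rightarrow> real^'m \<Rightarrow> enat" where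
  "local_order \<mu> A \<sigma> \<beta> \<Theta> \<theta>s =
     (SUP h \<in> transversal_space \<mu> A \<sigma> \<beta> \<Theta> \<theta>s - {0}. moment_order \<mu> A \<theta>s h)"


section \<open>Hermite features\<close>

primrec iter_partial :: "'d::finite list \<Rightarrow> (real^'d \<Rightarrow> real) \<Rightarrow> real^'d \<Rightarrow> real" where
  "iter_partial [] f = f"
| "iter_partial (i # is) f = (\<lambda>x. frechet_derivative (iter_partial is f) (at x) (axis i 1))"

definition hermite_tensor :: "nat \<Rightarrow> real^'d \<Rightarrow> 'd::finite tensor" where
  "hermite_tensor k x is =
     (if length is = k
      then (-1) ^ k * exp ((norm x)\<^sup>2 / 2) * iter_partial is (\<lambda>u. exp (- (norm u)\<^sup>2 / 2)) x
      else 0)"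

text \<open>Coordinates of the stacked features are indexed by a finite type \<open>'k\<close>. The coordinate \<open>\<kappa>\<close>
  belongs to the basis tensor \<open>e \<kappa>\<close> of order \<open>ord \<kappa>\<close>, and for each \<open>j\<close> in \<open>{1..L}\<close> the tensors
  of order \<open>j\<close> form a Frobenius-orthonormal basis of the symmetric order-\<open>j\<close> tensors.\<close>

definition sym_tensor_bases :: "nat \<Rightarrow> ('k \<Rightarrow> nat) \<Rightarrow> ('k::finite \<Rightarrow> 'd::finite tensor) \<Rightarrow> bool" where
  "sym_tensor_bases L ord e \<longleftrightarrow>
     (\<forall>\<kappa>. ord \<kappa> \<in> {1..L} \<and> sym_tensor (ord \<kappa>) (e \<kappa>)) \<and>
     (\<forall>\<kappa> \<kappa>'. ord \<kappa> = ord \<kappa>' \<longrightarrow> frob_inner (ord \<kappa>) (e \<kappa>) (e \<kappa>') = (if \<kappa> = \<kappa>' then 1 else 0)) \<and>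
     (\<forall>j\<in>{1..L}. \<forall>t. sym_tensor j t \<longrightarrow>
        (\<exists>c. \<forall>is. t is = (\<Sum>\<kappa> | ord \<kappa> = j. c \<kappa> * e \<kappa> is)))"

definition feature ::
    "real \<Rightarrow> ('k \<Rightarrow> nat) \<Rightarrow> ('k::finite \<Rightarrow> 'd::finite tensor) \<Rightarrow> real^'d \<Rightarrow> real^'k" where
  "feature \<sigma> ord e y = (\<chi> \<kappa>. frob_inner (ord \<kappa>) (e \<kappa>) (hermite_tensor (ord \<kappa>) ((1 / \<sigma>) *\<^sub>R y)))"

definition empirical_feature :: "(real^'d \<Rightarrow> real^'k) \<Rightarrow> nat \<Rightarrow> (nat \<Rightarrow> real^'d) \<Rightarrow> real^'k" where
  "empirical_feature \<psi> n ys = (1 / real n) *\<^sub>R (\<Sum>i=1..n. \<psi> (ys i))"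

definition mean_feature ::
    "'z measure \<Rightarrow> ('z \<Rightarrow> real^'m^'d) \<Rightarrow> real \<Rightarrow> real \<Rightarrow> (real^'d \<Rightarrow> real^'k) \<Rightarrow> real^'m \<Rightarrow> real^'k"
  where
  "mean_feature \<mu> A \<sigma> \<beta> \<psi> \<theta> = integral\<^sup>L (obs_law \<mu> A \<sigma> \<beta> \<theta>) \<psi>"

definition cov_feature ::
    "'z measure \<Rightarrow> ('z \<Rightarrow> real^'m^'d) \<Rightarrow> real \<Rightarrow> real \<Rightarrow> (real^'d \<Rightarrow> real^'k) \<Rightarrow> real^'m \<Rightarrow> real^'k^'k"
  where
  "cov_feature \<mu> A \<sigma> \<beta> \<psi> \<theta> =
     (\<chi> \<kappa> \<kappa>'. LINT y|obs_law \<mu> A \<sigma> \<beta> \<theta>.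
        (\<psi> y $ \<kappa> - mean_feature \<mu> A \<sigma> \<beta> \<psi> \<theta> $ \<kappa>) *
        (\<psi> y $ \<kappa>' - mean_feature \<mu> A \<sigma> \<beta> \<psi> \<theta> $ \<kappa>'))"


section \<open>The generalized method of moments\<close>

definition gmom_objective ::
    "'z measure \<Rightarrow> ('z \<Rightarrow> real^'m^'d) \<Rightarrow> real \<Rightarrow> real \<Rightarrow> (real^'d \<Rightarrow> real^'k) \<Rightarrow> real^'k^'k \<Rightarrow>
     nat \<Rightarrow> (nat \<Rightarrow> real^'d) \<Rightarrow> real^'m \<Rightarrow> real" where
  "gmom_objective \<mu> A \<sigma> \<beta> \<psi> \<Omega> n ys \<theta> =
     (empirical_feature \<psi> n ys - mean_feature \<mu> A \<sigma> \<beta> \<psi> \<theta>) \<bullet>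
     (\<Omega> *v (empirical_feature \<psi> n ys - mean_feature \<mu> A \<sigma> \<beta> \<psi> \<theta>))"

text \<open>As an operator on the Euclidean space \<open>W\<close>, the transpose of the restriction of \<open>DM\<close> to \<open>W\<close> is
  the transpose of \<open>DM\<close> followed by the orthogonal projection onto \<open>W\<close>.\<close>

definition gmom_information ::
    "'z measure \<Rightarrow> ('z \<Rightarrow> real^'m^'d) \<Rightarrow> real \<Rightarrow> real \<Rightarrow> (real^'d \<Rightarrow> real^'k) \<Rightarrow> (real^'m) set \<Rightarrow>
     real^'m \<Rightarrow> real^'m \<Rightarrow> real^'m" where
  "gmom_information \<mu> A \<sigma> \<beta> \<psi> W \<theta>s h =
     (let DM = frechet_derivative (mean_feature \<mu> A \<sigma> \<beta> \<psi>) (at \<theta>s)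
      in orth_proj W (adjoint DM (matrix_inv (cov_feature \<mu> A \<sigma> \<beta> \<psi> \<theta>s) *v DM h)))"

text \<open>The inverse of the information operator on \<open>W\<close>, extended by \<open>0\<close> to the orthogonal complement
  of \<open>W\<close>: a normal law on \<open>W\<close> is a normal law on \<open>\<real>\<^sup>m\<close> with this covariance.\<close>

definition gmom_covariance ::
    "'z measure \<Rightarrow> ('z \<Rightarrow> real^'m^'d) \<Rightarrow> real \<Rightarrow> real \<Rightarrow> (real^'d \<Rightarrow> real^'k) \<Rightarrow> (real^'m) set \<Rightarrow>
     real^'m \<Rightarrow> real^'m \<Rightarrow> real^'m" where
  "gmom_covariance \<mu> A \<sigma> \<beta> \<psi> W \<theta>s h =
     inv_into W (gmom_information \<mu> A \<sigma> \<beta> \<psi> W \<theta>s) (orth_proj W h)"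

text \<open>A measurable choice, for each \<open>n \<ge> 1\<close>, of an element of the equivalence class of the
  estimator \<open>\<theta>h n\<close>, converging to \<open>\<theta>s\<close>.\<close>

definition convergent_representative ::
    "'w measure \<Rightarrow> 'z measure \<Rightarrow> ('z \<Rightarrow> real^'m^'d) \<Rightarrow> real \<Rightarrow> real \<Rightarrow> (real^'m) set \<Rightarrow> real^'m \<Rightarrow>
     (nat \<Rightarrow> 'w \<Rightarrow> real^'m) \<Rightarrow> (nat \<Rightarrow> 'w \<Rightarrow> real^'m) \<Rightarrow> bool" where
  "convergent_representative P \<mu> A \<sigma> \<beta> \<Theta> \<theta>s \<theta>h \<theta>r \<longleftrightarrow>
     (\<forall>n\<ge>1. \<theta>r n \<in> borel_measurable P \<and>
        (\<forall>\<omega>\<in>space P. \<theta>r n \<omega> \<in> param_class \<mu> A \<sigma> \<beta> \<Theta> (\<theta>h n \<omega>))) \<and>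
     conv_in_prob P \<theta>r \<theta>s"

end

theory Submission
  imports Defs "HOL-Computational_Algebra.Polynomial"
begin

text \<open>The moment map \<open>M\<close> is a polynomial map in \<open>\<theta>\<close>, because the mean of a Hermite tensor of a Gaussian
  is a tensor power of its mean. It is constant on equivalence classes, and the order condition says
  that its derivative \<open>D\<close> at \<open>\<theta>s\<close> is injective on \<open>W\<close>. The chart of the quotient provides, by the
  inverse function theorem, a continuous map that moves each parameter near \<open>\<theta>s\<close> inside its class
  to the slice \<open>\<theta>s + W\<close>; the representative is chosen there, since an arbitrary convergent
  representative may drift along the curved class and spoil the rate of its \<open>W\<close>-component. On the
  slice the first-order condition of the minimization gives
  \<open>\<theta>r - \<theta>s = I\<^sup>-\<^sup>1 D\<^sup>T \<Sigma>\<^sup>-\<^sup>1 a + o(\<bar>a\<bar>)\<close>, where \<open>a\<close> is the error of the empirical moments, and the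
  central limit theorem for \<open>a\<close> carries over.\<close>

section \<open>Weak convergence from characteristic functions\<close>

text \<open>No rate for \<open>\<theta>r - \<theta>s\<close> is proved beforehand: stationarity at a
  point close to \<open>\<theta>s\<close> already bounds the linearization error by an arbitrarily
  small multiple of the norm of \<open>a\<close>, so consistency together with tightness of
  \<open>sqrt n * a\<close> suffices. Three facts make the stationarity equation usable on the
  slice. \<open>M\<close> is constant on classes, so the moved representative minimizes the
  objective as well; the neighborhood in (Q) is open and contained in \<open>\<Theta>\<close>, so
  the boundary of \<open>\<Theta>\<close> is not met near \<open>\<theta>s\<close>; and testing
  against directions in \<open>W\<close> alone determines the displacement, because the
  order-\<open>j\<close> block of \<open>D h\<close> is a nonzero multiple of the coordinates of the
  derivative of \<open>T_j\<close>, and \<open>L\<close> reaches the local order. The limit law is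
  the image of the normal limit of \<open>sqrt n * a\<close> under a linear map, and its sandwich
  covariance collapses to the inverse information because the weights converge to the inverse of the
  feature covariance. Vector limit theorems come from pointwise convergence of characteristic
  functions, hence from scalar projections.\<close>

inductive trig_poly :: "('b::euclidean_space \<Rightarrow> real) \<Rightarrow> bool" where
  wave: "trig_poly (\<lambda>x. a * cos (t \<bullet> x + c))"
| add: "trig_poly f \<Longrightarrow> trig_poly g \<Longrightarrow> trig_poly (\<lambda>x. f x + g x)"

lemma trig_poly_const: "trig_poly (\<lambda>x::'b::euclidean_space. a)"
  using trig_poly.wave[of a "0::'b" 0] by simp

lemma trig_poly_sum:
  "finite I \<Longrightarrow> (\<And>i. i \<in> I \<Longrightarrow> trig_poly (f i)) \<Longrightarrow> trig_poly (\<lambda>x. \<Sum>i\<in>I. f i x)"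
  by (induction I rule: finite_induct) (auto intro: trig_poly_const trig_poly.add)

text \<open>Product-to-sum: multiplying waves of frequencies \<open>t'\<close> and \<open>t\<close>
  gives waves of frequencies \<open>t' - t\<close> and \<open>t' + t\<close>. The free phase
  \<open>c\<close> lets a single constructor cover sines as well as cosines, and closure under
  products makes the class an algebra.\<close>

lemma trig_poly_mult_wave:
  assumes "trig_poly f"
  shows "trig_poly (\<lambda>x. f x * (a * cos (t \<bullet> x + c)))"
  using assms
proof induction
  case (wave a' t' c')
  have *: "(a' * cos (t' \<bullet> x + c')) * (a * cos (t \<bullet> x + c)) =
      (a' * a / 2) * cos ((t' - t) \<bullet> x + (c' - c)) + (a' * a / 2) * cos ((t' + t) \<bullet> x + (c' + c))" for x
  proof -
    have "cos (t' \<bullet> x + c') * cos (t \<bullet> x + c) =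
       (cos ((t' - t) \<bullet> x + (c' - c)) + cos ((t' + t) \<bullet> x + (c' + c))) / 2"
      by (subst cos_times_cos) (simp add: inner_diff_left inner_add_left algebra_simps)
    then show ?thesis by (simp add: field_simps)
  qed
  show ?case unfolding * by (intro trig_poly.intros)
next
  case (add f g)
  then show ?case by (simp add: distrib_right trig_poly.add)
qed

lemma trig_poly_mult:
  assumes "trig_poly f" "trig_poly g"
  shows "trig_poly (\<lambda>x. f x * g x)"
  using assms(2)
proof induction
  case (wave a t c)
  then show ?case by (rule trig_poly_mult_wave[OF assms(1)])
next
  case (add f g)
  then show ?case by (simp add: distrib_left trig_poly.add)
qed

lemma trig_poly_bounded_continuous:
  assumes "trig_poly f"
  shows "continuous_on UNIV f \<and> (\<exists>B. \<forall>x. \<bar>f x\<bar> \<le> B)"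
  using assms
proof induction
  case (wave a t c)
  have "\<bar>a * cos (t \<bullet> x + c)\<bar> \<le> \<bar>a\<bar>" for x
    by (simp add: abs_mult mult_left_le)
  then show ?case by (auto intro!: continuous_intros)
next
  case (add f g)
  then obtain B1 B2 where "\<forall>x. \<bar>f x\<bar> \<le> B1" "\<forall>x. \<bar>g x\<bar> \<le> B2" by auto
  then have "\<bar>f x + g x\<bar> \<le> B1 + B2" for x
    by (meson abs_triangle_ineq add_mono order_trans)
  then show ?case using add by (auto intro!: continuous_intros)
qed

text \<open>The covering of the torus with period \<open>2 * r\<close> in each coordinate, embedded
  by cosines and sines. It turns ordinary polynomial approximation on a compact set into
  approximation by periodic trigonometric polynomials.\<close>

definition torus_map :: "real \<Rightarrow> 'b::euclidean_space \<Rightarrow> 'b \<times> 'b" where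
  "torus_map r x = ((\<Sum>b\<in>Basis. cos (pi * (x \<bullet> b) / r) *\<^sub>R b), (\<Sum>b\<in>Basis. sin (pi * (x \<bullet> b) / r) *\<^sub>R b))"

lemma continuous_torus_map: "continuous_on S (torus_map r)"
  unfolding torus_map_def divide_inverse by (intro continuous_intros)

lemma trig_poly_torus_map:
  fixes p :: "'b::euclidean_space \<times> 'b \<Rightarrow> real"
  assumes "real_polynomial_function p"
  shows "trig_poly (\<lambda>x. p (torus_map r x))"
  using assms
proof (induction p rule: real_polynomial_function.induct)
  case (linear f)
  interpret bounded_linear f by fact
  have split: "(u, v) = (u, 0) + (0, v)" for u v :: 'b by simp
  \<comment> \<open>Only linear functionals need work; a sine is a wave with phase
    \<open>- pi/2\<close>.\<close>
  have *: "f (torus_map r x) = (\<Sum>b\<in>Basis. f (b, 0) * cos ((pi / r) *\<^sub>R b \<bullet> x + 0)) +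
      (\<Sum>b\<in>Basis. f (0, b) * cos ((pi / r) *\<^sub>R b \<bullet> x + (- (pi/2))))" for x
  proof -
    have 1: "(\<Sum>b\<in>Basis. u b *\<^sub>R b, 0::'b) = (\<Sum>b\<in>Basis. u b *\<^sub>R (b, 0))" for u :: "'b \<Rightarrow> real"
      by (simp add: prod_eq_iff fst_sum snd_sum)
    have 2: "(0::'b, \<Sum>b\<in>Basis. u b *\<^sub>R b) = (\<Sum>b\<in>Basis. u b *\<^sub>R (0, b))" for u :: "'b \<Rightarrow> real"
      by (simp add: prod_eq_iff fst_sum snd_sum)
    have "f (torus_map r x) = (\<Sum>b\<in>Basis. cos (pi * (x \<bullet> b) / r) * f (b, 0)) + (\<Sum>b\<in>Basis. sin (pi * (x \<bullet> b) / r) * f (0, b))"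
      unfolding torus_map_def
      by (subst split, subst add, subst 1, subst 2) (simp add: sum scaleR del: scaleR_Pair)
    then show ?thesis
      by (simp add: mult.commute inner_commute cos_diff)
  qed
  show ?case unfolding * by (intro trig_poly.add trig_poly_sum trig_poly.wave) auto
next
  case (const c)
  then show ?case by (rule trig_poly_const)
next
  case (add f g)
  then show ?case by (intro trig_poly.add)
next
  case (mult f g)
  then show ?case by (intro trig_poly_mult)
qed

text \<open>Points of the cube with the same image differ by multiples of \<open>2 * r\<close> in each coordinate.\<close>

lemma torus_map_eq_imp:
  fixes x x' :: "'b::euclidean_space"
  assumes "r > 0" and q: "torus_map r x = torus_map r x'"
    and cube: "\<And>b. b \<in> Basis \<Longrightarrow> \<bar>x \<bullet> b\<bar> \<le> r" "\<And>b. b \<in> Basis \<Longrightarrow> \<bar>x' \<bullet> b\<bar> \<le> r"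
  shows "x = x' \<or> (norm x \<ge> r \<and> norm x' \<ge> r)"
proof (cases "x = x'")
  case False
  then obtain b where b: "b \<in> Basis" "x \<bullet> b \<noteq> x' \<bullet> b"
    using euclidean_eq_iff by blast
  have "fst (torus_map r x) \<bullet> b = fst (torus_map r x') \<bullet> b" "snd (torus_map r x) \<bullet> b = snd (torus_map r x') \<bullet> b"
    using q by simp_all
  then have "cos (pi * (x \<bullet> b) / r) = cos (pi * (x' \<bullet> b) / r) " "sin (pi * (x \<bullet> b) / r) = sin (pi * (x' \<bullet> b) / r)"
    using b(1) by (simp_all add: torus_map_def inner_sum_left inner_Basis if_distrib cong: if_cong)
  then obtain n :: int where n: "pi * (x \<bullet> b) / r = pi * (x' \<bullet> b) / r + 2 * pi * n"
    using sin_cos_eq_iff[of "pi * (x \<bullet> b) / r" "pi * (x' \<bullet> b) / r"] by auto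
  then have "pi * (x \<bullet> b) = pi * ((x' \<bullet> b) + 2 * r * n)"
    using \<open>r > 0\<close> by (simp add: field_simps)
  then have n': "x \<bullet> b = x' \<bullet> b + 2 * r * n" by simp
  have "n \<noteq> 0" using n' b by auto
  then have "\<bar>real_of_int n\<bar> \<ge> 1" by linarith
  then have "2 * r \<le> \<bar>2 * r * n\<bar>" using \<open>r > 0\<close> by (simp add: abs_mult)
  then have "2 * r \<le> \<bar>x \<bullet> b - x' \<bullet> b\<bar>" using n' by simp
  \<comment> \<open>Two numbers in \<open>[-r, r]\<close> at distance at least \<open>2 * r\<close>
    are the two endpoints.\<close>
  then have "\<bar>x \<bullet> b\<bar> \<ge> r" "\<bar>x' \<bullet> b\<bar> \<ge> r" using cube[OF b(1)] by linarith+
  then have "norm x \<ge> r" "norm x' \<ge> r" using Basis_le_norm[OF b(1)] order_trans by blast+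
  then show ?thesis by simp
qed auto

text \<open>Each coordinate is reduced modulo \<open>2 * r\<close> by subtracting the nearest
  multiple. Bounds proved on the cube thus hold on the whole space for functions of
  \<open>torus_map r\<close>.\<close>

lemma torus_map_in_cube:
  fixes x :: "'b::euclidean_space"
  assumes "r > 0"
  shows "\<exists>x'. (\<forall>b\<in>Basis. \<bar>x' \<bullet> b\<bar> \<le> r) \<and> torus_map r x' = torus_map r x"
proof -
  define n where "n b = \<lfloor>(x \<bullet> b + r) / (2 * r)\<rfloor>" for b
  define x' where "x' = (\<Sum>b\<in>Basis. (x \<bullet> b - 2 * r * n b) *\<^sub>R b)"
  have x': "x' \<bullet> b = x \<bullet> b - 2 * r * n b" if "b \<in> Basis" for b
    using that by (simp add: x'_def)
  show ?thesis
  proof (intro exI conjI ballI)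
    fix b :: 'b assume b: "b \<in> Basis"
    have "real_of_int (n b) \<le> (x \<bullet> b + r) / (2 * r)" "(x \<bullet> b + r) / (2 * r) < real_of_int (n b) + 1"
      unfolding n_def by linarith+
    then have "real_of_int (n b) * (2 * r) \<le> x \<bullet> b + r" "x \<bullet> b + r < (real_of_int (n b) + 1) * (2 * r)"
      using assms by (simp_all add: field_simps)
    then show "\<bar>x' \<bullet> b\<bar> \<le> r" unfolding x'[OF b] by (simp add: algebra_simps abs_le_iff)
  next
    have *: "pi * (x' \<bullet> b) / r = pi * (x \<bullet> b) / r - 2 * pi * n b" if "b \<in> Basis" for b
      using assms unfolding x'[OF that] by (simp add: field_simps)
    have "cos (pi * (x' \<bullet> b) / r) = cos (pi * (x \<bullet> b) / r)" "sin (pi * (x' \<bullet> b) / r) = sin (pi * (x \<bullet> b) / r)" if "b \<in> Basis" for b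
      unfolding *[OF that]
      using cos_int_2pin[of "n b"] sin_int_2pin[of "n b"] by (simp_all add: cos_diff sin_diff)
    then show "torus_map r x' = torus_map r x"
      unfolding torus_map_def by (auto intro!: sum.cong)
  qed
qed

text \<open>\<open>f\<close> is cut off to a \<open>g\<close> that vanishes for norm at least
  \<open>R\<close>. Distinct points of the cube that the torus identifies have norm at least
  \<open>R\<close>, so \<open>g\<close> factors through the torus as \<open>F\<close>;
  Stone-Weierstrass approximates \<open>F\<close> there, and periodicity carries the bound
  \<open>B + \<epsilon>\<close> to all points.\<close>

lemma trig_poly_approx:
  fixes f :: "'b::euclidean_space \<Rightarrow> real"
  assumes f: "continuous_on UNIV f" and B: "\<And>x. \<bar>f x\<bar> \<le> B" and "r > 0" "\<epsilon> > 0"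
  obtains h where "trig_poly h" "\<And>x. \<bar>h x\<bar> \<le> B + \<epsilon>" "\<And>x. norm x \<le> r \<Longrightarrow> \<bar>f x - h x\<bar> \<le> \<epsilon>"
proof -
  define R where "R = r + 1"
  have "R > 0" using \<open>r > 0\<close> by (simp add: R_def)
  define g where "g x = f x * max 0 (min 1 (R - norm x))" for x
  have g_cont: "continuous_on UNIV g"
    unfolding g_def by (intro continuous_intros f)
  have g_B: "\<bar>g x\<bar> \<le> B" for x
  proof -
    have "\<bar>g x\<bar> \<le> \<bar>f x\<bar> * 1" unfolding g_def abs_mult by (intro mult_left_mono) auto
    then show ?thesis using B[of x] by simp
  qed
  have g_f: "g x = f x" if "norm x \<le> r" for x using that by (simp add: g_def R_def)
  have g_0: "g x = 0" if "norm x \<ge> R" for x using that by (simp add: g_def)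
  define S :: "'b set" where "S = {x. \<forall>b\<in>Basis. \<bar>x \<bullet> b\<bar> \<le> R}"
  have S_box: "S = cbox (- R *\<^sub>R One) (R *\<^sub>R One)"
    unfolding S_def by (auto simp: mem_box abs_le_iff) (force simp: )+
  have S: "compact S" unfolding S_box by (rule compact_cbox)
  define q :: "'b \<Rightarrow> 'b \<times> 'b" where "q = torus_map R"
  have q: "continuous_on T q" for T unfolding q_def by (rule continuous_torus_map)
  \<comment> \<open>Any preimage may be chosen, since \<open>g\<close> takes the same value on all
    preimages in the cube.\<close>
  define F where "F y = g (SOME x. x \<in> S \<and> q x = y)" for y
  have Fq: "F (q x) = g x" if "x \<in> S" for x
  proof -
    define x' where "x' = (SOME x'. x' \<in> S \<and> q x' = q x)"
    have "x' \<in> S \<and> q x' = q x" unfolding x'_def by (rule someI[of _ x]) (use that in simp)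
    then have "x' = x \<or> (norm x' \<ge> R \<and> norm x \<ge> R)"
      using torus_map_eq_imp[of R x' x] \<open>R > 0\<close> that by (auto simp: q_def S_def)
    then have "g x' = g x" using g_0 by auto
    then show ?thesis by (simp add: F_def x'_def)
  qed
  have F_cont: "continuous_on (q ` S) F"
    unfolding continuous_on_closed_vimage[OF compact_imp_closed[OF compact_continuous_image[OF q S]]]
  proof (intro allI impI)
    fix C :: "real set" assume C: "closed C"
    have "F -` C \<inter> q ` S = q ` (S \<inter> g -` C)"
      using Fq by auto
    moreover have "closed (g -` C)" using C g_cont by (rule closed_vimage)
    ultimately show "closed (F -` C \<inter> q ` S)"
      by (simp add: S compact_Int_closed compact_continuous_image compact_imp_closed q)
  qed
  obtain p where p: "real_polynomial_function p" "\<And>y. y \<in> q ` S \<Longrightarrow> \<bar>F y - p y\<bar> < \<epsilon>"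
    using Stone_Weierstrass_real_polynomial_function[OF compact_continuous_image[OF q S] F_cont \<open>\<epsilon> > 0\<close>] by metis
  show ?thesis
  proof
    show "trig_poly (\<lambda>x. p (q x))" unfolding q_def by (rule trig_poly_torus_map[OF p(1)])
    show "\<bar>p (q x)\<bar> \<le> B + \<epsilon>" for x
    proof -
      obtain x' where x': "\<forall>b\<in>Basis. \<bar>x' \<bullet> b\<bar> \<le> R" "torus_map R x' = torus_map R x"
        using torus_map_in_cube[OF \<open>R > 0\<close>, of x] by auto
      then have "x' \<in> S" "q x' = q x" by (simp_all add: S_def q_def)
      then have "\<bar>g x' - p (q x)\<bar> < \<epsilon>" using p(2)[of "q x'"] Fq[of x'] by (metis imageI)
      then show ?thesis using g_B[of x'] by linarith
    qed
    show "\<bar>f x - p (q x)\<bar> \<le> \<epsilon>" if "norm x \<le> r" for x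
    proof -
      have "x \<in> S" using that Basis_le_norm[of _ x] by (fastforce simp: S_def R_def)
      then have "\<bar>g x - p (q x)\<bar> < \<epsilon>" using p(2)[of "q x"] Fq[of x] by force
      then show ?thesis using g_f[OF that] by simp
    qed
  qed
qed


text \<open>A continuous majorant of the indicator of large norm, written as a sum of functions of
  single coordinates so that its integrals are controlled by one-dimensional weak
  convergence.\<close>

definition tail_fun :: "real \<Rightarrow> 'b::euclidean_space \<Rightarrow> real" where
  "tail_fun k x = (\<Sum>b\<in>Basis. min 1 (max 0 (\<bar>b \<bullet> x\<bar> - k)))"

lemma tail_fun_nonneg: "0 \<le> tail_fun k x"
  unfolding tail_fun_def by (intro sum_nonneg) auto

lemma tail_fun_le: "tail_fun k (x::'b::euclidean_space) \<le> DIM('b)"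
  unfolding tail_fun_def using sum_bounded_above[of "Basis::'b set" "\<lambda>b. min 1 (max 0 (\<bar>b \<bullet> x\<bar> - k))" 1] by auto

lemma continuous_tail_fun: "continuous_on S (tail_fun k)"
  unfolding tail_fun_def by (intro continuous_intros)

lemma tail_fun_ge_1:
  fixes x :: "'b::euclidean_space"
  assumes "norm x > (k + 1) * real (DIM('b))"
  shows "1 \<le> tail_fun k x"
proof -
  have "\<exists>b\<in>Basis. \<bar>x \<bullet> b\<bar> > k + 1"
  proof (rule ccontr)
    assume "\<not> ?thesis"
    then have "(\<Sum>b\<in>Basis. \<bar>x \<bullet> b\<bar>) \<le> (\<Sum>b\<in>(Basis::'b set). k + 1)"
      by (intro sum_mono) force
    then show False using norm_le_l1[of x] assms by (simp add: algebra_simps)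
  qed
  then obtain b where b: "b \<in> Basis" "\<bar>b \<bullet> x\<bar> > k + 1" by (auto simp: inner_commute)
  have "1 = min 1 (max 0 (\<bar>b \<bullet> x\<bar> - k))" using b by simp
  also have "\<dots> \<le> tail_fun k x"
    unfolding tail_fun_def by (rule member_le_sum) (use b in auto)
  finally show ?thesis .
qed

lemma tail_fun_tendsto_0: "(\<lambda>k. tail_fun (real k) x) \<longlonglongrightarrow> 0"
proof -
  obtain m :: nat where m: "norm x \<le> m" using real_arch_simple by blast
  have "tail_fun (real k) x = 0" if "k \<ge> m" for k
  proof -
    have "\<bar>b \<bullet> x\<bar> \<le> k" if "b \<in> Basis" for b
      using Basis_le_norm[OF that, of x] m \<open>k \<ge> m\<close> by (simp add: inner_commute)
    then show ?thesis unfolding tail_fun_def by (intro sum.neutral) auto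
  qed
  then show ?thesis
    by (intro tendsto_eventually eventually_sequentiallyI[of m])
qed

text \<open>Convergence of characteristic functions is only needed pointwise: Levy's one-dimensional
  continuity theorem makes the coordinates tight, and on a large cube a continuous function is
  uniformly close to a trigonometric polynomial, which moreover is bounded on the whole space
  because it is periodic.\<close>

theorem weak_conv_vec_if_char:
  fixes N :: "nat \<Rightarrow> 'b::euclidean_space measure" and \<nu> :: "'b measure"
  assumes N: "\<And>n. prob_space (N n)" "\<And>n. sets (N n) = sets borel"
    and \<nu>: "prob_space \<nu>" "sets \<nu> = sets borel"
    and cos: "\<And>t. (\<lambda>n. \<integral>x. cos (t \<bullet> x) \<partial>N n) \<longlonglongrightarrow> (\<integral>x. cos (t \<bullet> x) \<partial>\<nu>)"
    and sin: "\<And>t. (\<lambda>n. \<integral>x. sin (t \<bullet> x) \<partial>N n) \<longlonglongrightarrow> (\<integral>x. sin (t \<bullet> x) \<partial>\<nu>)"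
  shows "weak_conv_vec N \<nu>"
proof -
  have bint: "integrable M f" if "prob_space M" "sets M = sets borel" "continuous_on UNIV f" "\<And>x. \<bar>f x\<bar> \<le> B"
    for M :: "'b measure" and f :: "'b \<Rightarrow> real" and B
  proof -
    interpret prob_space M by fact
    have "f \<in> borel_measurable M"
      using borel_measurable_continuous_onI[OF that(3)] measurable_cong_sets[OF that(2) refl] by blast
    then show ?thesis using that(4) by (intro integrable_const_bound[of _ B]) auto
  qed
  have trig_int: "integrable M (\<lambda>x. cos (t \<bullet> x))" "integrable M (\<lambda>x. sin (t \<bullet> x))"
    if "prob_space M" "sets M = sets borel" for M and t :: 'b
    by (rule bint[OF that, of _ 1]; auto intro!: continuous_intros)+
  have trig: "(\<lambda>n. integral\<^sup>L (N n) f) \<longlonglongrightarrow> integral\<^sup>L \<nu> f" if "trig_poly f" for f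
    using that
  proof induction
    case (wave a t c)
    have *: "a * cos (t \<bullet> x + c) = (a * cos c) * cos (t \<bullet> x) - (a * sin c) * sin (t \<bullet> x)" for x
      by (simp add: cos_add algebra_simps)
    have "integral\<^sup>L M (\<lambda>x. a * cos (t \<bullet> x + c)) =
        (a * cos c) * (\<integral>x. cos (t \<bullet> x) \<partial>M) - (a * sin c) * (\<integral>x. sin (t \<bullet> x) \<partial>M)"
      if "prob_space M" "sets M = sets borel" for M
      unfolding * using trig_int[OF that, of t] by (subst Bochner_Integration.integral_diff) auto
    then show ?case using N \<nu> by (simp add: tendsto_intros cos sin)
  next
    case (add f g)
    have fg: "integrable M f" "integrable M g" if "prob_space M" "sets M = sets borel" for M
      using trig_poly_bounded_continuous[OF add(1)] trig_poly_bounded_continuous[OF add(2)] bint[OF that] by blast+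
    show ?case
      using add fg N \<nu> by (simp add: tendsto_add)
  qed
  \<comment> \<open>The characteristic function of the marginal along \<open>b\<close> at
    \<open>s\<close> is the trigonometric integral at \<open>s *\<^sub>R b\<close>, so the scalar
    continuity theorem applies.\<close>
  have coord: "(\<lambda>n. \<integral>x. g (b \<bullet> x) \<partial>N n) \<longlonglongrightarrow> (\<integral>x. g (b \<bullet> x) \<partial>\<nu>)"
    if g: "\<And>u. isCont g u" "\<And>u. norm (g u) \<le> B" for g :: "real \<Rightarrow> real" and b :: 'b and B
  proof -
    have m: "(\<lambda>x. b \<bullet> x) \<in> borel_measurable M" if "sets M = sets borel" for M :: "'b measure"
      by (subst measurable_cong_sets[OF that refl]) measurable
    have rd: "real_distribution (distr M borel (\<lambda>x. b \<bullet> x))" if "prob_space M" "sets M = sets borel" for M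
    proof -
      interpret prob_space M by fact
      show ?thesis by (rule real_distribution_distr) (rule m[OF that(2)])
    qed
    have ch: "char (distr M borel (\<lambda>x. b \<bullet> x)) s =
        of_real (\<integral>x. cos ((s *\<^sub>R b) \<bullet> x) \<partial>M) + \<i> * of_real (\<integral>x. sin ((s *\<^sub>R b) \<bullet> x) \<partial>M)"
      if M: "prob_space M" "sets M = sets borel" for M s
    proof -
      have "char (distr M borel (\<lambda>x. b \<bullet> x)) s = (CLINT x|M. iexp (s * (b \<bullet> x)))"
        unfolding char_def by (subst integral_distr) (use m[OF that(2)] in auto)
      also have "\<dots> = (CLINT x|M. of_real (cos ((s *\<^sub>R b) \<bullet> x)) + \<i> * of_real (sin ((s *\<^sub>R b) \<bullet> x)))"
        by (intro Bochner_Integration.integral_cong refl) (simp add: exp_Euler flip: cos_of_real sin_of_real of_real_mult)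
      also have "\<dots> = of_real (\<integral>x. cos ((s *\<^sub>R b) \<bullet> x) \<partial>M) + \<i> * of_real (\<integral>x. sin ((s *\<^sub>R b) \<bullet> x) \<partial>M)"
        using trig_int[OF M, of "s *\<^sub>R b"] by (subst Bochner_Integration.integral_add) auto
      finally show ?thesis .
    qed
    have wc: "weak_conv_m (\<lambda>n. distr (N n) borel (\<lambda>x. b \<bullet> x)) (distr \<nu> borel (\<lambda>x. b \<bullet> x))"
    proof (rule levy_continuity)
      show "(\<lambda>n. char (distr (N n) borel (\<lambda>x. b \<bullet> x)) t) \<longlonglongrightarrow> char (distr \<nu> borel (\<lambda>x. b \<bullet> x)) t" for t
        unfolding ch[OF N] ch[OF \<nu>] by (intro tendsto_intros cos sin)
    qed (use rd N \<nu> in auto)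
    have "(\<lambda>n. integral\<^sup>L (distr (N n) borel (\<lambda>x. b \<bullet> x)) g) \<longlonglongrightarrow> integral\<^sup>L (distr \<nu> borel (\<lambda>x. b \<bullet> x)) g"
      by (rule weak_conv_imp_integral_bdd_continuous_conv[OF _ _ wc g]) (use rd N \<nu> in auto)
    moreover have "g \<in> borel_measurable borel"
      using g(1) by (intro borel_measurable_continuous_onI continuous_at_imp_continuous_on) auto
    ultimately show ?thesis
      using m[OF N(2)] m[OF \<nu>(2)] by (simp add: integral_distr)
  qed
  have tail_int: "integrable M (tail_fun k)" if "prob_space M" "sets M = sets borel" for M :: "'b measure" and k
    by (rule bint[OF that, of _ "DIM('b)"]) (auto simp: continuous_tail_fun tail_fun_nonneg tail_fun_le)
  have tail: "(\<lambda>n. integral\<^sup>L (N n) (tail_fun k)) \<longlonglongrightarrow> integral\<^sup>L \<nu> (tail_fun k)" for k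
  proof -
    have i: "integrable M (\<lambda>x. min 1 (max 0 (\<bar>b \<bullet> x\<bar> - k)))" if "prob_space M" "sets M = sets borel" for M and b :: 'b
      by (rule bint[OF that, of _ 1]) (auto intro!: continuous_intros)
    have "(\<lambda>n. \<Sum>b\<in>Basis. \<integral>x. min 1 (max 0 (\<bar>b \<bullet> x\<bar> - k)) \<partial>N n) \<longlonglongrightarrow>
        (\<Sum>b\<in>Basis. \<integral>x. min 1 (max 0 (\<bar>b \<bullet> x\<bar> - k)) \<partial>\<nu>)"
      by (intro tendsto_sum coord[of _ 1]) (auto intro!: continuous_intros)
    then show ?thesis
      unfolding tail_fun_def using i[OF N] i[OF \<nu>] by simp
  qed
  have tail_0: "(\<lambda>k. integral\<^sup>L \<nu> (tail_fun (real k))) \<longlonglongrightarrow> 0"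
  proof -
    interpret \<nu>: prob_space \<nu> by fact
    have "(\<lambda>k. integral\<^sup>L \<nu> (tail_fun (real k))) \<longlonglongrightarrow> (\<integral>x. 0 \<partial>\<nu>)"
      by (rule integral_dominated_convergence[where w="\<lambda>_. DIM('b)"])
         (use tail_int[OF \<nu>] in \<open>auto simp: tail_fun_tendsto_0 tail_fun_nonneg tail_fun_le\<close>)
    then show ?thesis by simp
  qed
  show ?thesis
    unfolding weak_conv_vec_def
  proof (intro allI impI)
    fix f :: "'b \<Rightarrow> real"
    assume f: "continuous_on UNIV f \<and> bounded (range f)"
    then obtain B where "B > 0" and B: "\<bar>f x\<bar> \<le> B" for x
      by (auto simp: bounded_pos)
    have fi: "integrable M f" if "prob_space M" "sets M = sets borel" for M
      using bint[OF that] f B by blast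
    show "(\<lambda>n. integral\<^sup>L (N n) f) \<longlonglongrightarrow> integral\<^sup>L \<nu> f"
    proof (rule LIMSEQ_I)
      fix r :: real assume "r > 0"
      \<comment> \<open>The error adds up to less than \<open>5 * \<epsilon>\<close>: twice
        \<open>\<epsilon>\<close> for replacing \<open>f\<close> by \<open>h\<close> under each of
        the two measures, and \<open>\<epsilon>\<close> for the integrals of \<open>h\<close>. The
        cap \<open>\<epsilon> \<le> 1\<close> makes \<open>C = 2 * B + 1\<close> bound the
        difference of \<open>f\<close> and \<open>h\<close> everywhere.\<close>
      define \<epsilon> where "\<epsilon> = min 1 (r / 8)"
      have \<epsilon>: "\<epsilon> > 0" "\<epsilon> \<le> 1" "8 * \<epsilon> \<le> r" using \<open>r > 0\<close> by (auto simp: \<epsilon>_def)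
      define C where "C = 2 * B + 1"
      have "C > 0" using \<open>B > 0\<close> by (simp add: C_def)
      have "eventually (\<lambda>k. integral\<^sup>L \<nu> (tail_fun (real k)) < \<epsilon> / C) sequentially"
        using order_tendstoD(2)[OF tail_0, of "\<epsilon> / C"] \<epsilon> \<open>C > 0\<close> by simp
      then obtain k :: nat where k: "integral\<^sup>L \<nu> (tail_fun (real k)) < \<epsilon> / C"
        by (auto simp: eventually_sequentially)
      obtain h where h: "trig_poly h" "\<And>x. \<bar>h x\<bar> \<le> B + \<epsilon>"
        "\<And>x. norm x \<le> (real k + 1) * DIM('b) \<Longrightarrow> \<bar>f x - h x\<bar> \<le> \<epsilon>"
        using trig_poly_approx[of f B "(real k + 1) * DIM('b)" \<epsilon>] f B \<epsilon> by (auto simp: zero_less_mult_iff)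
      have hi: "integrable M h" if "prob_space M" "sets M = sets borel" for M
        using trig_poly_bounded_continuous[OF h(1)] bint[OF that] by blast
      have pt: "\<bar>f x - h x\<bar> \<le> \<epsilon> + C * tail_fun (real k) x" for x
      proof (cases "norm x \<le> (real k + 1) * DIM('b)")
        case True
        then show ?thesis using h(3)[of x] tail_fun_nonneg[of k x] \<open>C > 0\<close> by (simp add: add_increasing2)
      next
        case False
        then have "C * 1 \<le> C * tail_fun (real k) x"
          using tail_fun_ge_1[of "real k" x] \<open>C > 0\<close> by (intro mult_left_mono) auto
        moreover have "\<bar>f x - h x\<bar> \<le> C"
          using B[of x] h(2)[of x] \<epsilon> unfolding C_def by linarith
        ultimately show ?thesis using \<epsilon> by linarith
      qed
      have close: "\<bar>integral\<^sup>L M f - integral\<^sup>L M h\<bar> \<le> \<epsilon> + C * integral\<^sup>L M (tail_fun (real k))"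
        if M: "prob_space M" "sets M = sets borel" for M
      proof -
        interpret prob_space M by fact
        have "\<bar>integral\<^sup>L M f - integral\<^sup>L M h\<bar> = \<bar>\<integral>x. f x - h x \<partial>M\<bar>"
          using fi[OF M] hi[OF M] by simp
        also have "\<dots> \<le> (\<integral>x. \<bar>f x - h x\<bar> \<partial>M)"
          by (rule integral_abs_bound)
        also have "\<dots> \<le> (\<integral>x. \<epsilon> + C * tail_fun (real k) x \<partial>M)"
          using fi[OF M] hi[OF M] tail_int[OF M] pt by (intro integral_mono) auto
        also have "\<dots> = \<epsilon> + C * integral\<^sup>L M (tail_fun (real k))"
          using tail_int[OF M] by (simp add: prob_space)
        finally show ?thesis .
      qed
      have "eventually (\<lambda>n. integral\<^sup>L (N n) (tail_fun (real k)) < \<epsilon> / C) sequentially"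
        using order_tendstoD(2)[OF tail k] .
      moreover have "eventually (\<lambda>n. dist (integral\<^sup>L (N n) h) (integral\<^sup>L \<nu> h) < \<epsilon>) sequentially"
        using trig[OF h(1)] \<epsilon> by (simp add: tendstoD)
      ultimately have "eventually (\<lambda>n. norm (integral\<^sup>L (N n) f - integral\<^sup>L \<nu> f) < r) sequentially"
      proof eventually_elim
        case (elim n)
        have "C * integral\<^sup>L (N n) (tail_fun (real k)) < \<epsilon>" "C * integral\<^sup>L \<nu> (tail_fun (real k)) < \<epsilon>"
          using elim(1) k \<open>C > 0\<close> by (simp_all add: field_simps)
        then show ?case
          using close[OF N, of n] close[OF \<nu>] elim(2) \<epsilon> unfolding dist_real_def real_norm_def by linarith
      qed
      then show "\<exists>no. \<forall>n\<ge>no. norm (integral\<^sup>L (N n) f - integral\<^sup>L \<nu> f) < r"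
        by (simp add: eventually_sequentially)
    qed
  qed
qed

section \<open>Gaussian vectors\<close>

text \<open>The form is nonnegative at \<open>a *\<^sub>R x - y\<close> for every \<open>a\<close>;
  optimizing over \<open>a\<close> gives the inequality, and when the form vanishes at
  \<open>x\<close> the expression is affine in \<open>a\<close> and must be constant.\<close>

lemma psd_form_Cauchy_Schwarz:
  fixes C :: "'b::euclidean_space \<Rightarrow> 'b"
  assumes C: "linear C" and sym: "\<And>x y. x \<bullet> C y = C x \<bullet> y" and psd: "\<And>x. 0 \<le> x \<bullet> C x"
  shows "(x \<bullet> C y)\<^sup>2 \<le> (x \<bullet> C x) * (y \<bullet> C y)"
proof -
  interpret linear C by fact
  have q: "0 \<le> a\<^sup>2 * (x \<bullet> C x) - 2 * a * (x \<bullet> C y) + y \<bullet> C y" for a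
  proof -
    have "(a *\<^sub>R x - y) \<bullet> C (a *\<^sub>R x - y) = a\<^sup>2 * (x \<bullet> C x) - 2 * a * (x \<bullet> C y) + y \<bullet> C y"
      using sym[of y x] by (simp add: diff scale inner_diff_left inner_diff_right power2_eq_square algebra_simps inner_commute)
    then show ?thesis using psd by metis
  qed
  show ?thesis
  proof (cases "x \<bullet> C x = 0")
    case True
    have "x \<bullet> C y = 0"
    proof (rule ccontr)
      assume nz: "x \<bullet> C y \<noteq> 0"
      \<comment> \<open>At this \<open>a\<close> the affine function would equal
        \<open>-1\<close>.\<close>
      have "2 * ((y \<bullet> C y + 1) / (2 * (x \<bullet> C y))) * (x \<bullet> C y) = y \<bullet> C y + 1" using nz by simp
      then show False using q[of "(y \<bullet> C y + 1) / (2 * (x \<bullet> C y))"] True by simp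
    qed
    then show ?thesis using True by simp
  next
    case False
    then have p: "x \<bullet> C x > 0" using psd[of x] by simp
    have "0 \<le> ((x \<bullet> C y) / (x \<bullet> C x))\<^sup>2 * (x \<bullet> C x) - 2 * ((x \<bullet> C y) / (x \<bullet> C x)) * (x \<bullet> C y) + y \<bullet> C y"
      by (rule q)
    also have "\<dots> = y \<bullet> C y - (x \<bullet> C y)\<^sup>2 / (x \<bullet> C x)"
      using p by (simp add: power2_eq_square field_simps)
    finally show ?thesis using p by (simp add: field_simps)
  qed
qed

text \<open>Cauchy-Schwarz for the form with the vectors \<open>C x\<close> and \<open>x\<close>. It
  lets a zero of the form be read as a kernel vector.\<close>

lemma psd_form_zero:
  fixes C :: "'b::euclidean_space \<Rightarrow> 'b"
  assumes "linear C" "\<And>x y. x \<bullet> C y = C x \<bullet> y" "\<And>x. 0 \<le> x \<bullet> C x" "x \<bullet> C x = 0"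
  shows "C x = 0"
proof -
  have "(C x \<bullet> C x)\<^sup>2 \<le> 0"
    using psd_form_Cauchy_Schwarz[OF assms(1-3), of "C x" x] assms(4) by simp
  then show ?thesis by simp
qed

text \<open>Cholesky factorization by deflation: subtracting the square of one linear form enlarges the
  kernel.\<close>

lemma psd_form_sum_squares:
  fixes C :: "'b::euclidean_space \<Rightarrow> 'b"
  assumes "linear C" and "\<And>x y. x \<bullet> C y = C x \<bullet> y" and "\<And>x. 0 \<le> x \<bullet> C x"
  obtains r :: nat and s :: "nat \<Rightarrow> 'b" where "\<And>t. t \<bullet> C t = (\<Sum>i<r. (s i \<bullet> t)\<^sup>2)"
proof -
  have "\<exists>(r::nat) s. \<forall>t. t \<bullet> C t = (\<Sum>i<r. (s i \<bullet> t)\<^sup>2)"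
    using assms
  proof (induction "DIM('b) - dim {x. C x = 0}" arbitrary: C rule: less_induct)
    case less
    interpret linear C by fact
    show ?case
    proof (cases "\<forall>t. t \<bullet> C t = 0")
      case True
      then show ?thesis by (intro exI[of _ 0]) auto
    next
      case False
      then obtain u where "u \<bullet> C u \<noteq> 0" by blast
      then have u: "u \<bullet> C u > 0" using less.prems(3)[of u] by simp
      \<comment> \<open>Scaled so that subtracting the rank-one form of \<open>v\<close> sends
        \<open>u\<close> to zero; Cauchy-Schwarz keeps the remainder semidefinite.\<close>
      define v where "v = (1 / sqrt (u \<bullet> C u)) *\<^sub>R C u"
      define C' where "C' x = C x - (v \<bullet> x) *\<^sub>R v" for x
      have v: "(v \<bullet> x) * (v \<bullet> y) = (u \<bullet> C x) * (u \<bullet> C y) / (u \<bullet> C u)" for x y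
        using u less.prems(2) by (simp add: v_def)
      have lin: "linear C'"
        unfolding C'_def by (intro linearI) (simp_all add: add scale inner_add_right algebra_simps)
      have sym: "x \<bullet> C' y = C' x \<bullet> y" for x y
        using less.prems(2)[of x y] by (simp add: C'_def inner_diff_left inner_diff_right inner_commute)
      have psd: "0 \<le> x \<bullet> C' x" for x
      proof -
        have "x \<bullet> C' x = x \<bullet> C x - (u \<bullet> C x)\<^sup>2 / (u \<bullet> C u)"
          using v[of x x] by (simp add: C'_def inner_diff_right power2_eq_square inner_commute)
        moreover have "(u \<bullet> C x)\<^sup>2 / (u \<bullet> C u) \<le> x \<bullet> C x"
          using psd_form_Cauchy_Schwarz[OF less.prems, of u x] u by (simp add: field_simps)
        ultimately show ?thesis by simp
      qed
      have sub: "subspace {x. C x = 0}" "subspace {x. C' x = 0}"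
        by (rule linear_subspace_kernel[OF less.prems(1)], rule linear_subspace_kernel[OF lin])
      have C'u: "C' u = 0"
      proof -
        have "(v \<bullet> u) *\<^sub>R v = ((C u \<bullet> u) / (u \<bullet> C u)) *\<^sub>R C u"
          using u by (simp add: v_def)
        then show ?thesis using u by (simp add: C'_def inner_commute[of "C u" u])
      qed
      have "{x. C x = 0} \<subset> {x. C' x = 0}"
      proof
        show "{x. C x = 0} \<subseteq> {x. C' x = 0}"
        proof safe
          fix x assume "C x = 0"
          then have "v \<bullet> x = 0" using less.prems(2)[of u x] by (simp add: v_def)
          then show "C' x = 0" using \<open>C x = 0\<close> by (simp add: C'_def)
        qed
        have "C u \<noteq> 0" using u by auto
        then show "{x. C x = 0} \<noteq> {x. C' x = 0}" using C'u by blast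
      qed
      then have "dim {x. C x = 0} < dim {x. C' x = 0}"
        by (intro dim_psubset) (simp add: span_eq_iff[THEN iffD2, OF sub(1)] span_eq_iff[THEN iffD2, OF sub(2)])
      moreover have "dim {x. C' x = 0} \<le> DIM('b)" by (rule dim_subset_UNIV)
      ultimately have "DIM('b) - dim {x. C' x = 0} < DIM('b) - dim {x. C x = 0}" by linarith
      from less.hyps[OF this lin sym psd]
      obtain r :: nat and s where s: "\<And>t. t \<bullet> C' t = (\<Sum>i<r. (s i \<bullet> t)\<^sup>2)"
        by blast
      have "t \<bullet> C t = (\<Sum>i<Suc r. ((s(r := v)) i \<bullet> t)\<^sup>2)" for t
      proof -
        have "t \<bullet> C t = t \<bullet> C' t + (v \<bullet> t)\<^sup>2"
          by (simp add: C'_def inner_diff_right power2_eq_square inner_commute)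
        then show ?thesis by (simp add: s)
      qed
      then show ?thesis by blast
    qed
  qed
  then show ?thesis using that by blast
qed

text \<open>The point mass at variance \<open>0\<close> must be included: the direction
  \<open>t = 0\<close> always has it, and so do the directions orthogonal to \<open>W\<close> in the
  final limit.\<close>

lemma char_normal_law:
  assumes "v \<ge> 0"
  shows "char (normal_law 0 v) t = exp (- (v * t\<^sup>2 / 2))" "real_distribution (normal_law 0 v)"
proof -
  have "char (normal_law 0 v) t = exp (- (v * t\<^sup>2 / 2)) \<and> real_distribution (normal_law 0 v)"
  proof (cases "v = 0")
    case True
    have "char (return borel 0) t = 1"
      unfolding char_def by (subst integral_return) auto
    moreover have "real_distribution (return borel (0::real))"
      by (auto simp: real_distribution_def real_distribution_axioms_def prob_space_return)
    ultimately show ?thesis using True by (simp add: normal_law_def)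
  next
    case False
    define s where "s = sqrt v"
    have s: "s > 0" "s\<^sup>2 = v" using False assms by (simp_all add: s_def)
    interpret S: prob_space std_normal_distribution
      using real_dist_normal_dist by (simp add: real_distribution_def)
    have "distributed std_normal_distribution lborel (\<lambda>x. x) std_normal_density"
      unfolding distributed_def by (auto simp: distr_id2)
    then have "distributed std_normal_distribution lborel (\<lambda>x. 0 + s * x) (normal_density (0 + s * 0) (\<bar>s\<bar> * 1))"
      by (rule S.normal_density_affine) (use s in auto)
    then have "distr std_normal_distribution lborel (\<lambda>x. s * x) = normal_law 0 v"
      using s False by (simp add: distributed_def normal_law_def s_def)
    then have eq: "normal_law 0 v = distr std_normal_distribution borel (\<lambda>x. s * x)"
      by (simp add: cong: distr_cong)
    have "char (normal_law 0 v) t = char std_normal_distribution (t * s)"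
      unfolding eq char_def by (subst integral_distr) (auto simp: mult.assoc)
    also have "\<dots> = exp (- (v * t\<^sup>2 / 2))"
      by (simp add: char_std_normal_distribution power_mult_distrib s mult.commute exp_of_real)
    finally show ?thesis
      unfolding eq by (auto intro!: S.real_distribution_distr)
  qed
  then show "char (normal_law 0 v) t = exp (- (v * t\<^sup>2 / 2))" "real_distribution (normal_law 0 v)" by auto
qed

text \<open>The vector \<open>X\<close> combines the \<open>s i\<close> with independent standard
  normal coefficients, so along \<open>t\<close> its variance is the sum of the squares of
  \<open>s i \<bullet> t\<close>, which is \<open>t \<bullet> C t\<close>. The scalar laws are
  identified by characteristic functions.\<close>

lemma is_normal_vec_exists:
  fixes C :: "'b::euclidean_space \<Rightarrow> 'b"
  assumes "linear C" and "\<And>x y. x \<bullet> C y = C x \<bullet> y" and "\<And>x. 0 \<le> x \<bullet> C x"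
  shows "\<exists>\<nu>. is_normal_vec 0 C \<nu>"
proof -
  obtain r :: nat and s where s: "\<And>t. t \<bullet> C t = (\<Sum>i<r. (s i \<bullet> t)\<^sup>2)"
    using psd_form_sum_squares[OF assms] by blast
  define M where "M = PiM {..<r} (\<lambda>_. std_normal_distribution)"
  interpret S: prob_space std_normal_distribution
    using real_dist_normal_dist by (simp add: real_distribution_def)
  interpret I: product_prob_space "\<lambda>_::nat. std_normal_distribution" "{..<r}" ..
  have P: "prob_space M" unfolding M_def by (rule prob_space_PiM) (rule S.prob_space_axioms)
  interpret Q: prob_space M by (rule P)
  have coord[measurable]: "(\<lambda>\<omega>. \<omega> i) \<in> borel_measurable M" if "i < r" for i
    using measurable_component_singleton[of i "{..<r}" "\<lambda>_. std_normal_distribution"] that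
    by (simp add: M_def)
  define X where "X \<omega> = (\<Sum>i<r. \<omega> i *\<^sub>R s i)" for \<omega> :: "nat \<Rightarrow> real"
  have X[measurable]: "X \<in> borel_measurable M"
    unfolding X_def by measurable
  have law: "distr (distr M borel X) borel (\<lambda>x. t \<bullet> x) = normal_law (t \<bullet> 0) (t \<bullet> C t)" for t
  proof -
    have 1: "distr (distr M borel X) borel (\<lambda>x. t \<bullet> x) = distr M borel (\<lambda>\<omega>. \<Sum>i<r. (s i \<bullet> t) * \<omega> i)"
      by (subst distr_distr) (auto simp: comp_def X_def inner_sum_right inner_commute mult.commute)
    have "char (distr M borel (\<lambda>\<omega>. \<Sum>i<r. (s i \<bullet> t) * \<omega> i)) u = char (normal_law 0 (t \<bullet> C t)) u" for u
    proof -
      have "char (distr M borel (\<lambda>\<omega>. \<Sum>i<r. (s i \<bullet> t) * \<omega> i)) u =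
          (CLINT \<omega>|M. iexp (u * (\<Sum>i<r. (s i \<bullet> t) * \<omega> i)))"
        unfolding char_def by (subst integral_distr) auto
      also have "\<dots> = (CLINT \<omega>|M. (\<Prod>i<r. iexp (u * (s i \<bullet> t) * \<omega> i)))"
        by (intro Bochner_Integration.integral_cong refl)
           (simp add: sum_distrib_left mult.assoc flip: exp_sum)
      also have "\<dots> = (\<Prod>i<r. char std_normal_distribution (u * (s i \<bullet> t)))"
        unfolding M_def char_def
        by (rule I.product_integral_prod) (auto intro!: S.integrable_iexp)
      also have "\<dots> = (\<Prod>i<r. of_real (exp (- ((s i \<bullet> t)\<^sup>2 * u\<^sup>2 / 2))))"
        by (simp add: char_std_normal_distribution power_mult_distrib mult.commute exp_of_real)
      also have "\<dots> = of_real (exp (\<Sum>i<r. - ((s i \<bullet> t)\<^sup>2 * u\<^sup>2 / 2)))"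
        by (simp add: exp_sum)
      also have "(\<Sum>i<r. - ((s i \<bullet> t)\<^sup>2 * u\<^sup>2 / 2)) = - ((t \<bullet> C t) * u\<^sup>2 / 2)"
        by (simp add: s sum_negf sum_distrib_right sum_divide_distrib)
      finally show ?thesis using char_normal_law(1)[OF assms(3), of t u] by simp
    qed
    then have "distr M borel (\<lambda>\<omega>. \<Sum>i<r. (s i \<bullet> t) * \<omega> i) = normal_law 0 (t \<bullet> C t)"
      using char_normal_law(2)[OF assms(3), of t]
      by (intro Levy_uniqueness ext) (auto intro!: Q.real_distribution_distr)
    then show ?thesis using 1 by simp
  qed
  have "is_normal_vec 0 C (distr M borel X)"
    unfolding is_normal_vec_def using law by (auto intro!: Q.prob_space_distr)
  then show ?thesis by blast
qed

section \<open>Hermite polynomials and Gaussian integrals\<close>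

text \<open>The recursion is read off the closed formulas for even and odd moments by parity of
  \<open>n\<close>; at \<open>n = 0\<close> the truncated \<open>n - 1\<close> is harmless because
  of the factor \<open>n\<close>.\<close>

lemma std_normal_moments:
  shows "integrable std_normal_distribution (\<lambda>x. x ^ n)"
    and "(LINT x|std_normal_distribution. x ^ Suc n) = real n * (LINT x|std_normal_distribution. x ^ (n - 1))"
proof -
  show int: "integrable std_normal_distribution (\<lambda>x. x ^ n)" for n
    using integrable_std_normal_moment[of n] by (subst integrable_density) auto
  define m where "m n = (LINT x|std_normal_distribution. x ^ n)" for n
  have ev: "m (2 * k) = fact (2 * k) / (2 ^ k * fact k)" for k
    unfolding m_def by (rule std_normal_distribution_even_moments)
  have od: "m (2 * k + 1) = 0" for k
    unfolding m_def using integral_std_normal_moment_odd[of k] by (subst integral_density) auto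
  have "m (Suc n) = real n * m (n - 1)"
  proof (cases "even n")
    case True
    then obtain k where k: "n = 2 * k" by blast
    show ?thesis
    proof (cases k)
      case 0
      then show ?thesis using od[of 0] k by simp
    next
      case (Suc j)
      then show ?thesis using od[of "k"] od[of j] k by simp
    qed
  next
    case False
    then obtain k where k: "n = 2 * k + 1" using oddE by blast
    then have "m (Suc n) = m (2 * Suc k)" by simp
    also have "\<dots> = (2 * real k + 2) * (2 * real k + 1) * fact (2 * k) / (2 * 2 ^ k * ((real k + 1) * fact k))"
      unfolding ev by (simp add: algebra_simps)
    also have "\<dots> = real n * (fact (2 * k) / (2 ^ k * fact k))"
    proof -
      have "(2 * x + 2) * (2 * x + 1) * a / (2 * b * ((x + 1) * c)) = (2 * x + 1) * (a / (b * c))"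
        if "x + 1 \<noteq> 0" "b \<noteq> 0" "c \<noteq> 0" for a b c x :: real
        using that by (simp add: divide_simps)
      note this[of "real k" "2 ^ k" "fact k" "fact (2 * k)"]
      moreover have "real n = 2 * real k + 1" unfolding k by simp
      ultimately show ?thesis by simp
    qed
    finally show ?thesis unfolding ev[symmetric] k by simp
  qed
  then show "(LINT x|std_normal_distribution. x ^ Suc n) = real n * (LINT x|std_normal_distribution. x ^ (n - 1))"
    by (simp add: m_def)
qed

lemma integrable_std_normal_poly: "integrable std_normal_distribution (poly q)"
  unfolding poly_altdef[abs_def] by (intro Bochner_Integration.integrable_sum integrable_mult_right std_normal_moments(1))

text \<open>Stein's identity, which on monomials is the recursion of the moments.\<close>

lemma std_normal_Stein_poly:
  "(LINT x|std_normal_distribution. x * poly q x) = (LINT x|std_normal_distribution. poly (pderiv q) x)"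
proof -
  have int: "integrable std_normal_distribution (\<lambda>x. x * poly p x)" for p
    using integrable_std_normal_poly[of "[:0,1:] * p"] by (simp cong: Bochner_Integration.integrable_cong)
  have "(LINT x|std_normal_distribution. x * poly (\<Sum>i\<in>I. monom (coeff q i) i) x) =
      (LINT x|std_normal_distribution. poly (pderiv (\<Sum>i\<in>I. monom (coeff q i) i)) x)" if "finite I" for I
    using that
  proof (induction I rule: finite_induct)
    case (insert i I)
    have "(LINT x|std_normal_distribution. x * poly (monom (coeff q i) i) x) =
        coeff q i * (LINT x|std_normal_distribution. x ^ Suc i)"
      by (subst integral_mult_right_zero[symmetric]) (simp add: poly_monom algebra_simps)
    also have "\<dots> = (LINT x|std_normal_distribution. poly (pderiv (monom (coeff q i) i)) x)"
      unfolding std_normal_moments(2) by (simp add: pderiv_monom poly_monom algebra_simps)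
    finally show ?case
      using insert int[of "monom (coeff q i) i"] int[of "\<Sum>i\<in>I. monom (coeff q i) i"]
        integrable_std_normal_poly[of "pderiv (monom (coeff q i) i)"]
        integrable_std_normal_poly[of "pderiv (\<Sum>i\<in>I. monom (coeff q i) i)"]
      by (simp add: pderiv_add distrib_left)
  qed simp
  from this[of "{..degree q}"] show ?thesis by (simp add: poly_as_sum_of_monoms)
qed

text \<open>The probabilists' Hermite polynomials. In this recursive form, differentiating the
  \<open>n\<close>-th polynomial times \<open>exp (- t\<^sup>2 / 2)\<close> yields minus the next
  one times the same factor.\<close>

primrec Hermite_poly :: "nat \<Rightarrow> real poly" where
  "Hermite_poly 0 = 1"
| "Hermite_poly (Suc n) = [:0, 1:] * Hermite_poly n - pderiv (Hermite_poly n)"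

text \<open>The recursion at \<open>x + a\<close> reads \<open>x * q + a * q - q'\<close> for the
  shifted polynomial \<open>q\<close>; Stein's identity cancels the first term against the last.
  This is what removes the Gaussian noise from Hermite means.\<close>

lemma integral_Hermite_poly_shift:
  "(LINT x|std_normal_distribution. poly (Hermite_poly n) (x + a)) = a ^ n"
proof (induction n)
  case 0
  interpret prob_space std_normal_distribution
    using real_dist_normal_dist by (simp add: real_distribution_def)
  show ?case using prob_space by simp
next
  case (Suc n)
  define q where "q = Hermite_poly n \<circ>\<^sub>p [:a, 1:]"
  have q: "poly q x = poly (Hermite_poly n) (x + a)" "poly (pderiv q) x = poly (pderiv (Hermite_poly n)) (x + a)" for x
    by (simp_all add: q_def poly_pcompose pderiv_pcompose pderiv_pCons add.commute)
  have int: "integrable std_normal_distribution (\<lambda>x. x * poly q x)"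
    using integrable_std_normal_poly[of "[:0,1:] * q"] by (simp cong: Bochner_Integration.integrable_cong)
  have "(LINT x|std_normal_distribution. poly (Hermite_poly (Suc n)) (x + a)) =
      (LINT x|std_normal_distribution. x * poly q x + a * poly q x - poly (pderiv q) x)"
    by (simp add: q algebra_simps)
  also have "\<dots> = a * (LINT x|std_normal_distribution. poly q x)"
    using int integrable_std_normal_poly[of q] integrable_std_normal_poly[of "pderiv q"] std_normal_Stein_poly[of q]
    by simp
  finally show ?case using Suc by (simp add: q)
qed

text \<open>In each coordinate the one-dimensional factor \<open>f n\<close> has derivative
  \<open>- f (Suc n)\<close>, so the product rule raises one index at a time.\<close>

lemma has_derivative_gaussian_Hermite:
  fixes c :: "'d::finite \<Rightarrow> nat"
  shows "((\<lambda>x::real^'d. (\<Prod>j\<in>UNIV. poly (Hermite_poly (c j)) (x $ j)) * exp (- (norm x)\<^sup>2 / 2)) has_derivative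
    (\<lambda>h. - (\<Sum>i\<in>UNIV. h $ i * ((\<Prod>j\<in>UNIV. poly (Hermite_poly ((c(i := Suc (c i))) j)) (x $ j)) * exp (- (norm x)\<^sup>2 / 2)))))
    (at x)"
proof -
  define f where "f n t = poly (Hermite_poly n) t * exp (- t\<^sup>2 / 2)" for n and t :: real
  have split: "(\<Prod>j\<in>UNIV. poly (Hermite_poly (c j)) (x $ j)) * exp (- (norm x)\<^sup>2 / 2) = (\<Prod>j\<in>UNIV. f (c j) (x $ j))"
    for c and x :: "real^'d"
  proof -
    have "- (norm x)\<^sup>2 / 2 = (\<Sum>j\<in>UNIV. - (x $ j)\<^sup>2 / 2)"
      by (simp add: norm_vec_def L2_set_def sum_nonneg sum_negf sum_divide_distrib)
    then show ?thesis by (simp add: f_def prod.distrib exp_sum)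
  qed
  have df: "(f n has_real_derivative - f (Suc n) t) (at t)" for n t
    unfolding f_def by (auto intro!: derivative_eq_intros simp: algebra_simps)
  have "((\<lambda>x::real^'d. f (c j) (x $ j)) has_derivative (\<lambda>h. - f (Suc (c j)) (x $ j) * (h $ j))) (at x)" for j
  proof -
    have "((\<lambda>x::real^'d. x $ j) has_derivative (\<lambda>h. h $ j)) (at x)"
      by (rule bounded_linear_imp_has_derivative[OF bounded_linear_vec_nth])
    from DERIV_compose_FDERIV[OF df this]
    show ?thesis by (simp add: mult.commute)
  qed
  then have "((\<lambda>x::real^'d. \<Prod>j\<in>UNIV. f (c j) (x $ j)) has_derivative
      (\<lambda>h. \<Sum>i\<in>UNIV. (- f (Suc (c i)) (x $ i) * (h $ i)) * (\<Prod>j\<in>UNIV - {i}. f (c j) (x $ j)))) (at x)"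
    by (intro has_derivative_prod)
  moreover have "(\<Sum>i\<in>UNIV. (- f (Suc (c i)) (x $ i) * (h $ i)) * (\<Prod>j\<in>UNIV - {i}. f (c j) (x $ j))) =
      - (\<Sum>i\<in>UNIV. h $ i * (\<Prod>j\<in>UNIV. f ((c(i := Suc (c i))) j) (x $ j)))" for h
  proof -
    have "(\<Prod>j\<in>UNIV. f ((c(i := Suc (c i))) j) (x $ j)) = f (Suc (c i)) (x $ i) * (\<Prod>j\<in>UNIV - {i}. f (c j) (x $ j))" for i
      by (subst prod.remove[of UNIV i]) (auto intro!: prod.cong)
    then show ?thesis by (simp add: sum_negf algebra_simps)
  qed
  ultimately show ?thesis unfolding split by simp
qed

text \<open>Every partial derivative raises the Hermite index of its coordinate and contributes a
  sign, so only the multiplicities in the index list matter.\<close>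

lemma iter_partial_gaussian:
  fixes x :: "real^'d"
  shows "iter_partial is (\<lambda>u. exp (- (norm u)\<^sup>2 / 2)) x =
    (-1) ^ length is * ((\<Prod>j\<in>UNIV. poly (Hermite_poly (count_list is j)) (x $ j)) * exp (- (norm x)\<^sup>2 / 2))"
proof (induction "is" arbitrary: x)
  case Nil
  then show ?case by simp
next
  case (Cons i "is")
  have eq: "iter_partial is (\<lambda>u::real^'d. exp (- (norm u)\<^sup>2 / 2)) =
      (\<lambda>x. (-1) ^ length is * ((\<Prod>j\<in>UNIV. poly (Hermite_poly (count_list is j)) (x $ j)) * exp (- (norm x)\<^sup>2 / 2)))"
    using Cons.IH by (intro ext)
  let ?D = "\<lambda>h::real^'d. (-1) ^ length is * - (\<Sum>l\<in>UNIV. h $ l * ((\<Prod>j\<in>UNIV. poly (Hermite_poly (((count_list is)(l := Suc (count_list is l))) j)) (x $ j)) * exp (- (norm x)\<^sup>2 / 2)))"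
  have "(iter_partial is (\<lambda>u::real^'d. exp (- (norm u)\<^sup>2 / 2)) has_derivative ?D) (at x)"
    unfolding eq by (rule has_derivative_mult_right[OF has_derivative_gaussian_Hermite])
  then have "iter_partial (i # is) (\<lambda>u. exp (- (norm u)\<^sup>2 / 2)) x = ?D (axis i 1)"
    by (simp add: frechet_derivative_at[symmetric])
  also have "\<dots> = (-1) ^ length is * - ((\<Prod>j\<in>UNIV. poly (Hermite_poly (((count_list is)(i := Suc (count_list is i))) j)) (x $ j)) * exp (- (norm x)\<^sup>2 / 2))"
    by (simp add: axis_def if_distrib if_distribR cong: if_cong)
  also have "(count_list is)(i := Suc (count_list is i)) = count_list (i # is)"
    by auto
  finally show ?case by simp
qed

lemma hermite_tensor_eq:
  assumes "length is = k"
  shows "hermite_tensor k x is = (\<Prod>j\<in>UNIV. poly (Hermite_poly (count_list is j)) (x $ j))"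
proof -
  let ?p = "\<Prod>j\<in>UNIV. poly (Hermite_poly (count_list is j)) (x $ j)"
  have "hermite_tensor k x is =
      ((-1) ^ k * (-1) ^ k) * (exp ((norm x)\<^sup>2 / 2) * exp (- (norm x)\<^sup>2 / 2)) * ?p"
    unfolding hermite_tensor_def iter_partial_gaussian using assms by (simp only: if_True simp_thms mult_ac)
  also have "(-1) ^ k * (-1) ^ k = (1::real)"
    unfolding power_mult_distrib[symmetric] by simp
  also have "exp ((norm x)\<^sup>2 / 2) * exp (- (norm x)\<^sup>2 / 2) = 1"
    unfolding exp_add[symmetric] by simp
  finally show ?thesis by simp
qed

text \<open>Lebesgue measure on vectors is the image of the product measure indexed by
  \<open>Basis\<close>; after translating basis vectors to coordinates with
  \<open>axis_index\<close> the integral of a product factors.\<close>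

lemma lborel_vec_prod:
  fixes f :: "'d::finite \<Rightarrow> real \<Rightarrow> real"
  assumes f: "\<And>i. integrable lborel (f i)"
  shows "integrable lborel (\<lambda>x::real^'d. \<Prod>i\<in>UNIV. f i (x $ i))"
    and "(\<integral>x. (\<Prod>i\<in>UNIV. f i (x $ i)) \<partial>(lborel :: (real^'d) measure)) = (\<Prod>i\<in>UNIV. integral\<^sup>L lborel (f i))"
proof -
  interpret product_sigma_finite "\<lambda>_::real^'d. lborel :: real measure" ..
  define g where "g b = f (axis_index b)" for b :: "real^'d"
  have reindex: "(\<Prod>b\<in>(Basis :: (real^'d) set). h (axis_index b)) = (\<Prod>i\<in>UNIV. h i)" for h :: "'d \<Rightarrow> real"
  proof -
    have B: "(Basis :: (real^'d) set) = (\<lambda>i. axis i 1) ` UNIV" by (auto simp: Basis_vec_def)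
    show ?thesis unfolding B
      by (subst prod.reindex) (auto simp: inj_on_def axis_eq_axis axis_index_axis)
  qed
  have bas: "(\<Prod>b\<in>Basis. g b (x \<bullet> b)) = (\<Prod>i\<in>UNIV. f i (x $ i))" for x :: "real^'d"
  proof -
    have "(\<Prod>b\<in>Basis. g b (x \<bullet> b)) = (\<Prod>b\<in>(Basis :: (real^'d) set). (\<lambda>i. f i (x $ i)) (axis_index b))"
      by (intro prod.cong refl) (auto simp: g_def Basis_vec_def axis_index_axis inner_axis)
    then show ?thesis using reindex[of "\<lambda>i. f i (x $ i)"] by simp
  qed
  let ?S = "\<lambda>h. \<Sum>b\<in>Basis. h b *\<^sub>R (b::real^'d)"
  have S: "?S \<in> borel_measurable (PiM Basis (\<lambda>_. lborel))" by measurable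
  have m: "(\<lambda>x::real^'d. \<Prod>b\<in>Basis. g b (x \<bullet> b)) \<in> borel_measurable borel"
    using f by (intro borel_measurable_prod) (auto simp: g_def intro!: measurable_compose[OF _ borel_measurable_integrable[OF f, unfolded measurable_lborel1]])
  have pt: "(\<Prod>b\<in>Basis. g b (?S h \<bullet> b)) = (\<Prod>b\<in>Basis. g b (h b))" for h :: "real^'d \<Rightarrow> real"
    by (intro prod.cong) auto
  have "integrable (PiM Basis (\<lambda>_. lborel)) (\<lambda>h. \<Prod>b\<in>Basis. g b (h b))"
    by (rule product_integrable_prod) (auto simp: g_def f)
  then show "integrable lborel (\<lambda>x::real^'d. \<Prod>i\<in>UNIV. f i (x $ i))"
    unfolding bas[symmetric] by (subst lborel_eq, subst integrable_distr_eq[OF S m], simp only: pt)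
  have "(\<integral>x. (\<Prod>b\<in>Basis. g b (x \<bullet> b)) \<partial>(lborel :: (real^'d) measure)) = (\<integral>h. (\<Prod>b\<in>Basis. g b (h b)) \<partial>PiM Basis (\<lambda>_. lborel))"
    by (subst lborel_eq, subst integral_distr[OF S m], simp only: pt)
  also have "\<dots> = (\<Prod>b\<in>Basis. integral\<^sup>L lborel (g b))"
    by (rule product_integral_prod) (auto simp: g_def f)
  finally show "(\<integral>x. (\<Prod>i\<in>UNIV. f i (x $ i)) \<partial>(lborel :: (real^'d) measure)) = (\<Prod>i\<in>UNIV. integral\<^sup>L lborel (f i))"
    unfolding bas using reindex[of "\<lambda>i. integral\<^sup>L lborel (f i)"] by (simp add: g_def)
qed


text \<open>Substitution \<open>t = a + \<sigma> * x\<close>, whose Jacobian \<open>\<sigma>\<close>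
  turns the normal density into the standard one.\<close>

lemma normal_density_scale:
  fixes g :: "real \<Rightarrow> real"
  assumes "\<sigma> > 0" and g[measurable]: "g \<in> borel_measurable borel"
    and int: "integrable std_normal_distribution (\<lambda>x. g (x + a / \<sigma>))"
  shows "integrable lborel (\<lambda>t. normal_density a \<sigma> t * g (t / \<sigma>))"
    and "(LINT t|lborel. normal_density a \<sigma> t * g (t / \<sigma>)) = (LINT x|std_normal_distribution. g (x + a / \<sigma>))"
proof -
  have eq: "\<sigma> * (normal_density a \<sigma> (a + \<sigma> * x) * g ((a + \<sigma> * x) / \<sigma>)) = std_normal_density x * g (x + a / \<sigma>)" for x
    using \<open>\<sigma> > 0\<close> by (simp add: normal_density_def real_sqrt_mult power_mult_distrib add_divide_distrib add.commute)
  have "integrable lborel (\<lambda>x. std_normal_density x * g (x + a / \<sigma>))"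
    using int by (subst (asm) integrable_density) auto
  then have "integrable lborel (\<lambda>x. \<sigma> * (normal_density a \<sigma> (a + \<sigma> * x) * g ((a + \<sigma> * x) / \<sigma>)))"
    by (simp only: eq)
  then have "integrable lborel (\<lambda>x. normal_density a \<sigma> (a + \<sigma> * x) * g ((a + \<sigma> * x) / \<sigma>))"
    using \<open>\<sigma> > 0\<close> integrable_mult_right[of "1 / \<sigma>" lborel "\<lambda>x. \<sigma> * (normal_density a \<sigma> (a + \<sigma> * x) * g ((a + \<sigma> * x) / \<sigma>))"]
    by simp
  then show "integrable lborel (\<lambda>t. normal_density a \<sigma> t * g (t / \<sigma>))"
    using lborel_integrable_real_affine_iff[of \<sigma> "\<lambda>t. normal_density a \<sigma> t * g (t / \<sigma>)" a] \<open>\<sigma> > 0\<close> by simp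
  have "(LINT t|lborel. normal_density a \<sigma> t * g (t / \<sigma>)) =
      (LINT x|lborel. \<sigma> * (normal_density a \<sigma> (a + \<sigma> * x) * g ((a + \<sigma> * x) / \<sigma>)))"
    using lborel_integral_real_affine[of \<sigma> "\<lambda>t. normal_density a \<sigma> t * g (t / \<sigma>)" a] \<open>\<sigma> > 0\<close> by simp
  also have "\<dots> = (LINT x|std_normal_distribution. g (x + a / \<sigma>))"
    unfolding eq by (subst integral_density) auto
  finally show "(LINT t|lborel. normal_density a \<sigma> t * g (t / \<sigma>)) = (LINT x|std_normal_distribution. g (x + a / \<sigma>))" .
qed

lemma integrable_std_normal_poly_shift: "integrable std_normal_distribution (\<lambda>x. poly q (x + a))"
  using integrable_std_normal_poly[of "q \<circ>\<^sub>p [:a, 1:]"]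
  by (simp add: poly_pcompose add.commute cong: Bochner_Integration.integrable_cong)

text \<open>The constant depends on the shift only through \<open>R\<close>. This uniformity is what
  bounds the inner integrals over the almost surely bounded signal in the later use of
  Fubini.\<close>

lemma std_normal_abs_poly_shift_bound:
  obtains K where "\<And>a. \<bar>a\<bar> \<le> R \<Longrightarrow> (LINT x|std_normal_distribution. \<bar>poly q (x + a)\<bar>) \<le> K"
proof
  fix a :: real assume a: "\<bar>a\<bar> \<le> R"
  define B where "B x = (\<Sum>i\<le>degree q. \<bar>coeff q i\<bar> * (2 ^ i * \<bar>x ^ i\<bar> + 2 ^ i * R ^ i))" for x :: real
  have "R \<ge> 0" using a by simp
  interpret prob_space std_normal_distribution
    using real_dist_normal_dist by (simp add: real_distribution_def)
  have B: "integrable std_normal_distribution B"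
    unfolding B_def by (intro Bochner_Integration.integrable_sum integrable_mult_right Bochner_Integration.integrable_add integrable_abs std_normal_moments(1)) simp
  have "\<bar>poly q (x + a)\<bar> \<le> B x" for x
  proof -
    have p: "\<bar>x + a\<bar> ^ i \<le> 2 ^ i * \<bar>x ^ i\<bar> + 2 ^ i * R ^ i" for i
    proof -
      have "\<bar>x + a\<bar> \<le> 2 * max \<bar>x\<bar> R" using a by linarith
      then have "\<bar>x + a\<bar> ^ i \<le> (2 * max \<bar>x\<bar> R) ^ i" by (rule power_mono) simp
      also have "\<dots> = 2 ^ i * (max \<bar>x\<bar> R) ^ i" by (rule power_mult_distrib)
      also have "\<dots> \<le> 2 ^ i * (\<bar>x\<bar> ^ i + R ^ i)"
        using \<open>R \<ge> 0\<close> by (intro mult_left_mono) (auto simp: max_def)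
      finally show ?thesis by (simp add: power_abs distrib_left)
    qed
    have "\<bar>poly q (x + a)\<bar> \<le> (\<Sum>i\<le>degree q. \<bar>coeff q i * (x + a) ^ i\<bar>)"
      unfolding poly_altdef by (rule sum_abs)
    also have "\<dots> \<le> B x"
      unfolding B_def abs_mult power_abs[of "x + a"] by (intro sum_mono mult_left_mono p) auto
    finally show ?thesis .
  qed
  then show "(LINT x|std_normal_distribution. \<bar>poly q (x + a)\<bar>) \<le> integral\<^sup>L std_normal_distribution (\<lambda>x. \<Sum>i\<le>degree q. \<bar>coeff q i\<bar> * (2 ^ i * \<bar>x ^ i\<bar> + 2 ^ i * R ^ i))"
    using integrable_std_normal_poly_shift[of q a] B unfolding B_def by (intro integral_mono) auto
qed

lemma gauss_density_prod:
  "gauss_density \<sigma> (x - m) = (\<Prod>i\<in>UNIV. normal_density (m $ i) \<sigma> ((x::real^'d) $ i))"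
proof -
  have "- (norm (x - m))\<^sup>2 / (2 * \<sigma>\<^sup>2) = (\<Sum>i\<in>UNIV. - (x $ i - m $ i)\<^sup>2 / (2 * \<sigma>\<^sup>2))"
    by (simp add: norm_vec_def L2_set_def sum_nonneg sum_negf sum_divide_distrib)
  then show ?thesis
    by (simp add: gauss_density_def normal_density_def prod.distrib exp_sum prod_dividef)
qed

lemma gauss_density_nonneg: "0 \<le> gauss_density \<sigma> x"
  by (simp add: gauss_density_def)

lemma borel_measurable_gauss_density[measurable]: "gauss_density \<sigma> \<in> borel_measurable borel"
  unfolding gauss_density_def[abs_def] by measurable

text \<open>The third part, the absolute integral, supplies the integrability hypothesis when the
  latent variable is integrated out.\<close>

lemma gauss_density_integral_poly:
  fixes m :: "real^'d" and p :: "'d \<Rightarrow> real poly"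
  assumes "\<sigma> > 0"
  shows "integrable lborel (\<lambda>y. gauss_density \<sigma> (y - m) * (\<Prod>i\<in>UNIV. poly (p i) (y $ i / \<sigma>)))"
    and "(\<integral>y. gauss_density \<sigma> (y - m) * (\<Prod>i\<in>UNIV. poly (p i) (y $ i / \<sigma>)) \<partial>lborel) =
      (\<Prod>i\<in>UNIV. LINT x|std_normal_distribution. poly (p i) (x + m $ i / \<sigma>))"
    and "(\<integral>y. norm (gauss_density \<sigma> (y - m) * (\<Prod>i\<in>UNIV. poly (p i) (y $ i / \<sigma>))) \<partial>lborel) =
      (\<Prod>i\<in>UNIV. LINT x|std_normal_distribution. \<bar>poly (p i) (x + m $ i / \<sigma>)\<bar>)"
proof -
  have eq: "gauss_density \<sigma> (y - m) * (\<Prod>i\<in>UNIV. poly (p i) (y $ i / \<sigma>)) =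
      (\<Prod>i\<in>UNIV. normal_density (m $ i) \<sigma> (y $ i) * poly (p i) (y $ i / \<sigma>))" for y
    by (simp add: gauss_density_prod prod.distrib)
  have eq': "norm (gauss_density \<sigma> (y - m) * (\<Prod>i\<in>UNIV. poly (p i) (y $ i / \<sigma>))) =
      (\<Prod>i\<in>UNIV. normal_density (m $ i) \<sigma> (y $ i) * \<bar>poly (p i) (y $ i / \<sigma>)\<bar>)" for y
    unfolding eq by (simp add: abs_prod abs_mult)
  have meas: "poly (p i) \<in> borel_measurable borel" for i
    by (intro borel_measurable_continuous_onI continuous_intros)
  note n = normal_density_scale[OF assms meas integrable_std_normal_poly_shift, of "m $ i" i for i]
  have n': "integrable lborel (\<lambda>t. normal_density (m $ i) \<sigma> t * \<bar>poly (p i) (t / \<sigma>)\<bar>)"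
    "(LINT t|lborel. normal_density (m $ i) \<sigma> t * \<bar>poly (p i) (t / \<sigma>)\<bar>) =
      (LINT x|std_normal_distribution. \<bar>poly (p i) (x + m $ i / \<sigma>)\<bar>)" for i
    using normal_density_scale[OF assms borel_measurable_abs[OF meas] integrable_abs[OF integrable_std_normal_poly_shift], of "m $ i" i]
    by auto
  show "integrable lborel (\<lambda>y. gauss_density \<sigma> (y - m) * (\<Prod>i\<in>UNIV. poly (p i) (y $ i / \<sigma>)))"
    unfolding eq by (rule lborel_vec_prod(1)[OF n(1)])
  show "(\<integral>y. gauss_density \<sigma> (y - m) * (\<Prod>i\<in>UNIV. poly (p i) (y $ i / \<sigma>)) \<partial>lborel) =
      (\<Prod>i\<in>UNIV. LINT x|std_normal_distribution. poly (p i) (x + m $ i / \<sigma>))"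
    unfolding eq lborel_vec_prod(2)[OF n(1)] n(2) ..
  show "(\<integral>y. norm (gauss_density \<sigma> (y - m) * (\<Prod>i\<in>UNIV. poly (p i) (y $ i / \<sigma>))) \<partial>lborel) =
      (\<Prod>i\<in>UNIV. LINT x|std_normal_distribution. \<bar>poly (p i) (x + m $ i / \<sigma>)\<bar>)"
    unfolding eq' lborel_vec_prod(2)[OF n'(1)] n'(2) ..
qed

section \<open>Moments of the model\<close>

lemma prod_list_map_eq_prod_count:
  "prod_list (map f is) = (\<Prod>i\<in>UNIV. f i ^ count_list is i)" for f :: "'d::finite \<Rightarrow> real"
proof (induction "is")
  case (Cons j "is")
  have "(\<Prod>i\<in>UNIV. f i ^ count_list (j # is) i) = (\<Prod>i\<in>UNIV. (if i = j then f i else 1) * f i ^ count_list is i)"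
    by (intro prod.cong) auto
  then show ?case using Cons by (simp add: prod.distrib)
qed simp

locale signal_model = prob_space \<mu> for \<mu> :: "'z measure" +
  fixes A :: "'z \<Rightarrow> real^'m^'d" and \<sigma> a :: real
  assumes A_measurable[measurable]: "A \<in> borel_measurable \<mu>"
    and sigma_pos: "\<sigma> > 0"
    and A_bounded: "AE z in \<mu>. onorm ((*v) (A z)) \<le> a"
begin

lemma signal_measurable[measurable]: "(\<lambda>z. A z *v \<theta>) \<in> borel_measurable \<mu>"
proof -
  have "linear (\<lambda>M::real^'m^'d. M *v \<theta>)"
    by (intro linearI) (simp_all add: matrix_vector_mult_add_rdistrib scaleR_matrix_vector_assoc)
  then have "(\<lambda>M::real^'m^'d. M *v \<theta>) \<in> borel_measurable borel"
    by (intro borel_measurable_continuous_onI linear_continuous_on) (simp add: linear_conv_bounded_linear)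
  then show ?thesis by (rule measurable_compose[OF A_measurable])
qed

text \<open>The quantifier over \<open>\<theta>\<close> sits inside, so one null set serves all
  parameters; \<open>\<bar>a\<bar>\<close> appears since \<open>a\<close> carries no sign.\<close>

lemma signal_bounded: "AE z in \<mu>. \<forall>\<theta>. norm (A z *v \<theta>) \<le> \<bar>a\<bar> * norm \<theta>"
  using A_bounded
proof eventually_elim
  case (elim z)
  show ?case
  proof
    fix \<theta>
    have "norm (A z *v \<theta>) \<le> onorm ((*v) (A z)) * norm \<theta>"
      by (rule onorm) (rule matrix_vector_mul_bounded_linear)
    also have "\<dots> \<le> \<bar>a\<bar> * norm \<theta>" using elim by (intro mult_right_mono) auto
    finally show "norm (A z *v \<theta>) \<le> \<bar>a\<bar> * norm \<theta>" .
  qed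
qed

lemma obs_density_measurable[measurable]: "obs_density \<mu> A \<sigma> \<beta> \<theta> \<in> borel_measurable borel"
  unfolding obs_density_def[abs_def] by measurable

lemma obs_density_nonneg: "0 \<le> obs_density \<mu> A \<sigma> \<beta> \<theta> y"
  unfolding obs_density_def by (intro Bochner_Integration.integral_nonneg gauss_density_nonneg)

text \<open>Fubini: for fixed \<open>z\<close> the observation is Gaussian around
  \<open>\<beta> *\<^sub>R (A z *v \<theta>)\<close>, where polynomial integrals factor over
  coordinates. Boundedness of the signal bounds the absolute inner integrals uniformly and so gives
  joint integrability.\<close>

lemma obs_law_integral_poly:
  fixes p :: "'d \<Rightarrow> real poly"
  shows "integrable (obs_law \<mu> A \<sigma> \<beta> \<theta>) (\<lambda>y. \<Prod>i\<in>UNIV. poly (p i) (y $ i / \<sigma>))"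
    and "(LINT y|obs_law \<mu> A \<sigma> \<beta> \<theta>. (\<Prod>i\<in>UNIV. poly (p i) (y $ i / \<sigma>))) =
      (LINT z|\<mu>. (\<Prod>i\<in>UNIV. LINT x|std_normal_distribution. poly (p i) (x + \<beta> * (A z *v \<theta>) $ i / \<sigma>)))"
proof -
  interpret P: pair_sigma_finite \<mu> "lborel :: (real^'d) measure" ..
  define F where "F y = (\<Prod>i\<in>UNIV. poly (p i) (y $ i / \<sigma>))" for y :: "real^'d"
  have pm[measurable]: "poly q \<in> borel_measurable borel" for q :: "real poly"
    by (intro borel_measurable_continuous_onI continuous_intros)
  have F[measurable]: "F \<in> borel_measurable borel"
    unfolding F_def by measurable
  define h where "h = (\<lambda>(z, y). gauss_density \<sigma> (y - \<beta> *\<^sub>R (A z *v \<theta>)) * F y)"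
  have h[measurable]: "h \<in> borel_measurable (\<mu> \<Otimes>\<^sub>M lborel)"
    unfolding h_def by measurable
  have "\<exists>K. \<forall>b. \<bar>b\<bar> \<le> \<bar>\<beta>\<bar> * (\<bar>a\<bar> * norm \<theta>) / \<sigma> \<longrightarrow>
      (LINT x|std_normal_distribution. \<bar>poly (p i) (x + b)\<bar>) \<le> K" for i
    using std_normal_abs_poly_shift_bound by metis
  then obtain K where K: "\<And>i b. \<bar>b\<bar> \<le> \<bar>\<beta>\<bar> * (\<bar>a\<bar> * norm \<theta>) / \<sigma> \<Longrightarrow>
      (LINT x|std_normal_distribution. \<bar>poly (p i) (x + b)\<bar>) \<le> K i"
    by metis
  have bnd: "AE z in \<mu>. norm (\<integral>y. norm (h (z, y)) \<partial>lborel) \<le> (\<Prod>i\<in>UNIV. K i)"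
    using signal_bounded
  proof eventually_elim
    case (elim z)
    have "(\<integral>y. norm (h (z, y)) \<partial>lborel) =
        (\<Prod>i\<in>UNIV. LINT x|std_normal_distribution. \<bar>poly (p i) (x + (\<beta> *\<^sub>R (A z *v \<theta>)) $ i / \<sigma>)\<bar>)"
      unfolding h_def F_def prod.case by (rule gauss_density_integral_poly(3)[OF sigma_pos])
    also have "\<dots> \<le> (\<Prod>i\<in>UNIV. K i)"
    proof (intro prod_mono conjI K)
      fix i
      have "\<bar>(A z *v \<theta>) $ i\<bar> \<le> \<bar>a\<bar> * norm \<theta>"
        using elim component_le_norm_cart order_trans by blast
      then show "\<bar>(\<beta> *\<^sub>R (A z *v \<theta>)) $ i / \<sigma>\<bar> \<le> \<bar>\<beta>\<bar> * (\<bar>a\<bar> * norm \<theta>) / \<sigma>"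
        using sigma_pos by (simp add: abs_mult divide_right_mono mult_left_mono)
    qed auto
    finally show ?case by simp
  qed
  have int: "integrable (\<mu> \<Otimes>\<^sub>M lborel) h"
  proof (rule P.Fubini_integrable[OF h])
    show "integrable \<mu> (\<lambda>z. \<integral>y. norm (h (z, y)) \<partial>lborel)"
      by (rule integrable_const_bound[OF bnd]) measurable
    show "AE z in \<mu>. integrable lborel (\<lambda>y. h (z, y))"
      unfolding h_def F_def prod.case by (intro AE_I2 gauss_density_integral_poly(1)[OF sigma_pos])
  qed
  have eq: "obs_density \<mu> A \<sigma> \<beta> \<theta> y *\<^sub>R F y = (\<integral>z. h (z, y) \<partial>\<mu>)" for y
    by (simp add: obs_density_def h_def)
  have "integrable lborel (\<lambda>y. obs_density \<mu> A \<sigma> \<beta> \<theta> y *\<^sub>R F y)"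
    unfolding eq using P.integrable_snd[of "\<lambda>z y. h (z, y)"] int by simp
  then show "integrable (obs_law \<mu> A \<sigma> \<beta> \<theta>) (\<lambda>y. \<Prod>i\<in>UNIV. poly (p i) (y $ i / \<sigma>))"
    unfolding obs_law_def F_def[symmetric]
    by (subst integrable_density) (auto simp: obs_density_nonneg)
  have "(LINT y|obs_law \<mu> A \<sigma> \<beta> \<theta>. F y) = (\<integral>y. obs_density \<mu> A \<sigma> \<beta> \<theta> y *\<^sub>R F y \<partial>lborel)"
    unfolding obs_law_def by (subst integral_density) (auto simp: obs_density_nonneg)
  also have "\<dots> = (\<integral>z. (\<integral>y. h (z, y) \<partial>lborel) \<partial>\<mu>)"
    unfolding eq using P.Fubini_integral[of "\<lambda>z y. h (z, y)"] int by simp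
  also have "\<dots> = (LINT z|\<mu>. (\<Prod>i\<in>UNIV. LINT x|std_normal_distribution. poly (p i) (x + \<beta> * (A z *v \<theta>) $ i / \<sigma>)))"
    unfolding h_def F_def prod.case gauss_density_integral_poly(2)[OF sigma_pos] by simp
  finally show "(LINT y|obs_law \<mu> A \<sigma> \<beta> \<theta>. (\<Prod>i\<in>UNIV. poly (p i) (y $ i / \<sigma>))) =
      (LINT z|\<mu>. (\<Prod>i\<in>UNIV. LINT x|std_normal_distribution. poly (p i) (x + \<beta> * (A z *v \<theta>) $ i / \<sigma>)))"
    unfolding F_def .
qed

text \<open>Given \<open>z\<close>, the coordinatewise Hermite means multiply to the entry at
  \<open>is\<close> of the \<open>k\<close>-th tensor power of \<open>\<beta> / \<sigma>\<close>
  times the signal; averaging over \<open>z\<close> leaves the signal moment.\<close>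

lemma hermite_tensor_mean:
  assumes "length is = k"
  shows "integrable (obs_law \<mu> A \<sigma> \<beta> \<theta>) (\<lambda>y. hermite_tensor k ((1 / \<sigma>) *\<^sub>R y) is)"
    and "(LINT y|obs_law \<mu> A \<sigma> \<beta> \<theta>. hermite_tensor k ((1 / \<sigma>) *\<^sub>R y) is) = (\<beta> / \<sigma>) ^ k * signal_moment \<mu> A k \<theta> is"
proof -
  have eq: "hermite_tensor k ((1 / \<sigma>) *\<^sub>R y) is = (\<Prod>j\<in>UNIV. poly (Hermite_poly (count_list is j)) (y $ j / \<sigma>))" for y :: "real^'d"
    by (simp add: hermite_tensor_eq[OF assms])
  have scale: "prod_list (map (\<lambda>i. (\<beta> / \<sigma>) * v i) is) = (\<beta> / \<sigma>) ^ k * prod_list (map v is)" for v :: "'d \<Rightarrow> real"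
    unfolding assms[symmetric] by (induction "is") (simp_all add: mult_ac)
  show "integrable (obs_law \<mu> A \<sigma> \<beta> \<theta>) (\<lambda>y. hermite_tensor k ((1 / \<sigma>) *\<^sub>R y) is)"
    unfolding eq by (rule obs_law_integral_poly(1))
  have "(LINT y|obs_law \<mu> A \<sigma> \<beta> \<theta>. hermite_tensor k ((1 / \<sigma>) *\<^sub>R y) is) =
      (LINT z|\<mu>. prod_list (map (\<lambda>i. (\<beta> / \<sigma>) * (A z *v \<theta>) $ i) is))"
    unfolding eq obs_law_integral_poly(2) integral_Hermite_poly_shift
    by (simp add: prod_list_map_eq_prod_count)
  also have "\<dots> = (LINT z|\<mu>. (\<beta> / \<sigma>) ^ k * prod_list (map (\<lambda>i. (A z *v \<theta>) $ i) is))"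
    by (simp only: scale)
  finally show "(LINT y|obs_law \<mu> A \<sigma> \<beta> \<theta>. hermite_tensor k ((1 / \<sigma>) *\<^sub>R y) is) = (\<beta> / \<sigma>) ^ k * signal_moment \<mu> A k \<theta> is"
    using assms by (simp add: signal_moment_def)
qed

lemma hermite_tensor_mult_integrable:
  assumes "length is = k" "length js = l"
  shows "integrable (obs_law \<mu> A \<sigma> \<beta> \<theta>) (\<lambda>y. hermite_tensor k ((1 / \<sigma>) *\<^sub>R y) is * hermite_tensor l ((1 / \<sigma>) *\<^sub>R y) js)"
proof -
  have eq: "hermite_tensor k ((1 / \<sigma>) *\<^sub>R y) is * hermite_tensor l ((1 / \<sigma>) *\<^sub>R y) js =
      (\<Prod>j\<in>UNIV. poly (Hermite_poly (count_list is j) * Hermite_poly (count_list js j)) (y $ j / \<sigma>))" for y :: "real^'d"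
    by (simp add: hermite_tensor_eq assms prod.distrib)
  show ?thesis unfolding eq by (rule obs_law_integral_poly(1))
qed

text \<open>The weight makes the induction possible: expanding \<open>A z *v \<theta>\<close> in the
  first index leaves a factor \<open>A z $ i $ j\<close>, which joins the weight and keeps it
  bounded. Unweighted moments are the case of weight \<open>1\<close>.\<close>

lemma weighted_moment_polynomial:
  assumes "w \<in> borel_measurable \<mu>" "AE z in \<mu>. \<bar>w z\<bar> \<le> c"
  shows "(\<forall>\<theta>. integrable \<mu> (\<lambda>z. w z * prod_list (map (\<lambda>i. (A z *v \<theta>) $ i) is))) \<and>
    real_polynomial_function (\<lambda>\<theta>. LINT z|\<mu>. w z * prod_list (map (\<lambda>i. (A z *v \<theta>) $ i) is))"
  using assms
proof (induction "is" arbitrary: w c)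
  case Nil
  have "integrable \<mu> w"
  proof (rule integrable_const_bound)
    show "AE z in \<mu>. norm (w z) \<le> c" using Nil.prems(2) unfolding real_norm_def .
  qed (rule Nil.prems(1))
  then show ?case by (simp only: list.map prod_list.Nil mult_1_right real_polynomial_function.intros(2) simp_thms)
next
  case (Cons i "is")
  define w' where "w' j z = w z * A z $ i $ j" for j z
  have Aij: "A z $ i $ j = (A z *v axis j 1) $ i" for z j
    by (simp add: matrix_vector_mult_basis column_def)
  have w': "w' j \<in> borel_measurable \<mu>" "AE z in \<mu>. \<bar>w' j z\<bar> \<le> c * \<bar>a\<bar>" for j
  proof -
    show "w' j \<in> borel_measurable \<mu>" unfolding w'_def Aij
      by (intro borel_measurable_times Cons.prems(1) measurable_compose[OF signal_measurable]
          borel_measurable_continuous_onI continuous_intros)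
    show "AE z in \<mu>. \<bar>w' j z\<bar> \<le> c * \<bar>a\<bar>"
      using Cons.prems(2) signal_bounded
    proof eventually_elim
      case (elim z)
      have "\<bar>A z $ i $ j\<bar> \<le> norm (A z *v axis j 1)" unfolding Aij by (rule component_le_norm_cart)
      also have "\<dots> \<le> \<bar>a\<bar>" using elim(2)[rule_format, of "axis j 1"] by simp
      finally show ?case unfolding w'_def abs_mult using elim(1) by (intro mult_mono) auto
    qed
  qed
  note IH = Cons.IH[OF w']
  have eq: "w z * prod_list (map (\<lambda>i. (A z *v \<theta>) $ i) (i # is)) =
      (\<Sum>j\<in>UNIV. \<theta> $ j * (w' j z * prod_list (map (\<lambda>i. (A z *v \<theta>) $ i) is)))" for z \<theta>
    by (simp add: matrix_vector_mult_def w'_def sum_distrib_left sum_distrib_right algebra_simps)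
  have "(LINT z|\<mu>. w z * prod_list (map (\<lambda>i. (A z *v \<theta>) $ i) (i # is))) =
      (\<Sum>j\<in>UNIV. \<theta> $ j * (LINT z|\<mu>. w' j z * prod_list (map (\<lambda>i. (A z *v \<theta>) $ i) is)))" for \<theta>
    unfolding eq using IH by (subst Bochner_Integration.integral_sum) auto
  moreover have "real_polynomial_function (\<lambda>\<theta>::real^'m. \<theta> $ j)" for j
    by (rule real_polynomial_function.intros(1)) (rule bounded_linear_vec_nth)
  ultimately show ?case
    unfolding eq using IH by (auto intro!: real_polynomial_function_sum real_polynomial_function.intros(4))
qed

lemma signal_moment_polynomial: "real_polynomial_function (\<lambda>\<theta>. signal_moment \<mu> A k \<theta> is)"
  using weighted_moment_polynomial[of "\<lambda>_. 1" 1 "is"]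
  by (cases "length is = k") (simp_all add: signal_moment_def real_polynomial_function.intros(2))

lemma signal_moment_mset:
  assumes "mset is = mset js"
  shows "signal_moment \<mu> A k \<theta> is = signal_moment \<mu> A k \<theta> js"
proof -
  have "prod_list (map f is) = prod_list (map f js)" for f :: "'d \<Rightarrow> real"
    unfolding prod_mset_prod_list[symmetric] mset_map assms ..
  then show ?thesis
    using mset_eq_length[OF assms] by (simp add: signal_moment_def)
qed

text \<open>The basis tensors \<open>e\<close> span symmetric tensors only, so symmetry is what
  allows the derivative to be expanded in them.\<close>

lemma D_signal_moment_sym: "sym_tensor k (D_signal_moment \<mu> A k \<theta> h)"
  unfolding sym_tensor_def
proof (intro conjI allI impI)
  fix "is" :: "'d list" assume "length is \<noteq> k"
  then have "(\<lambda>\<theta>. signal_moment \<mu> A k \<theta> is) = (\<lambda>_. 0)"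
    by (simp add: signal_moment_def)
  then show "D_signal_moment \<mu> A k \<theta> h is = 0"
    by (simp add: D_signal_moment_def)
next
  fix "is" js :: "'d list" assume "mset is = mset js"
  then have "(\<lambda>\<theta>. signal_moment \<mu> A k \<theta> is) = (\<lambda>\<theta>. signal_moment \<mu> A k \<theta> js)"
    by (intro ext signal_moment_mset)
  then show "D_signal_moment \<mu> A k \<theta> h is = D_signal_moment \<mu> A k \<theta> h js"
    by (simp add: D_signal_moment_def)
qed

end

text \<open>The derivative is packaged as a continuous map into bounded linear functions, since the
  first-order estimate compares \<open>DM x\<close> with \<open>DM x0\<close> in operator
  norm.\<close>

lemma real_polynomial_function_C1:
  fixes p :: "'a::real_normed_vector \<Rightarrow> real"
  assumes "real_polynomial_function p"
  shows "\<exists>D :: 'a \<Rightarrow> 'a \<Rightarrow>\<^sub>L real. (\<forall>x. (p has_derivative blinfun_apply (D x)) (at x)) \<and> continuous_on UNIV D"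
  using assms
proof (induction p rule: real_polynomial_function.induct)
  case (linear f)
  then show ?case
    by (intro exI[of _ "\<lambda>_. Blinfun f"])
       (simp add: bounded_linear_Blinfun_apply bounded_linear_imp_has_derivative)
next
  case (const c)
  then show ?case by (intro exI[of _ "\<lambda>_. 0"]) simp
next
  case (add f g)
  then obtain Df Dg where D: "\<And>x. (f has_derivative blinfun_apply (Df x)) (at x)" "continuous_on UNIV Df"
    "\<And>x. (g has_derivative blinfun_apply (Dg x)) (at x)" "continuous_on UNIV Dg" by blast
  show ?case
  proof (intro exI[of _ "\<lambda>x. Df x + Dg x"] conjI allI)
    show "((\<lambda>x. f x + g x) has_derivative blinfun_apply (Df x + Dg x)) (at x)" for x
      using has_derivative_add[OF D(1,3)] by (simp add: plus_blinfun.rep_eq)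
  qed (intro continuous_intros D)
next
  case (mult f g)
  then obtain Df Dg where D: "\<And>x. (f has_derivative blinfun_apply (Df x)) (at x)" "continuous_on UNIV Df"
    "\<And>x. (g has_derivative blinfun_apply (Dg x)) (at x)" "continuous_on UNIV Dg" by blast
  have fg: "continuous_on UNIV f" "continuous_on UNIV g"
    using D by (auto intro!: has_derivative_continuous continuous_at_imp_continuous_on)
  show ?case
  proof (intro exI[of _ "\<lambda>x. f x *\<^sub>R Dg x + g x *\<^sub>R Df x"] conjI allI)
    fix x
    have "((\<lambda>x. f x * g x) has_derivative (\<lambda>h. f x * Dg x h + Df x h * g x)) (at x)"
      by (rule has_derivative_mult[OF D(1,3)])
    then show "((\<lambda>x. f x * g x) has_derivative blinfun_apply (f x *\<^sub>R Dg x + g x *\<^sub>R Df x)) (at x)"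
      by (simp add: plus_blinfun.rep_eq scaleR_blinfun.rep_eq mult.commute)
  qed (intro continuous_intros D fg)
qed

lemma vec_polynomial_C1:
  fixes M :: "'a::real_normed_vector \<Rightarrow> real^'k"
  assumes "\<And>\<kappa>. real_polynomial_function (\<lambda>x. M x $ \<kappa>)"
  shows "\<exists>D :: 'a \<Rightarrow> 'a \<Rightarrow>\<^sub>L (real^'k). (\<forall>x. (M has_derivative blinfun_apply (D x)) (at x)) \<and> continuous_on UNIV D"
proof -
  obtain D :: "'k \<Rightarrow> 'a \<Rightarrow> 'a \<Rightarrow>\<^sub>L real" where D: "\<And>\<kappa> x. ((\<lambda>x. M x $ \<kappa>) has_derivative blinfun_apply (D \<kappa> x)) (at x)"
    "\<And>\<kappa>. continuous_on UNIV (D \<kappa>)"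
    using real_polynomial_function_C1[OF assms] by metis
  define a :: "'k \<Rightarrow> real \<Rightarrow>\<^sub>L (real^'k)" where "a \<kappa> = Blinfun (\<lambda>r. r *\<^sub>R axis \<kappa> 1)" for \<kappa>
  have a: "blinfun_apply (a \<kappa>) r = r *\<^sub>R axis \<kappa> 1" for \<kappa> r
    unfolding a_def by (subst bounded_linear_Blinfun_apply) (rule bounded_linear_scaleR_left, simp)
  have vec: "v = (\<Sum>\<kappa>\<in>UNIV. (v $ \<kappa>) *\<^sub>R axis \<kappa> 1)" for v :: "real^'k"
    by (simp add: basis_expansion flip: scalar_mult_eq_scaleR)
  show ?thesis
  proof (intro exI[of _ "\<lambda>x. \<Sum>\<kappa>\<in>UNIV. a \<kappa> o\<^sub>L D \<kappa> x"] conjI allI)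
    fix x
    have "((\<lambda>x. \<Sum>\<kappa>\<in>UNIV. (M x $ \<kappa>) *\<^sub>R axis \<kappa> 1) has_derivative (\<lambda>h. \<Sum>\<kappa>\<in>UNIV. D \<kappa> x h *\<^sub>R axis \<kappa> 1)) (at x)"
      by (intro has_derivative_sum has_derivative_scaleR_left D)
    moreover have ap: "blinfun_apply (\<Sum>\<kappa>\<in>UNIV. a \<kappa> o\<^sub>L D \<kappa> x) = (\<lambda>h. \<Sum>\<kappa>\<in>UNIV. D \<kappa> x h *\<^sub>R axis \<kappa> 1)"
      by (rule ext) (simp add: blinfun.sum_left a)
    ultimately show "(M has_derivative blinfun_apply (\<Sum>\<kappa>\<in>UNIV. a \<kappa> o\<^sub>L D \<kappa> x)) (at x)"
      by (subst ext[of M, OF vec], subst ap)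
  qed (intro continuous_intros D)
qed

lemma integrable_vec:
  fixes f :: "'a \<Rightarrow> real^'k"
  assumes "\<And>\<kappa>. integrable M (\<lambda>x. f x $ \<kappa>)"
  shows "integrable M f" "integral\<^sup>L M f $ \<kappa> = (LINT x|M. f x $ \<kappa>)"
proof -
  have vec: "v = (\<Sum>\<kappa>\<in>UNIV. (v $ \<kappa>) *\<^sub>R axis \<kappa> 1)" for v :: "real^'k"
    by (simp add: basis_expansion flip: scalar_mult_eq_scaleR)
  have "integrable M (\<lambda>x. \<Sum>\<kappa>\<in>UNIV. (f x $ \<kappa>) *\<^sub>R axis \<kappa> 1)"
    by (intro Bochner_Integration.integrable_sum integrable_scaleR_left assms)
  then show "integrable M f" by (subst ext[of f, OF vec])
  then show "integral\<^sup>L M f $ \<kappa> = (LINT x|M. f x $ \<kappa>)"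
    by (rule integral_bounded_linear[OF bounded_linear_vec_nth, symmetric])
qed

section \<open>Moments and derivative of the feature map\<close>

context signal_model
begin

lemma feature_integrable:
  "integrable (obs_law \<mu> A \<sigma> \<beta> \<theta>) (\<lambda>y. feature \<sigma> ord e y $ \<kappa>)"
  "integrable (obs_law \<mu> A \<sigma> \<beta> \<theta>) (\<lambda>y. feature \<sigma> ord e y $ \<kappa> * feature \<sigma> ord e y $ \<kappa>')"
proof -
  show "integrable (obs_law \<mu> A \<sigma> \<beta> \<theta>) (\<lambda>y. feature \<sigma> ord e y $ \<kappa>)"
    unfolding feature_def frob_inner_def
    by (auto intro!: Bochner_Integration.integrable_sum integrable_mult_right hermite_tensor_mean(1))
  have eq: "feature \<sigma> ord e y $ \<kappa> * feature \<sigma> ord e y $ \<kappa>' =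
      (\<Sum>is | length is = ord \<kappa>. \<Sum>js | length js = ord \<kappa>'. (e \<kappa> is * e \<kappa>' js) *
        (hermite_tensor (ord \<kappa>) ((1 / \<sigma>) *\<^sub>R y) is * hermite_tensor (ord \<kappa>') ((1 / \<sigma>) *\<^sub>R y) js))" for y
    unfolding feature_def frob_inner_def by (simp add: sum_product mult_ac)
  show "integrable (obs_law \<mu> A \<sigma> \<beta> \<theta>) (\<lambda>y. feature \<sigma> ord e y $ \<kappa> * feature \<sigma> ord e y $ \<kappa>')"
    unfolding eq
    by (intro Bochner_Integration.integrable_sum integrable_mult_right hermite_tensor_mult_integrable) auto
qed

lemma mean_feature_eq:
  "mean_feature \<mu> A \<sigma> \<beta> (feature \<sigma> ord e) \<theta> $ \<kappa> =
    (\<beta> / \<sigma>) ^ ord \<kappa> * frob_inner (ord \<kappa>) (e \<kappa>) (signal_moment \<mu> A (ord \<kappa>) \<theta>)"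
proof -
  have "mean_feature \<mu> A \<sigma> \<beta> (feature \<sigma> ord e) \<theta> $ \<kappa> = (LINT y|obs_law \<mu> A \<sigma> \<beta> \<theta>. feature \<sigma> ord e y $ \<kappa>)"
    unfolding mean_feature_def by (rule integrable_vec(2)[OF feature_integrable(1)])
  also have "\<dots> = (\<Sum>is | length is = ord \<kappa>. e \<kappa> is * ((\<beta> / \<sigma>) ^ ord \<kappa> * signal_moment \<mu> A (ord \<kappa>) \<theta> is))"
    unfolding feature_def frob_inner_def vec_lambda_beta
    by (subst Bochner_Integration.integral_sum) (auto simp: hermite_tensor_mean intro!: sum.cong)
  finally show ?thesis by (simp add: frob_inner_def sum_distrib_left mult_ac)
qed

lemma mean_feature_C1:
  "\<exists>D :: real^'m \<Rightarrow> (real^'m) \<Rightarrow>\<^sub>L (real^'k::finite).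
     (\<forall>\<theta>. (mean_feature \<mu> A \<sigma> \<beta> (feature \<sigma> ord e) has_derivative blinfun_apply (D \<theta>)) (at \<theta>)) \<and> continuous_on UNIV D"
proof (rule vec_polynomial_C1)
  have "finite {is :: 'd list. length is = k}" for k
    using finite_lists_length_eq[of "UNIV :: 'd set" k] by simp
  then show "real_polynomial_function (\<lambda>\<theta>. mean_feature \<mu> A \<sigma> \<beta> (feature \<sigma> ord e) \<theta> $ \<kappa>)" for \<kappa>
    unfolding mean_feature_eq frob_inner_def
    by (intro real_polynomial_function_sum real_polynomial_function.intros(2,4) signal_moment_polynomial)
qed

text \<open>If \<open>D h = 0\<close>, the derivative \<open>t\<close> of the order-\<open>j\<close>
  moment is Frobenius-orthogonal to all basis tensors of order \<open>j\<close>, the factor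
  \<open>(\<beta> / \<sigma>) ^ j\<close> being nonzero. As \<open>t\<close> is itself a combination
  of them, it is orthogonal to itself and vanishes.\<close>

lemma D_mean_feature_nonzero:
  assumes bases: "sym_tensor_bases L ord e" and j: "1 \<le> j" "j \<le> L" and "\<beta> > 0"
    and D: "(mean_feature \<mu> A \<sigma> \<beta> (feature \<sigma> ord e) has_derivative D) (at \<theta>)"
    and h: "D_signal_moment \<mu> A j \<theta> h \<noteq> (\<lambda>is. 0)"
  shows "D h \<noteq> 0"
proof
  assume 0: "D h = 0"
  define t where "t = D_signal_moment \<mu> A j \<theta> h"
  have dT: "((\<lambda>\<theta>. signal_moment \<mu> A k \<theta> is) has_derivative (\<lambda>h. D_signal_moment \<mu> A k \<theta> h is)) (at \<theta>)" for k "is"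
    unfolding D_signal_moment_def frechet_derivative_works[symmetric]
    using differentiable_at_real_polynomial_function[OF signal_moment_polynomial] .
  have e0: "frob_inner j (e \<kappa>) t = 0" if "ord \<kappa> = j" for \<kappa>
  proof -
    have "((\<lambda>\<theta>. (\<beta> / \<sigma>) ^ ord \<kappa> * frob_inner (ord \<kappa>) (e \<kappa>) (signal_moment \<mu> A (ord \<kappa>) \<theta>)) has_derivative
        (\<lambda>h. (\<beta> / \<sigma>) ^ ord \<kappa> * frob_inner (ord \<kappa>) (e \<kappa>) (D_signal_moment \<mu> A (ord \<kappa>) \<theta> h))) (at \<theta>)"
      unfolding frob_inner_def by (intro has_derivative_mult_right has_derivative_sum dT)
    moreover have "((\<lambda>\<theta>. (\<beta> / \<sigma>) ^ ord \<kappa> * frob_inner (ord \<kappa>) (e \<kappa>) (signal_moment \<mu> A (ord \<kappa>) \<theta>)) has_derivative (\<lambda>h. D h $ \<kappa>)) (at \<theta>)"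
      unfolding mean_feature_eq[symmetric] by (rule bounded_linear.has_derivative[OF bounded_linear_vec_nth D])
    ultimately have "(\<lambda>h. (\<beta> / \<sigma>) ^ ord \<kappa> * frob_inner (ord \<kappa>) (e \<kappa>) (D_signal_moment \<mu> A (ord \<kappa>) \<theta> h)) = (\<lambda>h. D h $ \<kappa>)"
      by (rule has_derivative_unique)
    from fun_cong[OF this, of h] show ?thesis
      using 0 \<open>\<beta> > 0\<close> sigma_pos that by (simp add: t_def)
  qed
  have sym: "sym_tensor j t" unfolding t_def by (rule D_signal_moment_sym)
  then obtain c where c: "\<And>is. t is = (\<Sum>\<kappa> | ord \<kappa> = j. c \<kappa> * e \<kappa> is)"
    using bases j unfolding sym_tensor_bases_def by (metis atLeastAtMost_iff)
  have "frob_inner j t t = (\<Sum>is | length is = j. \<Sum>\<kappa> | ord \<kappa> = j. c \<kappa> * (e \<kappa> is * t is))"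
    unfolding frob_inner_def by (subst c) (simp add: sum_distrib_left mult_ac)
  also have "\<dots> = (\<Sum>\<kappa> | ord \<kappa> = j. c \<kappa> * frob_inner j (e \<kappa>) t)"
    unfolding frob_inner_def by (subst sum.swap) (simp add: sum_distrib_left)
  also have "\<dots> = 0" using e0 by simp
  finally have "(\<Sum>is | length is = j. t is * t is) = 0" unfolding frob_inner_def .
  moreover have "finite {is :: 'd list. length is = j}"
    using finite_lists_length_eq[of "UNIV :: 'd set" j] by simp
  ultimately have "t is = 0" if "length is = j" for "is"
    using that by (subst (asm) sum_nonneg_eq_0_iff) auto
  then have "t = (\<lambda>is. 0)" using sym unfolding sym_tensor_def by blast
  then show False using h unfolding t_def by simp
qed

end

section \<open>Central limit theorem and Slutsky's lemma for random vectors\<close>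

lemma integral_distr_vec:
  fixes f :: "'b::euclidean_space \<Rightarrow> real"
  assumes "X \<in> borel_measurable P" "continuous_on UNIV f"
  shows "integral\<^sup>L (distr P borel X) f = (\<integral>\<omega>. f (X \<omega>) \<partial>P)"
  using assms by (intro integral_distr borel_measurable_continuous_onI)

text \<open>\<open>tail_fun\<close> dominates the indicator of large norm and is an admissible test
  function, so its limiting integral, small for large \<open>k\<close> by dominated convergence,
  controls the tail probabilities eventually in \<open>n\<close>.\<close>

lemma (in prob_space) weak_conv_vec_tight:
  fixes Y :: "nat \<Rightarrow> 'a \<Rightarrow> 'b::euclidean_space"
  assumes Y[measurable]: "\<And>n. Y n \<in> borel_measurable M"
    and conv: "weak_conv_vec (\<lambda>n. distr M borel (Y n)) \<nu>" and \<nu>: "prob_space \<nu>" "sets \<nu> = sets borel"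
    and "\<epsilon> > 0"
  obtains K where "K > 0" "eventually (\<lambda>n. prob {\<omega>\<in>space M. norm (Y n \<omega>) > K} < \<epsilon>) sequentially"
proof -
  interpret \<nu>: prob_space \<nu> by fact
  have tm: "tail_fun k \<in> borel_measurable \<nu>" for k :: real
    using borel_measurable_continuous_onI[OF continuous_tail_fun] measurable_cong_sets[OF \<nu>(2) refl] by blast
  have "(\<lambda>k. integral\<^sup>L \<nu> (tail_fun (real k))) \<longlonglongrightarrow> (\<integral>x. 0 \<partial>\<nu>)"
    by (rule integral_dominated_convergence[where w="\<lambda>_. DIM('b)"])
       (auto simp: tail_fun_tendsto_0 tail_fun_nonneg tail_fun_le tm)
  then have "eventually (\<lambda>k. integral\<^sup>L \<nu> (tail_fun (real k)) < \<epsilon>) sequentially"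
    using order_tendstoD(2)[of _ 0 sequentially \<epsilon>] \<open>\<epsilon> > 0\<close> by simp
  then obtain k :: nat where k: "integral\<^sup>L \<nu> (tail_fun (real k)) < \<epsilon>"
    by (auto simp: eventually_sequentially)
  have "bounded (range (tail_fun (real k) :: 'b \<Rightarrow> real))"
    by (intro boundedI[of _ "DIM('b)"]) (auto simp: tail_fun_nonneg tail_fun_le)
  then have "(\<lambda>n. integral\<^sup>L (distr M borel (Y n)) (tail_fun (real k))) \<longlonglongrightarrow> integral\<^sup>L \<nu> (tail_fun (real k))"
    using conv continuous_tail_fun unfolding weak_conv_vec_def by blast
  then have ev: "eventually (\<lambda>n. (\<integral>\<omega>. tail_fun (real k) (Y n \<omega>) \<partial>M) < \<epsilon>) sequentially"
    using order_tendstoD(2)[OF _ k] by (simp add: integral_distr_vec continuous_tail_fun)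
  define K where "K = (real k + 1) * real (DIM('b))"
  have "prob {\<omega>\<in>space M. norm (Y n \<omega>) > K} \<le> (\<integral>\<omega>. tail_fun (real k) (Y n \<omega>) \<partial>M)" for n
  proof -
    have tY: "(\<lambda>\<omega>. tail_fun (real k) (Y n \<omega>)) \<in> borel_measurable M"
      by (rule measurable_compose[OF Y borel_measurable_continuous_onI[OF continuous_tail_fun]])
    have "prob {\<omega>\<in>space M. norm (Y n \<omega>) > K} = (\<integral>\<omega>. indicator {\<omega>\<in>space M. norm (Y n \<omega>) > K} \<omega> \<partial>M)"
      by simp
    also have "\<dots> \<le> (\<integral>\<omega>. tail_fun (real k) (Y n \<omega>) \<partial>M)"
    proof (rule integral_mono)
      show "integrable M (\<lambda>\<omega>. tail_fun (real k) (Y n \<omega>))"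
        using tY by (intro integrable_const_bound[of _ "DIM('b)"]) (auto simp: tail_fun_nonneg tail_fun_le)
      show "indicator {\<omega>\<in>space M. norm (Y n \<omega>) > K} \<omega> \<le> tail_fun (real k) (Y n \<omega>)" for \<omega>
        using tail_fun_ge_1[of "real k" "Y n \<omega>"] tail_fun_nonneg[of "real k" "Y n \<omega>"]
        by (auto simp: indicator_def K_def)
    qed (auto simp: emeasure_eq_measure)
    finally show ?thesis .
  qed
  then have "eventually (\<lambda>n. prob {\<omega>\<in>space M. norm (Y n \<omega>) > K} < \<epsilon>) sequentially"
    by (intro eventually_mono[OF ev]) (meson le_less_trans)
  moreover have "K > 0" unfolding K_def by (intro mult_pos_pos) auto
  ultimately show ?thesis using that by blast
qed

lemma iexp_lipschitz: "cmod (iexp u - iexp v) \<le> \<bar>u - v\<bar>"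
proof -
  have "iexp u - iexp v = iexp v * (iexp (u - v) - 1)"
    by (simp add: algebra_simps flip: exp_add)
  then have "cmod (iexp u - iexp v) = cmod (iexp (u - v) - 1)"
    by (simp add: norm_mult)
  then show ?thesis using iexp_approx1[of "u - v" 0] by simp
qed

text \<open>By the characteristic function criterion it suffices to test with \<open>cos\<close> and
  \<open>sin\<close> of \<open>t \<bullet> x\<close>, which are bounded and 1-Lipschitz: a small
  difference costs little, and a large one is improbable.\<close>

lemma (in prob_space) weak_conv_vec_Slutsky:
  fixes X Y :: "nat \<Rightarrow> 'a \<Rightarrow> 'b::euclidean_space"
  assumes X[measurable]: "\<And>n. X n \<in> borel_measurable M" and Y[measurable]: "\<And>n. Y n \<in> borel_measurable M"
    and conv: "weak_conv_vec (\<lambda>n. distr M borel (Y n)) \<nu>" and \<nu>: "prob_space \<nu>" "sets \<nu> = sets borel"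
    and diff: "\<And>\<epsilon>. \<epsilon> > 0 \<Longrightarrow> (\<lambda>n. prob {\<omega>\<in>space M. norm (X n \<omega> - Y n \<omega>) > \<epsilon>}) \<longlonglongrightarrow> 0"
  shows "weak_conv_vec (\<lambda>n. distr M borel (X n)) \<nu>"
proof -
  have step: "(\<lambda>n. \<integral>x. g (t \<bullet> x) \<partial>distr M borel (X n)) \<longlonglongrightarrow> (\<integral>x. g (t \<bullet> x) \<partial>\<nu>)"
    if g: "continuous_on UNIV g" "\<And>u v. \<bar>g u - g v\<bar> \<le> \<bar>u - v\<bar>" "\<And>u. \<bar>g u\<bar> \<le> 1" for g :: "real \<Rightarrow> real" and t :: 'b
  proof -
    have gt: "continuous_on UNIV (\<lambda>x. g (t \<bullet> x))"
      by (intro continuous_on_compose2[OF g(1)] continuous_intros) auto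
    have gm[measurable]: "g \<in> borel_measurable borel" by (rule borel_measurable_continuous_onI[OF g(1)])
    have int: "integrable M (\<lambda>\<omega>. g (t \<bullet> Z \<omega>))" if [measurable]: "Z \<in> borel_measurable M" for Z
      by (rule integrable_const_bound[of _ 1]) (auto simp: g)
    have "bounded (range (\<lambda>x. g (t \<bullet> x)))"
      using g(3) by (intro boundedI[of _ 1]) auto
    then have lim: "(\<lambda>n. \<integral>x. g (t \<bullet> x) \<partial>distr M borel (Y n)) \<longlonglongrightarrow> (\<integral>x. g (t \<bullet> x) \<partial>\<nu>)"
      using conv gt unfolding weak_conv_vec_def by blast
    have "(\<lambda>n. (\<integral>\<omega>. g (t \<bullet> X n \<omega>) \<partial>M) - (\<integral>\<omega>. g (t \<bullet> Y n \<omega>) \<partial>M)) \<longlonglongrightarrow> 0"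
    proof (rule LIMSEQ_I)
      fix r :: real assume "r > 0"
      \<comment> \<open>Outside \<open>?E\<close> the Lipschitz bound costs at most
        \<open>r / 2\<close>; on \<open>?E\<close> the integrand is at most \<open>2\<close> and the
        probability is below \<open>r / 4\<close>. The \<open>+ 1\<close> admits
        \<open>t = 0\<close>.\<close>
      define \<epsilon> where "\<epsilon> = r / (2 * (norm t + 1))"
      have "\<epsilon> > 0" using \<open>r > 0\<close> by (simp add: \<epsilon>_def add_nonneg_pos)
      have \<epsilon>t: "norm t * \<epsilon> \<le> r / 2"
      proof -
        have "norm t * \<epsilon> \<le> (norm t + 1) * \<epsilon>" using \<open>\<epsilon> > 0\<close> by simp
        also have "\<dots> = r / 2"
          using add_nonneg_pos[OF norm_ge_zero[of t] zero_less_one] by (simp add: \<epsilon>_def field_simps)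
        finally show ?thesis .
      qed
      have "eventually (\<lambda>n. prob {\<omega>\<in>space M. norm (X n \<omega> - Y n \<omega>) > \<epsilon>} < r / 4) sequentially"
        using order_tendstoD(2)[OF diff[OF \<open>\<epsilon> > 0\<close>], of "r / 4"] \<open>r > 0\<close> by simp
      then have "eventually (\<lambda>n. norm ((\<integral>\<omega>. g (t \<bullet> X n \<omega>) \<partial>M) - (\<integral>\<omega>. g (t \<bullet> Y n \<omega>) \<partial>M)) < r) sequentially"
      proof eventually_elim
        case (elim n)
        let ?E = "{\<omega>\<in>space M. norm (X n \<omega> - Y n \<omega>) > \<epsilon>}"
        have iE: "integrable M (indicator ?E :: 'a \<Rightarrow> real)"
          by (auto simp: emeasure_eq_measure)
        have "norm ((\<integral>\<omega>. g (t \<bullet> X n \<omega>) \<partial>M) - (\<integral>\<omega>. g (t \<bullet> Y n \<omega>) \<partial>M)) = \<bar>\<integral>\<omega>. g (t \<bullet> X n \<omega>) - g (t \<bullet> Y n \<omega>) \<partial>M\<bar>"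
          using int[OF X] int[OF Y] by simp
        also have "\<dots> \<le> (\<integral>\<omega>. \<bar>g (t \<bullet> X n \<omega>) - g (t \<bullet> Y n \<omega>)\<bar> \<partial>M)"
          by (rule integral_abs_bound)
        also have "\<dots> \<le> (\<integral>\<omega>. r / 2 + 2 * indicator ?E \<omega> \<partial>M)"
        proof (rule integral_mono)
          fix \<omega> assume \<omega>: "\<omega> \<in> space M"
          show "\<bar>g (t \<bullet> X n \<omega>) - g (t \<bullet> Y n \<omega>)\<bar> \<le> r / 2 + 2 * indicator ?E \<omega>"
          proof (cases "norm (X n \<omega> - Y n \<omega>) > \<epsilon>")
            case True
            then show ?thesis using g(3)[of "t \<bullet> X n \<omega>"] g(3)[of "t \<bullet> Y n \<omega>"] \<omega> \<open>r > 0\<close> by simp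
          next
            case False
            have "\<bar>g (t \<bullet> X n \<omega>) - g (t \<bullet> Y n \<omega>)\<bar> \<le> \<bar>t \<bullet> (X n \<omega> - Y n \<omega>)\<bar>"
              using g(2) by (simp add: inner_diff_right)
            also have "\<dots> \<le> norm t * norm (X n \<omega> - Y n \<omega>)" by (rule Cauchy_Schwarz_ineq2)
            also have "\<dots> \<le> norm t * \<epsilon>" using False by (intro mult_left_mono) auto
            also have "\<dots> \<le> r / 2" by (rule \<epsilon>t)
            finally show ?thesis using False by simp
          qed
        qed (use int[OF X] int[OF Y] iE in auto)
        also have "\<dots> = r / 2 + 2 * prob ?E"
          using iE by (simp add: prob_space)
        also have "\<dots> < r" using elim \<open>r > 0\<close> by simp
        finally show ?case .
      qed
      then show "\<exists>no. \<forall>n\<ge>no. norm ((\<integral>\<omega>. g (t \<bullet> X n \<omega>) \<partial>M) - (\<integral>\<omega>. g (t \<bullet> Y n \<omega>) \<partial>M) - 0) < r"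
        by (simp add: eventually_sequentially)
    qed
    from tendsto_add[OF this lim] show ?thesis
      by (simp add: integral_distr_vec[OF X gt] integral_distr_vec[OF Y gt])
  qed
  show ?thesis
  proof (rule weak_conv_vec_if_char)
    show "prob_space (distr M borel (X n))" for n by (rule prob_space_distr) simp
    show "(\<lambda>n. \<integral>x. cos (t \<bullet> x) \<partial>distr M borel (X n)) \<longlonglongrightarrow> (\<integral>x. cos (t \<bullet> x) \<partial>\<nu>)" for t
    proof (rule step)
      show "\<bar>cos u - cos v\<bar> \<le> \<bar>u - v\<bar>" for u v :: real
        using abs_Re_le_cmod[of "iexp u - iexp v"] iexp_lipschitz[of u v] by (simp add: Re_exp Im_exp)
    qed (auto intro!: continuous_intros)
    show "(\<lambda>n. \<integral>x. sin (t \<bullet> x) \<partial>distr M borel (X n)) \<longlonglongrightarrow> (\<integral>x. sin (t \<bullet> x) \<partial>\<nu>)" for t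
    proof (rule step)
      show "\<bar>sin u - sin v\<bar> \<le> \<bar>u - v\<bar>" for u v :: real
        using abs_Im_le_cmod[of "iexp u - iexp v"] iexp_lipschitz[of u v] by (simp add: Re_exp Im_exp)
    qed (auto intro!: continuous_intros)
  qed (use \<nu> in auto)
qed

text \<open>\<open>is_normal_vec\<close> constrains scalar projections only, so \<open>C'\<close>
  has to match as a quadratic form; moving \<open>B\<close> to the other side of the inner product
  reduces everything to projections of \<open>\<nu>\<close>.\<close>

lemma is_normal_vec_linear_image:
  fixes B :: "'b::euclidean_space \<Rightarrow> 'c::euclidean_space"
  assumes \<nu>: "is_normal_vec 0 C \<nu>" and B: "linear B" and C': "\<And>t. t \<bullet> C' t = adjoint B t \<bullet> C (adjoint B t)"
  shows "is_normal_vec 0 C' (distr \<nu> borel B)"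
  unfolding is_normal_vec_def
proof (intro conjI allI)
  have s: "sets \<nu> = sets borel" and p: "prob_space \<nu>" using \<nu> by (auto simp: is_normal_vec_def)
  have "B \<in> borel_measurable borel"
    using B by (intro borel_measurable_continuous_onI linear_continuous_on) (simp add: linear_conv_bounded_linear)
  then have m[measurable]: "B \<in> borel_measurable \<nu>" using measurable_cong_sets[OF s refl] by blast
  show "prob_space (distr \<nu> borel B)" by (rule prob_space.prob_space_distr[OF p m])
  fix t
  have "distr (distr \<nu> borel B) borel (\<lambda>x. t \<bullet> x) = distr \<nu> borel (\<lambda>x. t \<bullet> B x)"
    by (subst distr_distr) (auto simp: comp_def)
  also have "(\<lambda>x. t \<bullet> B x) = (\<lambda>x. adjoint B t \<bullet> x)"
    using adjoint_works[OF B] by (auto simp: inner_commute)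
  also have "distr \<nu> borel \<dots> = normal_law (adjoint B t \<bullet> 0) (adjoint B t \<bullet> C (adjoint B t))"
    using \<nu> unfolding is_normal_vec_def by blast
  finally show "distr (distr \<nu> borel B) borel (\<lambda>x. t \<bullet> x) = normal_law (t \<bullet> 0) (t \<bullet> C' t)"
    by (simp add: C')
qed simp

lemma weak_conv_vec_linear_image:
  fixes B :: "'b::euclidean_space \<Rightarrow> 'c::euclidean_space"
  assumes Y: "\<And>n. Y n \<in> borel_measurable M" and conv: "weak_conv_vec (\<lambda>n. distr M borel (Y n)) \<nu>"
    and \<nu>: "sets \<nu> = sets borel" and B: "linear B"
  shows "weak_conv_vec (\<lambda>n. distr M borel (\<lambda>\<omega>. B (Y n \<omega>))) (distr \<nu> borel B)"
  unfolding weak_conv_vec_def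
proof (intro allI impI)
  fix f :: "'c \<Rightarrow> real" assume f: "continuous_on UNIV f \<and> bounded (range f)"
  have Bc: "continuous_on UNIV B"
    using B by (intro linear_continuous_on) (simp add: linear_conv_bounded_linear)
  have fB: "continuous_on UNIV (\<lambda>x. f (B x))" "bounded (range (\<lambda>x. f (B x)))"
    using f by (auto intro!: continuous_on_compose2[OF _ Bc] elim: bounded_subset)
  have Bm: "B \<in> borel_measurable \<nu>"
    using borel_measurable_continuous_onI[OF Bc] measurable_cong_sets[OF \<nu> refl] by blast
  have BY: "(\<lambda>\<omega>. B (Y n \<omega>)) \<in> borel_measurable M" for n
    by (rule measurable_compose[OF Y borel_measurable_continuous_onI[OF Bc]])
  have "(\<lambda>n. \<integral>x. f (B x) \<partial>distr M borel (Y n)) \<longlonglongrightarrow> (\<integral>x. f (B x) \<partial>\<nu>)"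
    using conv fB unfolding weak_conv_vec_def by blast
  then show "(\<lambda>n. integral\<^sup>L (distr M borel (\<lambda>\<omega>. B (Y n \<omega>))) f) \<longlonglongrightarrow> integral\<^sup>L (distr \<nu> borel B) f"
    using f by (simp add: integral_distr_vec[OF BY] integral_distr_vec[OF Bm] integral_distr_vec[OF Y fB(1)])
qed


text \<open>Cramer-Wold: the scalar theorem is applied to \<open>t \<bullet> Z i\<close> for each
  nonzero \<open>t\<close>; definiteness of \<open>C\<close> provides the positive variance it
  requires.\<close>

theorem (in prob_space) CLT_vec:
  fixes Z :: "nat \<Rightarrow> 'a \<Rightarrow> 'b::euclidean_space" and C :: "'b \<Rightarrow> 'b"
  assumes indep: "indep_vars (\<lambda>_. borel) Z UNIV"
    and law: "\<And>i. distr M borel (Z i) = N"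
    and mean: "\<And>i u. expectation (\<lambda>\<omega>. u \<bullet> Z i \<omega>) = 0"
    and sq: "\<And>i u. integrable M (\<lambda>\<omega>. (u \<bullet> Z i \<omega>)\<^sup>2)"
    and cov: "\<And>i u. expectation (\<lambda>\<omega>. (u \<bullet> Z i \<omega>)\<^sup>2) = u \<bullet> C u"
    and C: "linear C" "\<And>x y. x \<bullet> C y = C x \<bullet> y" "\<And>u. u \<noteq> 0 \<Longrightarrow> 0 < u \<bullet> C u"
  obtains \<nu> where "is_normal_vec 0 C \<nu>"
    "weak_conv_vec (\<lambda>n. distr M borel (\<lambda>\<omega>. (1 / sqrt n) *\<^sub>R (\<Sum>i<n. Z i \<omega>))) \<nu>"
proof -
  have psd: "0 \<le> u \<bullet> C u" for u
    using C(3)[of u] by (cases "u = 0") (auto simp: less_imp_le)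
  obtain \<nu> where \<nu>: "is_normal_vec 0 C \<nu>" using is_normal_vec_exists[OF C(1,2) psd] by blast
  then have \<nu>s: "sets \<nu> = sets borel" and \<nu>p: "prob_space \<nu>"
    and \<nu>t: "\<And>t. distr \<nu> borel (\<lambda>x. t \<bullet> x) = normal_law 0 (t \<bullet> C t)"
    by (auto simp: is_normal_vec_def)
  have Z[measurable]: "Z i \<in> borel_measurable M" for i
    using indep by (auto simp: indep_vars_def)
  define Y where "Y n \<omega> = (1 / sqrt n) *\<^sub>R (\<Sum>i<n. Z i \<omega>)" for n \<omega>
  have Y[measurable]: "Y n \<in> borel_measurable M" for n
    unfolding Y_def by measurable
  have int1: "integrable K (\<lambda>x. iexp (t \<bullet> x))" if "prob_space K" "sets K = sets borel" for K :: "'b measure" and t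
    by (rule prob_space.integrable_iexp[OF that(1)]) (simp_all add: measurable_cong_sets[OF that(2) refl])
  have cs: "(\<integral>x. cos (t \<bullet> x) \<partial>K) = Re (CLINT x|K. iexp (t \<bullet> x))" "(\<integral>x. sin (t \<bullet> x) \<partial>K) = Im (CLINT x|K. iexp (t \<bullet> x))"
    if "prob_space K" "sets K = sets borel" for K :: "'b measure" and t
    using integral_Re[OF int1[OF that, of t]] integral_Im[OF int1[OF that, of t]] by (simp_all add: Re_exp Im_exp)
  have lim: "(\<lambda>n. CLINT x|distr M borel (Y n). iexp (t \<bullet> x)) \<longlonglongrightarrow> (CLINT x|\<nu>. iexp (t \<bullet> x))" for t
  proof (cases "t = 0")
    case True
    then show ?thesis
      using prob_space.prob_space[OF prob_space_distr[OF Y]] prob_space.prob_space[OF \<nu>p] by simp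
  next
    case False
    define s where "s = sqrt (t \<bullet> C t)"
    have s: "s > 0" "s\<^sup>2 = t \<bullet> C t" using C(3)[OF False] by (simp_all add: s_def)
    have \<nu>_val: "(CLINT x|\<nu>. iexp (t \<bullet> x)) = exp (- (s\<^sup>2 / 2))"
    proof -
      have "(CLINT x|\<nu>. iexp (t \<bullet> x)) = char (distr \<nu> borel (\<lambda>x. t \<bullet> x)) 1"
        unfolding char_def by (subst integral_distr) (simp_all add: measurable_cong_sets[OF \<nu>s refl])
      then show ?thesis unfolding \<nu>t char_normal_law(1)[OF psd] by (simp add: s)
    qed
    have "weak_conv_m (\<lambda>n. distr M borel (\<lambda>x. (\<Sum>i<n. t \<bullet> Z i x) / sqrt (real n * s\<^sup>2))) std_normal_distribution"
    proof (rule central_limit_theorem_zero_mean)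
      show "indep_vars (\<lambda>i. borel) (\<lambda>i x. t \<bullet> Z i x) UNIV"
        by (rule indep_vars_compose2[OF indep]) auto
      show "variance (\<lambda>x. t \<bullet> Z n x) = s\<^sup>2" for n
        by (simp add: mean cov s)
      show "distr M borel (\<lambda>x. t \<bullet> Z n x) = distr N borel (\<lambda>x. t \<bullet> x)" for n
        unfolding law[of n, symmetric] by (subst distr_distr) (auto simp: comp_def)
    qed (use s mean sq in auto)
    \<comment> \<open>Evaluating at \<open>s\<close>, the standard deviation along \<open>t\<close>,
      undoes the normalization of the scalar theorem.\<close>
    then have "(\<lambda>n. char (distr M borel (\<lambda>x. (\<Sum>i<n. t \<bullet> Z i x) / sqrt (real n * s\<^sup>2))) s) \<longlonglongrightarrow> char std_normal_distribution s"
      by (intro levy_continuity1) (auto intro!: real_distribution_distr real_dist_normal_dist)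
    moreover have "char (distr M borel (\<lambda>x. (\<Sum>i<n. t \<bullet> Z i x) / sqrt (real n * s\<^sup>2))) s = (CLINT x|distr M borel (Y n). iexp (t \<bullet> x))" for n
    proof -
      have *: "s * ((\<Sum>i<n. t \<bullet> Z i x) / sqrt (real n * s\<^sup>2)) = t \<bullet> Y n x" for x
        using s(1) by (simp add: Y_def inner_sum_right real_sqrt_mult)
      have "char (distr M borel (\<lambda>x. (\<Sum>i<n. t \<bullet> Z i x) / sqrt (real n * s\<^sup>2))) s = (CLINT x|M. iexp (t \<bullet> Y n x))"
        unfolding char_def *[symmetric] by (subst integral_distr) auto
      also have "\<dots> = (CLINT x|distr M borel (Y n). iexp (t \<bullet> x))"
        by (subst integral_distr) auto
      finally show ?thesis .
    qed
    ultimately show ?thesis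
      unfolding \<nu>_val char_std_normal_distribution by (simp add: exp_of_real)
  qed
  have "weak_conv_vec (\<lambda>n. distr M borel (Y n)) \<nu>"
  proof (rule weak_conv_vec_if_char)
    show pY: "prob_space (distr M borel (Y n))" for n by (rule prob_space_distr) simp
    show "(\<lambda>n. \<integral>x. cos (t \<bullet> x) \<partial>distr M borel (Y n)) \<longlonglongrightarrow> (\<integral>x. cos (t \<bullet> x) \<partial>\<nu>)" for t
      unfolding cs(1)[OF \<nu>p \<nu>s] cs(1)[OF pY sets_distr] by (intro tendsto_Re lim)
    show "(\<lambda>n. \<integral>x. sin (t \<bullet> x) \<partial>distr M borel (Y n)) \<longlonglongrightarrow> (\<integral>x. sin (t \<bullet> x) \<partial>\<nu>)" for t
      unfolding cs(2)[OF \<nu>p \<nu>s] cs(2)[OF pY sets_distr] by (intro tendsto_Im lim)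
  qed (use \<nu>p \<nu>s in auto)
  then show ?thesis using that[OF \<nu>] unfolding Y_def[abs_def] by simp
qed

section \<open>Orthogonal projections and slices of submersions\<close>

lemma orth_proj_in:
  fixes W :: "'a::euclidean_space set"
  assumes W: "subspace W"
  shows "orth_proj W x \<in> W" "x - orth_proj W x \<in> W\<^sup>\<bottom>"
proof -
  have "\<exists>!p. p \<in> W \<and> x - p \<in> W\<^sup>\<bottom>"
  proof (rule ex_ex1I)
    obtain y z where "y \<in> span W" "\<And>w. w \<in> span W \<Longrightarrow> orthogonal z w" "x = y + z"
      using orthogonal_subspace_decomp_exists[of W x] by metis
    then show "\<exists>p. p \<in> W \<and> x - p \<in> W\<^sup>\<bottom>"
      unfolding span_eq_iff[THEN iffD2, OF W]
      by (intro exI[of _ y]) (auto simp: orthogonal_comp_def orthogonal_commute)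
  next
    fix p q assume pq: "p \<in> W \<and> x - p \<in> W\<^sup>\<bottom>" "q \<in> W \<and> x - q \<in> W\<^sup>\<bottom>"
    then have "p - q \<in> W" using W by (simp add: subspace_diff)
    moreover have "(x - q) - (x - p) \<in> W\<^sup>\<bottom>"
      using pq subspace_diff[OF subspace_orthogonal_comp] by blast
    ultimately have "(p - q) \<bullet> (p - q) = 0"
      by (simp add: orthogonal_comp_def orthogonal_def)
    then show "p = q" by simp
  qed
  from theI'[OF this] show "orth_proj W x \<in> W" "x - orth_proj W x \<in> W\<^sup>\<bottom>"
    unfolding orth_proj_def by blast+
qed

lemma orth_proj_unique:
  fixes W :: "'a::euclidean_space set"
  assumes W: "subspace W" and "p \<in> W" "x - p \<in> W\<^sup>\<bottom>"
  shows "orth_proj W x = p"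
proof -
  have "p - orth_proj W x \<in> W" using assms orth_proj_in[OF W] by (simp add: subspace_diff)
  moreover have "(x - orth_proj W x) - (x - p) \<in> W\<^sup>\<bottom>"
    using assms orth_proj_in[OF W] subspace_diff[OF subspace_orthogonal_comp] by blast
  ultimately have "(p - orth_proj W x) \<bullet> (p - orth_proj W x) = 0"
    by (simp add: orthogonal_comp_def orthogonal_def)
  then show ?thesis by simp
qed

lemma orth_proj_id: "subspace W \<Longrightarrow> x \<in> W \<Longrightarrow> orth_proj W x = x"
  by (rule orth_proj_unique) (simp_all add: subspace_0 subspace_orthogonal_comp)

lemma orth_proj_zero: "subspace W \<Longrightarrow> x \<in> W\<^sup>\<bottom> \<Longrightarrow> orth_proj W x = 0"
  by (rule orth_proj_unique) (simp_all add: subspace_0)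

lemma orth_proj_inner:
  assumes "subspace W" "w \<in> W"
  shows "w \<bullet> orth_proj W x = w \<bullet> x"
proof -
  have "w \<bullet> (x - orth_proj W x) = 0"
    using orth_proj_in(2)[OF assms(1), of x] assms(2) by (simp add: orthogonal_comp_def orthogonal_def)
  then show ?thesis by (simp add: inner_diff_right)
qed

lemma linear_orth_proj:
  assumes W: "subspace W"
  shows "linear (orth_proj W)"
proof (rule linearI)
  fix x y
  have "(x - orth_proj W x) + (y - orth_proj W y) \<in> W\<^sup>\<bottom>"
    using orth_proj_in[OF W] by (intro subspace_add subspace_orthogonal_comp)
  moreover have "(x - orth_proj W x) + (y - orth_proj W y) = (x + y) - (orth_proj W x + orth_proj W y)" by simp
  ultimately show "orth_proj W (x + y) = orth_proj W x + orth_proj W y"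
    using orth_proj_in[OF W] W by (intro orth_proj_unique[OF W]) (simp_all only: subspace_add)
next
  fix c x
  have "c *\<^sub>R (x - orth_proj W x) \<in> W\<^sup>\<bottom>"
    using orth_proj_in[OF W] by (intro subspace_scale subspace_orthogonal_comp)
  then show "orth_proj W (c *\<^sub>R x) = c *\<^sub>R orth_proj W x"
    using orth_proj_in[OF W] W by (intro orth_proj_unique[OF W]) (simp_all add: subspace_scale scaleR_diff_right)
qed

text \<open>Near a point where \<open>f\<close> is a submersion onto \<open>V\<close>, adding the component along the kernel to
  \<open>f\<close> gives a local diffeomorphism; its inverse moves points along the fibres of \<open>f\<close> into the
  slice orthogonal to the kernel.\<close>

lemma submersion_slice:
  fixes f :: "'a::euclidean_space \<Rightarrow> 'b::euclidean_space" and f' :: "'a \<Rightarrow> 'a \<Rightarrow>\<^sub>L 'b"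
  assumes U: "open U" "x0 \<in> U"
    and df: "\<And>x. x \<in> U \<Longrightarrow> (f has_derivative blinfun_apply (f' x)) (at x)"
    and cf': "continuous_on U f'"
    and V: "range (blinfun_apply (f' x0)) = V" "\<And>x. x \<in> U \<Longrightarrow> f x \<in> V"
  defines "K \<equiv> {v. blinfun_apply (f' x0) v = 0}"
  obtains N s where "open N" "x0 \<in> N" "N \<subseteq> U" "continuous_on N s" "s x0 = x0"
    "\<And>x. x \<in> N \<Longrightarrow> s x \<in> U \<and> f (s x) = f x \<and> s x - x0 \<in> K\<^sup>\<bottom>"
    "\<And>v. v \<in> K \<Longrightarrow> \<exists>\<gamma>. \<gamma> 0 = x0 \<and> (\<gamma> has_vector_derivative v) (at 0) \<and>
       eventually (\<lambda>t. \<gamma> t \<in> U \<and> f (\<gamma> t) = f x0) (nhds (0::real))"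
proof -
  let ?L = "blinfun_apply (f' x0)"
  have L: "linear ?L" by (rule bounded_linear.linear[OF blinfun.bounded_linear_right])
  have K: "subspace K" unfolding K_def by (rule linear_subspace_kernel[OF L])
  have Kp: "subspace (K\<^sup>\<bottom>)" by (rule subspace_orthogonal_comp)
  have Vs: "subspace V" unfolding V(1)[symmetric] by (rule linear_subspace_image[OF L subspace_UNIV])
  define Pr where "Pr = orth_proj (K\<^sup>\<bottom>)"
  have Pr_in: "Pr x \<in> K\<^sup>\<bottom>" for x unfolding Pr_def by (rule orth_proj_in[OF Kp])
  have Pr_lin: "linear Pr" unfolding Pr_def by (rule linear_orth_proj[OF Kp])
  have Pr_id: "Pr x = x" if "x \<in> K\<^sup>\<bottom>" for x unfolding Pr_def using that by (rule orth_proj_id[OF Kp])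
  have LPr: "?L (Pr x) = ?L x" for x
  proof -
    have "x - Pr x \<in> K" using orth_proj_in(2)[OF Kp, of x] orthogonal_comp_self[OF K] by (simp add: Pr_def)
    then show ?thesis by (simp add: K_def blinfun.diff_right)
  qed
  have Pr_K: "Pr v = 0" if "v \<in> K" for v
    unfolding Pr_def using that orthogonal_comp_self[OF K] by (intro orth_proj_zero[OF Kp]) simp
  have "inj_on ?L (K\<^sup>\<bottom>)"
  proof (subst linear_injective_on_subspace_0[OF L Kp], intro ballI impI)
    fix x assume "x \<in> K\<^sup>\<bottom>" "?L x = 0"
    then have "x \<bullet> x = 0" by (simp add: orthogonal_comp_def orthogonal_def K_def)
    then show "x = 0" by simp
  qed
  \<comment> \<open>\<open>B\<close> inverts the derivative on \<open>K\<^sup>\<bottom>\<close>, so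
    composing it with the derivative gives the projection \<open>Pr\<close>, and \<open>B\<close> is
    injective on \<open>V\<close>.\<close>
  from linear_exists_left_inverse_on[OF L Kp this]
  obtain B where B: "B ` UNIV \<subseteq> K\<^sup>\<bottom>" "linear B" "\<And>v. v \<in> K\<^sup>\<bottom> \<Longrightarrow> B (?L v) = v" by blast
  have BL: "B (?L x) = Pr x" for x using B(3)[OF Pr_in] LPr by metis
  have B_inj: "v = w" if "v \<in> V" "w \<in> V" "B v = B w" for v w
  proof -
    obtain a b where ab: "v = ?L a" "w = ?L b" using \<open>v \<in> V\<close> \<open>w \<in> V\<close> V(1) by blast
    then have "Pr a = Pr b" using that(3) BL by simp
    then show "v = w" using ab LPr by metis
  qed
  have Bb: "bounded_linear B" "bounded_linear Pr" using B(2) Pr_lin by (simp_all add: linear_conv_bounded_linear)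
  \<comment> \<open>Coordinates on \<open>K\<^sup>\<bottom>\<close> come from \<open>f\<close> and
    those on \<open>K\<close> from the point itself; at \<open>x0\<close> the derivative is
    \<open>Pr\<close> plus its complement, the identity.\<close>
  define F where "F x = x0 + B (f x - f x0) + ((x - x0) - Pr (x - x0))" for x
  define Q where "Q = id_blinfun - Blinfun Pr"
  define F' where "F' x = (Blinfun B o\<^sub>L f' x) + Q" for x
  have dF: "(F has_derivative blinfun_apply (F' x)) (at x)" if "x \<in> U" for x
  proof -
    have "((\<lambda>x. x0 + B (f x - f x0) + ((x - x0) - Pr (x - x0))) has_derivative (\<lambda>h. 0 + B (f' x h - 0) + ((h - 0) - Pr (h - 0)))) (at x)"
      by (intro has_derivative_add has_derivative_const has_derivative_diff has_derivative_ident df that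
          bounded_linear.has_derivative[OF Bb(1)] bounded_linear.has_derivative[OF Bb(2)])
    then show ?thesis
      unfolding F_def[abs_def]
      by (simp add: F'_def Q_def plus_blinfun.rep_eq minus_blinfun.rep_eq bounded_linear_Blinfun_apply Bb)
  qed
  have cF': "continuous_on U F'" unfolding F'_def by (intro continuous_intros cf')
  have F'0: "F' x0 = id_blinfun"
    by (rule blinfun_eqI) (simp add: F'_def Q_def plus_blinfun.rep_eq minus_blinfun.rep_eq bounded_linear_Blinfun_apply Bb BL)
  have F0: "F x0 = x0" using B(2) Pr_lin by (simp add: F_def linear_0)
  have inv: "id_blinfun o\<^sub>L F' x0 = id_blinfun" unfolding F'0 by (rule blinfun_eqI) simp
  obtain U' V' g g' where IFT: "open U'" "U' \<subseteq> U" "x0 \<in> U'" "open V'" "F x0 \<in> V'" "homeomorphism U' V' F g"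
    and dg: "\<And>y. y \<in> V' \<Longrightarrow> (g has_derivative (g' y)) (at y)"
    and g': "\<And>y. y \<in> V' \<Longrightarrow> g' y = Hilbert_Choice.inv (blinfun_apply (F' (g y)))"
    and "\<And>y. y \<in> V' \<Longrightarrow> bij (blinfun_apply (F' (g y)))"
    by (rule inverse_function_theorem[OF U(1) dF cF' U(2) inv]) (assumption | rule that)+
  have gx0: "g x0 = x0" using IFT F0 homeomorphism_apply1[OF IFT(6), of x0] by simp
  have gU: "g y \<in> U'" "F (g y) = y" if "y \<in> V'" for y
    using homeomorphism_apply2[OF IFT(6) that] homeomorphism_image2[OF IFT(6)] that by blast+
  \<comment> \<open>Apart from the constant \<open>x0\<close>, the two summands of \<open>F\<close>
    lie in complementary subspaces, so an equation for \<open>F\<close> splits; the first component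
    fixes the fibre of \<open>f\<close>, the second the position along \<open>K\<close>.\<close>
  have split: "B (f y - f x0) = Pr w" "y - x0 - Pr (y - x0) = w - Pr w"
    if "y \<in> U" "F y = x0 + w" for y w
  proof -
    have e: "B (f y - f x0) + (y - x0 - Pr (y - x0)) = w"
      using that(2) unfolding F_def add.assoc by (rule add_left_imp_eq)
    have 1: "Pr (B (f y - f x0)) = B (f y - f x0)" using B(1) by (intro Pr_id) blast
    have 2: "Pr (y - x0 - Pr (y - x0)) = 0"
      using Pr_lin Pr_id[OF Pr_in] by (simp add: linear_diff)
    have "Pr w = Pr (B (f y - f x0)) + Pr (y - x0 - Pr (y - x0))"
      unfolding e[symmetric] by (rule linear_add[OF Pr_lin])
    then show "B (f y - f x0) = Pr w" using 1 2 by simp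
    then show "y - x0 - Pr (y - x0) = w - Pr w" using e by (simp add: algebra_simps)
  qed
  have fV: "f y - f x0 \<in> V" if "y \<in> U" for y using V(2) U(2) that Vs by (intro subspace_diff)
  have f_eq: "f y = f x" if "x \<in> U" "y \<in> U" "B (f y - f x0) = B (f x - f x0)" for x y
    using B_inj[OF fV[OF that(2)] fV[OF that(1)] that(3)] by simp
  \<comment> \<open>Keeps the fibre coordinate and sets the coordinate along \<open>K\<close> to
    zero.\<close>
  define s where "s x = g (x0 + B (f x - f x0))" for x
  define N where "N = U \<inter> (\<lambda>x. x0 + B (f x - f x0)) -` V'"
  have cf: "continuous_on U f"
    using df by (intro continuous_at_imp_continuous_on) (blast intro: has_derivative_continuous)
  have cB: "continuous_on U (\<lambda>x. x0 + B (f x - f x0))"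
    by (intro continuous_intros bounded_linear.continuous_on[OF Bb(1)] cf)
  show ?thesis
  proof
    show "open N" unfolding N_def by (rule continuous_open_preimage[OF cB U(1) IFT(4)])
    show "x0 \<in> N" using U(2) IFT(5) F0 B(2) by (simp add: N_def linear_0)
    show "N \<subseteq> U" by (auto simp: N_def)
    have "continuous_on V' g" using homeomorphism_cont2[OF IFT(6)] .
    then show "continuous_on N s"
      unfolding s_def[abs_def] by (rule continuous_on_compose2) (auto simp: N_def intro!: continuous_on_subset[OF cB])
    show "s x0 = x0" using B(2) gx0 by (simp add: s_def linear_0)
    show "s x \<in> U \<and> f (s x) = f x \<and> s x - x0 \<in> K\<^sup>\<bottom>" if "x \<in> N" for x
    proof -
      have xV: "x0 + B (f x - f x0) \<in> V'" and xU: "x \<in> U" using that by (auto simp: N_def)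
      have sU: "s x \<in> U" using gU(1)[OF xV] IFT(2) by (auto simp: s_def)
      have P1: "Pr (B (f x - f x0)) = B (f x - f x0)" using B(1) by (intro Pr_id) blast
      note sp = split[OF sU, of "B (f x - f x0)", unfolded P1]
      have "F (s x) = x0 + B (f x - f x0)" using gU(2)[OF xV] by (simp add: s_def)
      note sp = sp[OF this]
      have "s x - x0 = Pr (s x - x0)" using sp(2) by simp
      then have "s x - x0 \<in> K\<^sup>\<bottom>" using Pr_in by metis
      then show ?thesis using sU f_eq[OF xU sU sp(1)] by blast
    qed
    show "\<exists>\<gamma>. \<gamma> 0 = x0 \<and> (\<gamma> has_vector_derivative v) (at 0) \<and>
       eventually (\<lambda>t. \<gamma> t \<in> U \<and> f (\<gamma> t) = f x0) (nhds (0::real))" if v: "v \<in> K" for v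
    proof (intro exI conjI)
      \<comment> \<open>The straight line along \<open>K\<close> in \<open>F\<close>-coordinates: it
        stays in the fibre of \<open>x0\<close>, and its velocity is \<open>v\<close> since
        \<open>g\<close> has identity derivative at \<open>x0\<close>.\<close>
      let ?\<gamma> = "\<lambda>t::real. g (x0 + t *\<^sub>R v)"
      show "?\<gamma> 0 = x0" using gx0 by simp
      have x0V: "x0 \<in> V'" using IFT(5) F0 by simp
      have "(g has_derivative (\<lambda>h. h)) (at x0)"
        using dg[OF x0V] unfolding g'[OF x0V] gx0 F'0 by (simp add: inv_id[unfolded id_def])
      then have gd: "(g has_derivative (\<lambda>h. h)) (at (x0 + 0 *\<^sub>R v))" by simp
      have "((\<lambda>t::real. x0 + t *\<^sub>R v) has_derivative (\<lambda>t. 0 + t *\<^sub>R v)) (at 0)"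
        by (intro has_derivative_add has_derivative_const has_derivative_scaleR_left has_derivative_ident)
      from has_derivative_compose[OF this gd]
      show "(?\<gamma> has_vector_derivative v) (at 0)"
        by (simp add: has_vector_derivative_def)
      have "isCont (\<lambda>t::real. x0 + t *\<^sub>R v) 0" by (intro continuous_intros)
      then have "eventually (\<lambda>t::real. x0 + t *\<^sub>R v \<in> V') (nhds 0)"
        using IFT(4) x0V by (intro topological_tendstoD[of _ x0]) (auto simp: isCont_def tendsto_nhds_iff)
      then show "eventually (\<lambda>t. ?\<gamma> t \<in> U \<and> f (?\<gamma> t) = f x0) (nhds (0::real))"
      proof eventually_elim
        case (elim t)
        have yU: "?\<gamma> t \<in> U" using gU(1)[OF elim] IFT(2) by blast
        have "t *\<^sub>R v \<in> K" using v K by (simp add: subspace_scale)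
        then have "B (f (?\<gamma> t) - f x0) = B (f x0 - f x0)"
          using split(1)[OF yU gU(2)[OF elim]] Pr_K B(2) by (simp add: linear_0)
        then show ?case using f_eq[OF U(2) yU] yU by simp
      qed
    qed
  qed
qed

section \<open>Generalized least squares on a subspace\<close>

lemma norm_matrix_vector_mult_le: "norm (A *v x) \<le> norm A * norm x" for A :: "real^'n^'m"
proof -
  have "norm (A *v x) \<le> L2_set (\<lambda>i. norm (A $ i) * norm x) UNIV"
    unfolding norm_vec_def[of "A *v x"]
    by (rule L2_set_mono) (simp_all add: matrix_vector_mul_component Cauchy_Schwarz_ineq2)
  also have "\<dots> = norm A * norm x"
    by (simp add: norm_vec_def[of A] L2_set_left_distrib)
  finally show ?thesis .
qed

text \<open>The linearized problem: \<open>D\<close> stands for the derivative of the moment map at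
  \<open>\<theta>s\<close> and \<open>S\<close> for the limit of the weights. Injectivity is
  required on \<open>W\<close> only, so all inverses are taken there.\<close>

locale restricted_gls =
  fixes W :: "'a::euclidean_space set" and D :: "'a \<Rightarrow> real^'k" and S :: "real^'k^'k"
  assumes W: "subspace W" and D: "linear D" and S: "pd_matrix S"
    and D_inj: "\<And>h. h \<in> W \<Longrightarrow> D h = 0 \<Longrightarrow> h = 0"
begin

definition info :: "'a \<Rightarrow> 'a" where "info h = orth_proj W (adjoint D (S *v D h))"
definition cov :: "'a \<Rightarrow> 'a" where "cov h = inv_into W info (orth_proj W h)"
text \<open>The generalized least squares solution: the minimizer over \<open>h\<close> in
  \<open>W\<close> of \<open>(a - D h) \<bullet> (S *v (a - D h))\<close>.\<close>

definition est :: "real^'k \<Rightarrow> 'a" where "est a = cov (adjoint D (S *v a))"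

lemma S_sym: "x \<bullet> (S *v y) = (S *v x) \<bullet> y"
proof -
  have "x \<bullet> (S *v y) = (transpose S *v x) \<bullet> y" by (simp add: dot_lmul_matrix[symmetric] transpose_matrix_vector)
  moreover have "transpose S = S" using S unfolding pd_matrix_def by blast
  ultimately show ?thesis by (simp only:)
qed

lemma S_pos: "x \<noteq> 0 \<Longrightarrow> 0 < x \<bullet> (S *v x)"
  using S by (simp add: pd_matrix_def)

lemma info_in: "info h \<in> W" unfolding info_def by (rule orth_proj_in(1)[OF W])

lemma inner_adjoint: "w \<bullet> adjoint D v = D w \<bullet> v"
  using adjoint_works[OF D] .

lemma inner_info: "w \<in> W \<Longrightarrow> w \<bullet> info h = D w \<bullet> (S *v D h)"
  unfolding info_def by (simp add: orth_proj_inner[OF W] inner_adjoint)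

lemma linear_info: "linear info"
  unfolding info_def
  using linear_compose[OF linear_compose[OF linear_compose[OF D matrix_vector_mul_linear[of S]] adjoint_linear[OF D]] linear_orth_proj[OF W]]
  by (simp add: comp_def)

lemma info_inj:
  assumes "h \<in> W" "info h = 0"
  shows "h = 0"
proof (rule D_inj[OF assms(1)], rule ccontr)
  assume "D h \<noteq> 0"
  then show False using inner_info[OF assms(1), of h] S_pos[of "D h"] assms(2) by simp
qed

lemma info_bij: "bij_betw info W W"
proof -
  have inj: "inj_on info W"
    by (subst linear_injective_on_subspace_0[OF linear_info W]) (use info_inj in blast)
  have "info ` W \<subseteq> W" using info_in by blast
  moreover have "dim (info ` W) = dim W"
    by (rule dim_image_eq[OF linear_info]) (simp add: span_eq_iff[THEN iffD2, OF W] inj)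
  ultimately have "info ` W = W"
    by (intro subspace_dim_equal linear_subspace_image[OF linear_info W] W) simp_all
  then show ?thesis using inj by (simp add: bij_betw_def)
qed

lemma cov_in: "cov h \<in> W" and info_cov: "info (cov h) = orth_proj W h"
proof -
  have "orth_proj W h \<in> info ` W" using info_bij orth_proj_in(1)[OF W] by (simp add: bij_betw_def)
  then show "cov h \<in> W" "info (cov h) = orth_proj W h"
    unfolding cov_def by (rule inv_into_into, rule f_inv_into_f)
qed

lemma cov_unique: "w \<in> W \<Longrightarrow> info w = orth_proj W h \<Longrightarrow> cov h = w"
  unfolding cov_def by (metis bij_betw_def info_bij inv_into_f_f)

lemma linear_cov: "linear cov"
proof (rule linearI)
  fix x y c
  show "cov (x + y) = cov x + cov y"
    by (rule cov_unique) (simp_all add: linear_add[OF linear_info] info_cov linear_add[OF linear_orth_proj[OF W]] subspace_add[OF W] cov_in)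
  show "cov (c *\<^sub>R x) = c *\<^sub>R cov x"
    by (rule cov_unique) (simp_all add: linear_scale[OF linear_info] info_cov linear_scale[OF linear_orth_proj[OF W]] subspace_scale[OF W] cov_in)
qed

lemma inner_cov: "x \<bullet> cov y = D (cov x) \<bullet> (S *v D (cov y))"
proof -
  have "x \<bullet> cov y = cov y \<bullet> orth_proj W x" by (metis orth_proj_inner[OF W cov_in] inner_commute)
  also have "\<dots> = D (cov y) \<bullet> (S *v D (cov x))" by (simp add: info_cov[symmetric] inner_info[OF cov_in])
  finally show ?thesis by (metis S_sym inner_commute)
qed

lemma cov_sym: "x \<bullet> cov y = cov x \<bullet> y"
proof -
  have "x \<bullet> cov y = (S *v D (cov x)) \<bullet> D (cov y)" unfolding inner_cov S_sym ..
  also have "\<dots> = D (cov y) \<bullet> (S *v D (cov x))" by (rule inner_commute)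
  also have "\<dots> = y \<bullet> cov x" by (rule inner_cov[symmetric])
  also have "\<dots> = cov x \<bullet> y" by (rule inner_commute)
  finally show ?thesis .
qed

lemma linear_est: "linear est"
  unfolding est_def
  using linear_compose[OF linear_compose[OF matrix_vector_mul_linear[of S] adjoint_linear[OF D]] linear_cov]
  by (simp add: comp_def)

lemma est_in: "est a \<in> W" unfolding est_def by (rule cov_in)

text \<open>The normal equations of the least squares problem.\<close>

lemma inner_info_est: "w \<in> W \<Longrightarrow> w \<bullet> info (est a) = D w \<bullet> (S *v a)"
  unfolding est_def info_cov by (simp add: orth_proj_inner[OF W] inner_adjoint)

lemma adjoint_est: "adjoint est t = S *v D (cov t)"
proof -
  have "est a \<bullet> t = a \<bullet> (S *v D (cov t))" for a t
  proof -
    have "est a \<bullet> t = cov t \<bullet> adjoint D (S *v a)"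
      unfolding est_def by (metis cov_sym inner_commute)
    also have "\<dots> = (S *v D (cov t)) \<bullet> a" by (simp add: inner_adjoint S_sym)
    finally show ?thesis by (simp add: inner_commute)
  qed
  then have "adjoint est = (\<lambda>t. S *v D (cov t))" by (intro adjoint_unique) blast
  then show ?thesis by simp
qed

text \<open>The adjoint of \<open>est\<close> is \<open>S\<close> composed with \<open>D\<close> and
  \<open>cov\<close>; for \<open>C\<close> the inverse of \<open>S\<close> the sandwich
  \<open>est C est^T\<close> loses one factor \<open>S\<close> and becomes
  \<open>cov info cov\<close>, which is \<open>cov\<close>.\<close>

lemma est_covariance:
  assumes "C ** S = mat 1"
  shows "t \<bullet> cov t = adjoint est t \<bullet> (C *v adjoint est t)"
proof -
  have "C *v adjoint est t = D (cov t)"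
    using assms by (simp add: adjoint_est matrix_vector_mul_assoc)
  then show ?thesis using inner_cov[of t t] by (simp only: adjoint_est inner_commute)
qed

text \<open>Stationarity is tested in the direction \<open>v = info (est a - h)\<close>, for which
  \<open>v \<bullet> v\<close> splits into three errors: the Taylor remainder, the change of the
  derivative, and the change of the weight. Each is small relative to
  \<open>norm v * (norm a + norm h)\<close>. As \<open>info\<close> is bounded below on
  \<open>W\<close>, the part involving \<open>h\<close> is absorbed, which leaves a bound by
  \<open>norm a\<close> without any prior rate for \<open>h\<close>.\<close>

lemma first_order_estimate:
  fixes M :: "'a \<Rightarrow> real^'k" and DM :: "'a \<Rightarrow> 'a \<Rightarrow>\<^sub>L (real^'k)"
  assumes M: "(M has_derivative D) (at x0)" and DM: "isCont DM x0" "blinfun_apply (DM x0) = D" and "\<eta> > 0"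
  obtains \<delta> where "\<delta> > 0"
    "\<And>x O' a. norm (x - x0) < \<delta> \<Longrightarrow> x - x0 \<in> W \<Longrightarrow> norm (O' - S) < \<delta> \<Longrightarrow>
      (\<And>w. w \<in> W \<Longrightarrow> DM x w \<bullet> (O' *v (a - (M x - M x0))) = 0) \<Longrightarrow> norm (x - x0 - est a) \<le> \<eta> * norm a"
proof -
  obtain c where c: "c > 0" "\<And>h. h \<in> W \<Longrightarrow> norm (info h) \<ge> c * norm h"
    using injective_imp_isometric[OF closed_subspace[OF W] W, of info] linear_info info_inj
    by (auto simp: linear_conv_bounded_linear)
  obtain b where b: "b > 0" "\<And>a. norm (est a) \<le> b * norm a"
    using linear_bounded_pos[OF linear_est] by blast
  define d where "d = norm (DM x0)"
  define s where "s = norm S"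
  \<comment> \<open>\<open>K\<close> collects the constants of the three error terms after
    \<open>norm r \<le> norm a + (d + 1) * norm h\<close> is inserted.\<close>
  define K where "K = d * s + (s + d + 1) * (d + 1)"
  have ds: "d \<ge> 0" "s \<ge> 0" by (simp_all add: d_def s_def)
  then have K: "K \<ge> 1" "K \<ge> s + d + 1" by (simp_all add: K_def algebra_simps)
  \<comment> \<open>The bound \<open>c / (2 * K)\<close> gives
    \<open>\<epsilon> * K \<le> c / 2\<close>, which absorbs \<open>q\<close>; the last one leaves
    \<open>\<eta> * (c / 2)\<close> in front of \<open>norm a\<close>.\<close>
  define \<epsilon> where "\<epsilon> = min 1 (min (c / (2 * K)) (\<eta> * c / (2 * K * (1 + b))))"
  have \<epsilon>: "\<epsilon> > 0" "\<epsilon> \<le> 1" using c(1) K(1) b(1) \<open>\<eta> > 0\<close> by (auto simp: \<epsilon>_def)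
  have "\<epsilon> \<le> c / (2 * K)" by (simp add: \<epsilon>_def)
  then have \<epsilon>c: "\<epsilon> * K \<le> c / 2" using K(1) by (simp add: field_simps)
  have "\<epsilon> \<le> \<eta> * c / (2 * K * (1 + b))" by (simp add: \<epsilon>_def)
  then have \<epsilon>b: "\<epsilon> * K * (1 + b) \<le> \<eta> * (c / 2)"
  proof -
    have "0 < 2 * K * (1 + b)" using K(1) b(1) by simp
    then have "\<epsilon> * (2 * K * (1 + b)) \<le> \<eta> * c"
      using \<open>\<epsilon> \<le> \<eta> * c / (2 * K * (1 + b))\<close> by (simp only: pos_le_divide_eq)
    then show ?thesis by (simp add: algebra_simps)
  qed
  have Dn: "norm (D w) \<le> d * norm w" for w unfolding d_def DM(2)[symmetric] by (rule norm_blinfun)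
  obtain \<delta>1 where \<delta>1: "\<delta>1 > 0" "\<And>x. norm (x - x0) < \<delta>1 \<Longrightarrow> norm (M x - M x0 - D (x - x0)) \<le> \<epsilon> * norm (x - x0)"
    using M \<epsilon>(1) unfolding has_derivative_at_alt by blast
  obtain \<delta>2 where \<delta>2: "\<delta>2 > 0" "\<And>x. norm (x - x0) < \<delta>2 \<Longrightarrow> norm (DM x - DM x0) < \<epsilon>"
    using DM(1) \<epsilon>(1) unfolding continuous_at_eps_delta dist_norm by blast
  show ?thesis
  proof
    show "min \<epsilon> (min \<delta>1 \<delta>2) > 0" using \<epsilon> \<delta>1 \<delta>2 by simp
    fix x O' a
    assume x: "norm (x - x0) < min \<epsilon> (min \<delta>1 \<delta>2)" and hW: "x - x0 \<in> W" and O': "norm (O' - S) < min \<epsilon> (min \<delta>1 \<delta>2)"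
      and foc: "\<And>w. w \<in> W \<Longrightarrow> DM x w \<bullet> (O' *v (a - (M x - M x0))) = 0"
    define h where "h = x - x0"
    define R where "R = M x - M x0 - D h"
    define r where "r = a - (M x - M x0)"
    define v where "v = info (est a - h)"
    have Rn: "norm R \<le> \<epsilon> * norm h" using \<delta>1(2)[of x] x by (simp add: R_def h_def)
    have DMn: "norm (DM x - DM x0) \<le> \<epsilon>" using \<delta>2(2)[of x] x by simp
    have On: "norm (O' - S) \<le> \<epsilon>" using O' by simp
    have vW: "v \<in> W" unfolding v_def by (rule info_in)
    have rn: "norm r \<le> norm a + (d + 1) * norm h"
    proof -
      have "r = a - (D h + R)" by (simp add: r_def R_def)
      then have "norm r \<le> norm a + (norm (D h) + norm R)"
        using norm_triangle_ineq4[of a "D h + R"] norm_triangle_ineq[of "D h" R] by simp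
      also have "norm (D h) + norm R \<le> d * norm h + 1 * norm h"
        using Rn mult_right_mono[OF \<epsilon>(2), of "norm h"] by (intro add_mono Dn) auto
      finally show ?thesis by (simp add: algebra_simps)
    qed
    have "v \<bullet> v = D v \<bullet> (S *v a) - D v \<bullet> (S *v D h)"
      using inner_info_est[OF vW, of a] inner_info[OF vW, of h]
      by (simp add: linear_diff[OF linear_info] inner_diff_right v_def)
    \<comment> \<open>Here \<open>a - D h = R + r\<close>, and the subtracted stationarity term is
      zero.\<close>
    also have "\<dots> = D v \<bullet> (S *v (R + r)) - DM x v \<bullet> (O' *v r)"
      using foc[OF vW] by (simp add: r_def R_def inner_diff_right matrix_vector_mult_diff_distrib)
    also have "\<dots> = D v \<bullet> (S *v R) - (DM x v - D v) \<bullet> (S *v r) - DM x v \<bullet> ((O' - S) *v r)"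
      by (simp add: matrix_vector_right_distrib matrix_vector_mult_diff_rdistrib inner_add_right inner_diff_left inner_diff_right)
    also have "\<dots> \<le> norm (D v) * norm (S *v R) + norm (DM x v - D v) * norm (S *v r) + norm (DM x v) * norm ((O' - S) *v r)"
      using Cauchy_Schwarz_ineq2[of "D v" "S *v R"] Cauchy_Schwarz_ineq2[of "DM x v - D v" "S *v r"]
        Cauchy_Schwarz_ineq2[of "DM x v" "(O' - S) *v r"] by linarith
    also have "\<dots> \<le> (d * norm v) * (s * (\<epsilon> * norm h)) + (\<epsilon> * norm v) * (s * norm r) + ((d + 1) * norm v) * (\<epsilon> * norm r)"
    proof (intro add_mono mult_mono)
      show "norm (S *v R) \<le> s * (\<epsilon> * norm h)"
        using norm_matrix_vector_mult_le[of S R] mult_left_mono[OF Rn ds(2)] by (simp add: s_def)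
      show "norm (S *v r) \<le> s * norm r" unfolding s_def by (rule norm_matrix_vector_mult_le)
      show dv: "norm (DM x v - D v) \<le> \<epsilon> * norm v"
        using norm_blinfun[of "DM x - DM x0" v] mult_right_mono[OF DMn, of "norm v"]
        by (simp add: blinfun.diff_left DM(2))
      show "norm (DM x v) \<le> (d + 1) * norm v"
      proof -
        have "norm (DM x v) \<le> norm (D v) + norm (DM x v - D v)"
          using norm_triangle_ineq[of "D v" "DM x v - D v"] by simp
        also have "\<dots> \<le> d * norm v + 1 * norm v"
          using dv mult_right_mono[OF \<epsilon>(2), of "norm v"] by (intro add_mono Dn) auto
        finally show ?thesis by (simp add: algebra_simps)
      qed
      show "norm ((O' - S) *v r) \<le> \<epsilon> * norm r"
        using norm_matrix_vector_mult_le[of "O' - S" r] mult_right_mono[OF On, of "norm r"] by simp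
    qed (use ds \<epsilon> Dn in auto)
    also have "\<dots> = norm v * (\<epsilon> * (d * s * norm h + (s + d + 1) * norm r))"
      by (simp add: algebra_simps)
    also have "\<dots> \<le> norm v * (\<epsilon> * (K * (norm a + norm h)))"
    proof (intro mult_left_mono)
      have "(s + d + 1) * norm r \<le> (s + d + 1) * (norm a + (d + 1) * norm h)"
        using ds by (intro mult_left_mono rn) auto
      moreover have "(s + d + 1) * norm a \<le> K * norm a" using K(2) by (intro mult_right_mono) auto
      ultimately show "d * s * norm h + (s + d + 1) * norm r \<le> K * (norm a + norm h)"
        unfolding K_def by (simp add: algebra_simps)
    qed (use \<epsilon> in auto)
    finally have vv: "norm v * norm v \<le> norm v * (\<epsilon> * (K * (norm a + norm h)))"
      by (simp add: power2_eq_square[symmetric] power2_norm_eq_inner)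
    have v_le: "norm v \<le> \<epsilon> * K * (norm a + norm h)"
    proof (cases "v = 0")
      case True
      then show ?thesis using \<epsilon> K by simp
    next
      case False
      then show ?thesis using vv by (simp add: mult.assoc)
    qed
    define q where "q = norm (est a - h)"
    have "est a - h \<in> W" using est_in hW W by (simp add: h_def subspace_diff)
    then have cq: "c * q \<le> norm v" unfolding q_def v_def by (rule c(2))
    have "norm h \<le> q + b * norm a"
      using norm_triangle_ineq3[of "est a" h] b(2)[of a] norm_triangle_sub[of h "est a"] unfolding q_def
      by (simp add: norm_minus_commute)
    then have "\<epsilon> * K * (norm a + norm h) \<le> \<epsilon> * K * ((1 + b) * norm a + q)"
      using \<epsilon> K by (intro mult_left_mono) (auto simp: algebra_simps)
    also have "\<dots> = \<epsilon> * K * (1 + b) * norm a + \<epsilon> * K * q" by (simp add: algebra_simps)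
    also have "\<dots> \<le> \<eta> * (c / 2) * norm a + c / 2 * q"
      using \<epsilon>b \<epsilon>c by (intro add_mono mult_right_mono) (auto simp: q_def)
    finally have "c * q \<le> \<eta> * (c / 2) * norm a + c / 2 * q" using v_le cq by linarith
    then have "(c / 2) * q \<le> (c / 2) * (\<eta> * norm a)" by (simp add: algebra_simps)
    then have "q \<le> \<eta> * norm a" using c(1) by simp
    then show "norm (x - x0 - est a) \<le> \<eta> * norm a"
      by (simp add: q_def h_def norm_minus_commute)
  qed
qed

end

section \<open>Geometry and covariance of the model\<close>

lemma covariance_matrix_inner:
  fixes \<psi> :: "'x \<Rightarrow> real^'k"
  assumes M: "prob_space M" and int1: "\<And>\<kappa>. integrable M (\<lambda>y. \<psi> y $ \<kappa>)"
    and int2: "\<And>\<kappa> \<kappa>'. integrable M (\<lambda>y. \<psi> y $ \<kappa> * \<psi> y $ \<kappa>')"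
    and m: "m = integral\<^sup>L M \<psi>"
    and C: "C = (\<chi> \<kappa> \<kappa>'. LINT y|M. (\<psi> y $ \<kappa> - m $ \<kappa>) * (\<psi> y $ \<kappa>' - m $ \<kappa>'))"
  shows "integrable M (\<lambda>y. u \<bullet> (\<psi> y - m))" "(LINT y|M. u \<bullet> (\<psi> y - m)) = 0"
    "integrable M (\<lambda>y. (u \<bullet> (\<psi> y - m)) * (v \<bullet> (\<psi> y - m)))"
    "(LINT y|M. (u \<bullet> (\<psi> y - m)) * (v \<bullet> (\<psi> y - m))) = u \<bullet> (C *v v)"
proof -
  interpret prob_space M by fact
  have c: "integrable M (\<lambda>y. \<psi> y $ \<kappa> - m $ \<kappa>)" for \<kappa>
    using int1 by simp
  have c0: "(LINT y|M. \<psi> y $ \<kappa> - m $ \<kappa>) = 0" for \<kappa>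
    using int1 integrable_vec(2)[OF int1, of \<kappa>] by (simp add: m prob_space)
  have e1: "u \<bullet> (\<psi> y - m) = (\<Sum>\<kappa>\<in>UNIV. u $ \<kappa> * (\<psi> y $ \<kappa> - m $ \<kappa>))" for u y
    by (simp add: inner_vec_def)
  show "integrable M (\<lambda>y. u \<bullet> (\<psi> y - m))"
    unfolding e1 by (intro Bochner_Integration.integrable_sum integrable_mult_right c)
  show "(LINT y|M. u \<bullet> (\<psi> y - m)) = 0"
    unfolding e1 using c c0 by simp
  have cc: "integrable M (\<lambda>y. (\<psi> y $ \<kappa> - m $ \<kappa>) * (\<psi> y $ \<kappa>' - m $ \<kappa>'))" for \<kappa> \<kappa>'
  proof -
    have "(\<psi> y $ \<kappa> - m $ \<kappa>) * (\<psi> y $ \<kappa>' - m $ \<kappa>') =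
        \<psi> y $ \<kappa> * \<psi> y $ \<kappa>' - m $ \<kappa> * \<psi> y $ \<kappa>' - m $ \<kappa>' * \<psi> y $ \<kappa> + m $ \<kappa> * m $ \<kappa>'" for y
      by (simp add: algebra_simps)
    then show ?thesis using int1 int2 by simp
  qed
  have e2: "(u \<bullet> (\<psi> y - m)) * (v \<bullet> (\<psi> y - m)) =
      (\<Sum>\<kappa>\<in>UNIV. \<Sum>\<kappa>'\<in>UNIV. (u $ \<kappa> * v $ \<kappa>') * ((\<psi> y $ \<kappa> - m $ \<kappa>) * (\<psi> y $ \<kappa>' - m $ \<kappa>')))" for y
    unfolding e1 sum_product by (intro sum.cong refl) (simp add: mult_ac)
  show "integrable M (\<lambda>y. (u \<bullet> (\<psi> y - m)) * (v \<bullet> (\<psi> y - m)))"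
    unfolding e2 by (intro Bochner_Integration.integrable_sum integrable_mult_right cc)
  have "(LINT y|M. (u \<bullet> (\<psi> y - m)) * (v \<bullet> (\<psi> y - m))) = (\<Sum>\<kappa>\<in>UNIV. \<Sum>\<kappa>'\<in>UNIV. (u $ \<kappa> * v $ \<kappa>') * C $ \<kappa> $ \<kappa>')"
    unfolding e2 by (simp add: C cc)
  also have "\<dots> = u \<bullet> (C *v v)"
    by (simp add: inner_vec_def matrix_vector_mult_def sum_distrib_left mult_ac)
  finally show "(LINT y|M. (u \<bullet> (\<psi> y - m)) * (v \<bullet> (\<psi> y - m))) = u \<bullet> (C *v v)" .
qed

lemma transpose_eq_if_inner_sym:
  fixes C :: "real^'k^'k"
  assumes "\<And>u v. u \<bullet> (C *v v) = (C *v u) \<bullet> v"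
  shows "transpose C = C"
proof -
  have "transpose C *v u = C *v u" for u
  proof (rule vector_eq_rdot[THEN iffD1, rule_format])
    show "(transpose C *v u) \<bullet> v = (C *v u) \<bullet> v" for v
      using assms[of u v] by (simp add: dot_lmul_matrix[symmetric] transpose_matrix_vector)
  qed
  then show ?thesis by (simp add: matrix_eq)
qed

text \<open>A vector where a semidefinite form vanishes lies in the kernel, so invertibility
  upgrades the covariance to a definite matrix; substituting \<open>S *v x\<close> transfers
  definiteness to the inverse.\<close>

lemma pd_matrix_inverse:
  fixes C :: "real^'k^'k"
  assumes inv: "invertible C" and sym: "\<And>u v. u \<bullet> (C *v v) = (C *v u) \<bullet> v" and psd: "\<And>u. 0 \<le> u \<bullet> (C *v u)"
  shows "u \<noteq> 0 \<Longrightarrow> 0 < u \<bullet> (C *v u)" "pd_matrix (matrix_inv C)" "C ** matrix_inv C = mat 1"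
proof -
  have "C ** matrix_inv C = mat 1 \<and> matrix_inv C ** C = mat 1"
    using inv unfolding invertible_def matrix_inv_def by (rule someI_ex)
  then have r: "C ** matrix_inv C = mat 1" and l: "matrix_inv C ** C = mat 1" by auto
  show "C ** matrix_inv C = mat 1" by (rule r)
  have pos: "0 < u \<bullet> (C *v u)" if "u \<noteq> 0" for u
  proof (rule ccontr)
    assume "\<not> ?thesis"
    then have "u \<bullet> (C *v u) = 0" using psd[of u] by simp
    then have "C *v u = 0" using psd_form_zero[of "(*v) C" u] sym psd by simp
    then have "(matrix_inv C ** C) *v u = 0" by (simp flip: matrix_vector_mul_assoc)
    then show False using that l by simp
  qed
  then show "u \<noteq> 0 \<Longrightarrow> 0 < u \<bullet> (C *v u)" .
  define S where "S = matrix_inv C"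
  have CS: "C *v (S *v x) = x" for x using r by (simp add: S_def matrix_vector_mul_assoc)
  have "x \<bullet> (S *v z) = (S *v x) \<bullet> z" for x z
    using sym[of "S *v x" "S *v z"] by (simp add: CS)
  then have "transpose S = S" by (rule transpose_eq_if_inner_sym)
  moreover have "0 < x \<bullet> (S *v x)" if "x \<noteq> 0" for x
  proof -
    have "S *v x \<noteq> 0" using CS[of x] that by auto
    from pos[OF this] show ?thesis by (simp add: CS inner_commute)
  qed
  ultimately show "pd_matrix (matrix_inv C)" by (simp add: pd_matrix_def S_def)
qed

text \<open>Used with \<open>Suc\<close>: the sample is numbered from \<open>1\<close>, the limit
  theorem from \<open>0\<close>.\<close>

lemma (in prob_space) indep_vars_reindex:
  assumes inj: "inj_on g I" and ind: "indep_vars M' X (g ` I)"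
  shows "indep_vars (\<lambda>i. M' (g i)) (\<lambda>i. X (g i)) I"
  unfolding indep_vars_def2 indep_sets_def
proof (intro conjI ballI allI impI)
  show "random_variable (M' (g i)) (X (g i))" if "i \<in> I" for i
    using ind that by (auto simp: indep_vars_def2)
  show "{X (g i) -` A \<inter> space M |A. A \<in> sets (M' (g i))} \<subseteq> events" if "i \<in> I" for i
    using ind that by (auto simp: indep_vars_def2 indep_sets_def)
  fix J A assume J: "J \<subseteq> I" "J \<noteq> {}" "finite J"
    and A: "A \<in> (\<Pi> i\<in>J. {X (g i) -` A \<inter> space M |A. A \<in> sets (M' (g i))})"
  have injJ: "inj_on g J" using inj J(1) by (rule inj_on_subset)
  define A' where "A' = A \<circ> the_inv_into J g"
  have A': "A' (g i) = A i" if "i \<in> J" for i using that injJ by (simp add: A'_def the_inv_into_f_f)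
  have "A' \<in> (\<Pi> i\<in>g ` J. {X i -` A \<inter> space M |A. A \<in> sets (M' i)})"
    using A A' by (auto simp: Pi_iff)
  then have "prob (\<Inter>j\<in>g ` J. A' j) = (\<Prod>j\<in>g ` J. prob (A' j))"
    using ind J unfolding indep_vars_def2 indep_sets_def by (meson finite_imageI image_is_empty image_mono)
  then show "prob (\<Inter>j\<in>J. A j) = (\<Prod>j\<in>J. prob (A j))"
    using A' by (simp add: prod.reindex[OF injJ])
qed

section \<open>The observation law and the geometry of equivalence classes\<close>

context signal_model
begin

lemma prob_space_obs_law: "prob_space (obs_law \<mu> A \<sigma> \<beta> \<theta>)"
proof
  interpret S: prob_space std_normal_distribution
    using real_dist_normal_dist by (simp add: real_distribution_def)
  have "measure (obs_law \<mu> A \<sigma> \<beta> \<theta>) (space (obs_law \<mu> A \<sigma> \<beta> \<theta>)) = 1"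
    using obs_law_integral_poly(2)[of \<beta> \<theta> "\<lambda>_. 1"] S.prob_space prob_space by simp
  \<comment> \<open>An infinite mass would have \<open>measure\<close> zero, so the value one
    settles finiteness.\<close>
  then show "emeasure (obs_law \<mu> A \<sigma> \<beta> \<theta>) (space (obs_law \<mu> A \<sigma> \<beta> \<theta>)) = 1"
    using emeasure_eq_ennreal_measure[of "obs_law \<mu> A \<sigma> \<beta> \<theta>" "space (obs_law \<mu> A \<sigma> \<beta> \<theta>)"]
    by (auto simp: measure_def)
qed

lemma sets_obs_law: "sets (obs_law \<mu> A \<sigma> \<beta> \<theta>) = sets borel"
  by (simp add: obs_law_def)

lemma mean_feature_equiv:
  assumes "param_equiv \<mu> A \<sigma> \<beta> \<theta> \<theta>'"
  shows "mean_feature \<mu> A \<sigma> \<beta> \<psi> \<theta> = mean_feature \<mu> A \<sigma> \<beta> \<psi> \<theta>'"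
proof -
  have "obs_law \<mu> A \<sigma> \<beta> \<theta> = obs_law \<mu> A \<sigma> \<beta> \<theta>'"
    unfolding obs_law_def
  proof (rule density_cong)
    show "AE y in lborel. ennreal (obs_density \<mu> A \<sigma> \<beta> \<theta> y) = ennreal (obs_density \<mu> A \<sigma> \<beta> \<theta>' y)"
      using assms unfolding param_equiv_def by eventually_elim simp
  qed measurable
  then show ?thesis by (simp add: mean_feature_def)
qed

text \<open>Borel measurability is extracted from integrability under an observation law, since
  every such law carries the Borel sigma-algebra.\<close>

lemma feature_measurable: "feature \<sigma> ord (e :: 'k::finite \<Rightarrow> 'd tensor) \<in> borel_measurable borel"
proof -
  have "integrable (obs_law \<mu> A \<sigma> 0 0) (feature \<sigma> ord e)"
    by (rule integrable_vec(1)[OF feature_integrable(1)])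
  then have "feature \<sigma> ord e \<in> borel_measurable (obs_law \<mu> A \<sigma> 0 0)"
    by (rule borel_measurable_integrable)
  then show ?thesis by (simp only: measurable_cong_sets[OF sets_obs_law refl])
qed

end

lemma param_equiv_refl: "param_equiv \<mu> A \<sigma> \<beta> \<theta> \<theta>"
  by (simp add: param_equiv_def)

lemma param_equiv_sym: "param_equiv \<mu> A \<sigma> \<beta> \<theta> \<theta>' \<Longrightarrow> param_equiv \<mu> A \<sigma> \<beta> \<theta>' \<theta>"
  unfolding param_equiv_def by (erule eventually_mono) simp

lemma param_equiv_trans:
  "param_equiv \<mu> A \<sigma> \<beta> \<theta> \<theta>' \<Longrightarrow> param_equiv \<mu> A \<sigma> \<beta> \<theta>' \<theta>'' \<Longrightarrow> param_equiv \<mu> A \<sigma> \<beta> \<theta> \<theta>''"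
  unfolding param_equiv_def by (erule (1) eventually_elim2) simp

lemma equiv_on_equiv: "equiv U (equiv_on \<mu> A \<sigma> \<beta> U)"
  by (intro equivI refl_onI symI transI)
     (auto simp: equiv_on_def intro: param_equiv_refl param_equiv_sym param_equiv_trans)

text \<open>\<open>f\<close>, the projection followed by a chart around the class of
  \<open>\<theta>s\<close>, has exactly the equivalence classes within \<open>U0\<close> as fibres
  because the chart is injective. The slice construction applies to it, with \<open>K\<close> the
  kernel of its derivative at \<open>\<theta>s\<close>; curves in the class have velocity in
  \<open>K\<close> because \<open>f\<close> is constant along them.\<close>

lemma condition_Q_slice:
  fixes \<theta>s :: "real^'m"
  assumes Q: "condition_Q \<mu> A \<sigma> \<beta> \<Theta> \<theta>s"
  obtains K N s U where "subspace K" "open N" "\<theta>s \<in> N" "continuous_on N s" "s \<theta>s = \<theta>s" "U \<subseteq> \<Theta>" "open U"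
    "\<And>x. x \<in> N \<Longrightarrow> s x \<in> U \<and> param_equiv \<mu> A \<sigma> \<beta> (s x) x \<and> s x - \<theta>s \<in> K\<^sup>\<bottom>"
    "class_tangent \<mu> A \<sigma> \<beta> \<Theta> \<theta>s \<subseteq> K"
    "\<And>v. v \<in> K \<Longrightarrow> \<exists>\<gamma>. \<gamma> 0 = \<theta>s \<and> (\<gamma> has_vector_derivative v) (at 0) \<and>
       eventually (\<lambda>t. param_equiv \<mu> A \<sigma> \<beta> (\<gamma> t) \<theta>s) (nhds (0::real))"
proof -
  obtain U and V :: "(real^'m) set" and X \<A> where U: "open U" "\<theta>s \<in> U" "U \<subseteq> \<Theta>"
    and X: "topspace X = U // equiv_on \<mu> A \<sigma> \<beta> U"
    and mf: "C2_manifold V X \<A>"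
    and sub: "C2_submersion U V X \<A> (\<lambda>\<theta>. equiv_on \<mu> A \<sigma> \<beta> U `` {\<theta>})"
    using Q unfolding condition_Q_def by blast
  define \<pi> where "\<pi> \<theta> = equiv_on \<mu> A \<sigma> \<beta> U `` {\<theta>}" for \<theta>
  have pi_eq: "\<pi> x = \<pi> y \<longleftrightarrow> param_equiv \<mu> A \<sigma> \<beta> x y" if "x \<in> U" "y \<in> U" for x y
    unfolding \<pi>_def eq_equiv_class_iff[OF equiv_on_equiv that] using that by (simp add: equiv_on_def)
  have "\<pi> \<theta>s \<in> topspace X" unfolding X \<pi>_def using U(2) by (rule quotientI)
  then obtain D \<phi> where D: "(D, \<phi>) \<in> \<A>" "\<pi> \<theta>s \<in> D"
    using mf unfolding C2_manifold_def by auto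
  have chart: "openin X D" "openin (top_of_set V) (\<phi> ` D)"
    "homeomorphic_map (subtopology X D) (top_of_set (\<phi> ` D)) \<phi>"
    using mf D(1) unfolding C2_manifold_def by blast+
  have "topspace (subtopology X D) = D"
    using openin_subset[OF chart(1)] by auto
  then have inj: "inj_on \<phi> D"
    using chart(3) unfolding homeomorphic_eq_everything_map by simp
  have sub': "continuous_map (top_of_set U) X \<pi>" "C2_on {\<theta>\<in>U. \<pi> \<theta> \<in> D} (\<phi> \<circ> \<pi>)"
    "\<And>\<theta>. \<theta> \<in> U \<Longrightarrow> \<pi> \<theta> \<in> D \<Longrightarrow> range (frechet_derivative (\<phi> \<circ> \<pi>) (at \<theta>)) = V"
    using sub D(1) unfolding C2_submersion_def \<pi>_def[abs_def, symmetric] by blast+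
  define U0 where "U0 = {\<theta>\<in>U. \<pi> \<theta> \<in> D}"
  have "openin (top_of_set U) U0"
    using openin_continuous_map_preimage[OF sub'(1) chart(1)] by (simp add: U0_def)
  then have U0: "open U0" using openin_open_eq[OF U(1)] by blast
  have \<theta>0: "\<theta>s \<in> U0" using U(2) D(2) by (simp add: U0_def)
  define f where "f = \<phi> \<circ> \<pi>"
  obtain f' :: "real^'m \<Rightarrow> (real^'m) \<Rightarrow>\<^sub>L (real^'m)" and f'' :: "real^'m \<Rightarrow> (real^'m) \<Rightarrow>\<^sub>L ((real^'m) \<Rightarrow>\<^sub>L (real^'m))"
    where f': "\<And>x. x \<in> U0 \<Longrightarrow> (f has_derivative blinfun_apply (f' x)) (at x within U0)"
    and f'': "\<And>x. x \<in> U0 \<Longrightarrow> (f' has_derivative blinfun_apply (f'' x)) (at x within U0)"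
    using sub'(2) unfolding C2_on_def U0_def f_def by blast
  have df: "(f has_derivative blinfun_apply (f' x)) (at x)" if "x \<in> U0" for x
    using f'[OF that] at_within_open[OF that U0] by simp
  have cf': "continuous_on U0 f'"
    using f'' has_derivative_continuous unfolding continuous_on_eq_continuous_within by blast
  have "frechet_derivative f (at \<theta>s) = blinfun_apply (f' \<theta>s)"
    using frechet_derivative_at[OF df[OF \<theta>0]] by simp
  then have rng: "range (blinfun_apply (f' \<theta>s)) = V"
    using sub'(3)[OF U(2) D(2)] by (simp add: f_def)
  have fV: "f x \<in> V" if "x \<in> U0" for x
    using that openin_imp_subset[OF chart(2)] by (auto simp: U0_def f_def)
  have f_equiv: "f x = f y \<longleftrightarrow> param_equiv \<mu> A \<sigma> \<beta> x y" if "x \<in> U0" "y \<in> U0" for x y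
    using that pi_eq[of x y] inj_on_eq_iff[OF inj, of "\<pi> x" "\<pi> y"] by (simp add: U0_def f_def)
  define K where "K = {v. blinfun_apply (f' \<theta>s) v = 0}"
  obtain N s where N: "open N" "\<theta>s \<in> N" "N \<subseteq> U0" "continuous_on N s" "s \<theta>s = \<theta>s"
    and s: "\<And>x. x \<in> N \<Longrightarrow> s x \<in> U0 \<and> f (s x) = f x \<and> s x - \<theta>s \<in> K\<^sup>\<bottom>"
    and \<gamma>: "\<And>v. v \<in> K \<Longrightarrow> \<exists>\<gamma>. \<gamma> 0 = \<theta>s \<and> (\<gamma> has_vector_derivative v) (at 0) \<and>
       eventually (\<lambda>t. \<gamma> t \<in> U0 \<and> f (\<gamma> t) = f \<theta>s) (nhds (0::real))"
    by (rule submersion_slice[OF U0 \<theta>0 df cf' rng fV, folded K_def]) (assumption | rule that)+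
  show ?thesis
  proof
    show "subspace K"
      unfolding K_def by (rule linear_subspace_kernel[OF bounded_linear.linear[OF blinfun.bounded_linear_right]])
    show "U0 \<subseteq> \<Theta>" using U(3) by (auto simp: U0_def)
    show "s x \<in> U0 \<and> param_equiv \<mu> A \<sigma> \<beta> (s x) x \<and> s x - \<theta>s \<in> K\<^sup>\<bottom>" if "x \<in> N" for x
      using s[OF that] f_equiv[of "s x" x] N(3) that by blast
    show "\<exists>\<gamma>. \<gamma> 0 = \<theta>s \<and> (\<gamma> has_vector_derivative v) (at 0) \<and>
       eventually (\<lambda>t. param_equiv \<mu> A \<sigma> \<beta> (\<gamma> t) \<theta>s) (nhds (0::real))" if v: "v \<in> K" for v
    proof -
      obtain \<gamma> where g: "\<gamma> 0 = \<theta>s" "(\<gamma> has_vector_derivative v) (at 0)"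
        "eventually (\<lambda>t. \<gamma> t \<in> U0 \<and> f (\<gamma> t) = f \<theta>s) (nhds (0::real))"
        using \<gamma>[OF v] by blast
      have "eventually (\<lambda>t. param_equiv \<mu> A \<sigma> \<beta> (\<gamma> t) \<theta>s) (nhds (0::real))"
        using g(3) by eventually_elim (use f_equiv \<theta>0 in blast)
      then show ?thesis using g by blast
    qed
    show "class_tangent \<mu> A \<sigma> \<beta> \<Theta> \<theta>s \<subseteq> K"
    proof
      fix v assume "v \<in> class_tangent \<mu> A \<sigma> \<beta> \<Theta> \<theta>s"
      then obtain \<epsilon> and \<gamma> :: "real \<Rightarrow> real^'m" where g: "\<epsilon> > 0"
        "\<gamma> ` {-\<epsilon><..<\<epsilon>} \<subseteq> param_class \<mu> A \<sigma> \<beta> \<Theta> \<theta>s" "\<gamma> 0 = \<theta>s" "(\<gamma> has_vector_derivative v) (at 0)"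
        unfolding class_tangent_def by blast
      have dg: "(\<gamma> has_derivative (\<lambda>t. t *\<^sub>R v)) (at 0)"
        using g(4) by (simp add: has_vector_derivative_def)
      have "isCont \<gamma> 0" using has_derivative_continuous[OF dg] .
      then have "eventually (\<lambda>t. \<gamma> t \<in> U0) (at 0)"
        using U0 \<theta>0 g(3) by (intro topological_tendstoD[of \<gamma> \<theta>s]) (auto simp: isCont_def)
      moreover have "eventually (\<lambda>t. t \<in> {-\<epsilon><..<\<epsilon>}) (at (0::real))"
        using g(1) by (intro eventually_at_in_open') auto
      ultimately have ev: "eventually (\<lambda>t. f (\<gamma> t) = f \<theta>s) (at 0)"
      proof eventually_elim
        case (elim t)
        have "\<gamma> t \<in> param_class \<mu> A \<sigma> \<beta> \<Theta> \<theta>s" using g(2) elim(2) by blast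
        then show ?case using f_equiv[OF elim(1) \<theta>0] by (simp add: param_class_def)
      qed
      have "((\<lambda>t. f (\<gamma> t)) has_derivative (\<lambda>t. f' \<theta>s (t *\<^sub>R v))) (at 0)"
        using has_derivative_compose[OF dg, of f "blinfun_apply (f' \<theta>s)"] df[OF \<theta>0] g(3) by simp
      moreover have "((\<lambda>t. f (\<gamma> t)) has_derivative (\<lambda>t. 0)) (at 0)"
        by (rule has_derivative_transform_eventually[OF has_derivative_const[of "f \<theta>s"]])
           (use ev g(3) in \<open>auto elim: eventually_mono\<close>)
      ultimately have "(\<lambda>t. f' \<theta>s (t *\<^sub>R v)) = (\<lambda>t. 0)" by (rule has_derivative_unique)
      from fun_cong[OF this, of 1] show "v \<in> K" by (simp add: K_def)
    qed
  qed (use N U0 in auto)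
qed

text \<open>The derivative of the quadratic objective vanishes at an interior minimum; symmetry of
  \<open>O'\<close> makes its two terms equal.\<close>

lemma weighted_square_first_order:
  fixes M :: "'a::euclidean_space \<Rightarrow> real^'k" and O' :: "real^'k^'k"
  assumes U: "open U" "x \<in> U" and min: "\<And>z. z \<in> U \<Longrightarrow> (a - M x) \<bullet> (O' *v (a - M x)) \<le> (a - M z) \<bullet> (O' *v (a - M z))"
    and M: "(M has_derivative D) (at x)" and sym: "transpose O' = O'"
  shows "D w \<bullet> (O' *v (a - M x)) = 0"
proof -
  have s: "u \<bullet> (O' *v v) = (O' *v u) \<bullet> v" for u v
  proof -
    have "u \<bullet> (O' *v v) = (transpose O' *v u) \<bullet> v" by (simp add: dot_lmul_matrix[symmetric] transpose_matrix_vector)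
    then show ?thesis by (simp only: sym)
  qed
  have d: "((\<lambda>z. a - M z) has_derivative (\<lambda>h. 0 - D h)) (at x)"
    by (intro has_derivative_diff has_derivative_const M)
  have "bounded_linear ((*v) O')" by (rule matrix_vector_mul_bounded_linear)
  from has_derivative_inner[OF d bounded_linear.has_derivative[OF this d]]
  have "((\<lambda>z. (a - M z) \<bullet> (O' *v (a - M z))) has_derivative
      (\<lambda>h. (a - M x) \<bullet> (O' *v (0 - D h)) + (0 - D h) \<bullet> (O' *v (a - M x)))) (at x)" .
  from differential_zero_maxmin[OF U(2,1) this] min
  have "(\<lambda>h. (a - M x) \<bullet> (O' *v (0 - D h)) + (0 - D h) \<bullet> (O' *v (a - M x))) = (\<lambda>h. 0)"
    by blast
  from fun_cong[OF this, of w] show ?thesis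
    using s[of "a - M x" "0 - D w"] by (simp add: inner_commute)
qed

text \<open>For an empty set of orders the infimum is \<open>\<infinity>\<close>, which exceeds
  \<open>enat L\<close>; a nonempty set of extended naturals contains its infimum.\<close>

lemma moment_order_attained:
  assumes "moment_order \<mu> A \<theta> h \<le> enat L"
  obtains j where "1 \<le> j" "j \<le> L" "D_signal_moment \<mu> A j \<theta> h \<noteq> (\<lambda>is. 0)"
proof -
  let ?J = "{j. 1 \<le> j \<and> D_signal_moment \<mu> A j \<theta> h \<noteq> (\<lambda>is. 0)}"
  have ne: "enat ` ?J \<noteq> {}"
  proof
    assume "enat ` ?J = {}"
    then show False using assms unfolding moment_order_def by (simp add: Inf_enat_def)
  qed
  then have "Inf (enat ` ?J) \<in> enat ` ?J"
    unfolding Inf_enat_def by (simp only: if_False) (metis (mono_tags, lifting) LeastI_ex ex_in_conv)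
  then show ?thesis using assms that unfolding moment_order_def by auto
qed

context signal_model
begin

text \<open>The order condition forces the derivative of the moment map to be injective on \<open>W\<close>; since it
  vanishes on the kernel \<open>K\<close> of the quotient chart and \<open>K\<^sup>\<bottom> \<subseteq> W\<close>, this already gives \<open>W = K\<^sup>\<bottom>\<close>.\<close>

lemma transversal_slice:
  fixes e :: "'k::finite \<Rightarrow> 'd tensor"
  assumes Q: "condition_Q \<mu> A \<sigma> \<beta> \<Theta> \<theta>s" and bases: "sym_tensor_bases L ord e"
    and order: "local_order \<mu> A \<sigma> \<beta> \<Theta> \<theta>s \<le> enat L" and "\<beta> > 0"
    and D: "(mean_feature \<mu> A \<sigma> \<beta> (feature \<sigma> ord e) has_derivative D) (at \<theta>s)"
  defines "W \<equiv> transversal_space \<mu> A \<sigma> \<beta> \<Theta> \<theta>s"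
  obtains N s U where "open N" "\<theta>s \<in> N" "continuous_on N s" "s \<theta>s = \<theta>s" "U \<subseteq> \<Theta>" "open U"
    "\<And>x. x \<in> N \<Longrightarrow> s x \<in> U \<and> param_equiv \<mu> A \<sigma> \<beta> (s x) x \<and> s x - \<theta>s \<in> W"
    "\<And>h. h \<in> W \<Longrightarrow> D h = 0 \<Longrightarrow> h = 0"
proof -
  let ?M = "mean_feature \<mu> A \<sigma> \<beta> (feature \<sigma> ord e)"
  obtain K N s U where K: "subspace K" and N: "open N" "\<theta>s \<in> N" "continuous_on N s" "s \<theta>s = \<theta>s" "U \<subseteq> \<Theta>" "open U"
    and s: "\<And>x. x \<in> N \<Longrightarrow> s x \<in> U \<and> param_equiv \<mu> A \<sigma> \<beta> (s x) x \<and> s x - \<theta>s \<in> K\<^sup>\<bottom>"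
    and T: "class_tangent \<mu> A \<sigma> \<beta> \<Theta> \<theta>s \<subseteq> K"
    and \<gamma>: "\<And>v. v \<in> K \<Longrightarrow> \<exists>\<gamma>. \<gamma> 0 = \<theta>s \<and> (\<gamma> has_vector_derivative v) (at 0) \<and>
       eventually (\<lambda>t. param_equiv \<mu> A \<sigma> \<beta> (\<gamma> t) \<theta>s) (nhds (0::real))"
    by (rule condition_Q_slice[OF Q]) (assumption | rule that)+
  have KW: "K\<^sup>\<bottom> \<subseteq> W"
    unfolding W_def transversal_space_def by (rule orthogonal_comp_anti_mono[OF T])
  have inj: "h = 0" if h: "h \<in> W" and D0: "D h = 0" for h
  proof (rule ccontr)
    assume "h \<noteq> 0"
    then have "moment_order \<mu> A \<theta>s h \<le> local_order \<mu> A \<sigma> \<beta> \<Theta> \<theta>s"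
      unfolding local_order_def using h by (intro SUP_upper) (simp add: W_def)
    then have "moment_order \<mu> A \<theta>s h \<le> enat L" using order by (rule order_trans)
    then obtain j where j: "1 \<le> j" "j \<le> L" "D_signal_moment \<mu> A j \<theta>s h \<noteq> (\<lambda>is. 0)"
      by (rule moment_order_attained)
    from D_mean_feature_nonzero[OF bases j(1,2) \<open>\<beta> > 0\<close> D j(3)] D0 show False by blast
  qed
  \<comment> \<open>\<open>?M\<close> is constant near time \<open>0\<close> along a curve through
    \<open>\<theta>s\<close> with velocity \<open>v\<close>, since the curve stays in the class
    there.\<close>
  have DK: "D v = 0" if v: "v \<in> K" for v
  proof -
    obtain g where g: "g 0 = \<theta>s" "(g has_vector_derivative v) (at 0)"
      "eventually (\<lambda>t. param_equiv \<mu> A \<sigma> \<beta> (g t) \<theta>s) (nhds (0::real))"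
      using \<gamma>[OF v] by blast
    have dg: "(g has_derivative (\<lambda>t. t *\<^sub>R v)) (at 0)"
      using g(2) by (simp add: has_vector_derivative_def)
    have "((\<lambda>t. ?M (g t)) has_derivative (\<lambda>t. D (t *\<^sub>R v))) (at 0)"
      using has_derivative_compose[OF dg, of ?M D] D g(1) by simp
    moreover have "((\<lambda>t. ?M (g t)) has_derivative (\<lambda>t. 0)) (at 0)"
    proof (rule has_derivative_transform_eventually[OF has_derivative_const[of "?M \<theta>s"]])
      have "eventually (\<lambda>t. ?M \<theta>s = ?M (g t)) (nhds 0)"
        by (rule eventually_mono[OF g(3)]) (rule mean_feature_equiv[symmetric])
      then show "eventually (\<lambda>t. ?M \<theta>s = ?M (g t)) (at 0)"
        unfolding eventually_nhds_conv_at by (rule conjunct1)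
    qed (use g(1) in auto)
    ultimately have "(\<lambda>t. D (t *\<^sub>R v)) = (\<lambda>t. 0)" by (rule has_derivative_unique)
    from fun_cong[OF this, of 1] show ?thesis by simp
  qed
  have "W \<subseteq> K\<^sup>\<bottom>"
  proof
    fix w assume w: "w \<in> W"
    have Ks: "subspace (K\<^sup>\<bottom>)" by (rule subspace_orthogonal_comp)
    have Ws: "subspace W" unfolding W_def transversal_space_def by (rule subspace_orthogonal_comp)
    define p where "p = orth_proj (K\<^sup>\<bottom>) w"
    have p: "p \<in> K\<^sup>\<bottom>" "w - p \<in> K"
      using orth_proj_in[OF Ks, of w] orthogonal_comp_self[OF K] by (auto simp: p_def)
    then have "w - p \<in> W" using w KW Ws by (intro subspace_diff) auto
    then have "w - p = 0" using inj DK p(2) by blast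
    then show "w \<in> K\<^sup>\<bottom>" using p(1) by simp
  qed
  then have "K\<^sup>\<bottom> = W" using KW by blast
  then show ?thesis using that[OF N] s inj by blast
qed

text \<open>The centred features of the sample are independent and identically distributed with
  finite second moments, since products of Hermite entries are polynomial; invertibility makes their
  covariance definite, as \<open>CLT_vec\<close> requires.\<close>

lemma empirical_feature_CLT:
  fixes e :: "'k::finite \<Rightarrow> 'd tensor" and ord :: "'k \<Rightarrow> nat" and y :: "nat \<Rightarrow> 'w \<Rightarrow> real^'d"
  assumes P: "prob_space P" and indep: "prob_space.indep_vars P (\<lambda>_. borel) y {1..}"
    and dens: "\<And>i. 1 \<le> i \<Longrightarrow> distributed P lborel (y i) (\<lambda>x. ennreal (obs_density \<mu> A \<sigma> \<beta> \<theta> x))"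
  defines "\<psi> \<equiv> feature \<sigma> ord e"
  defines "C \<equiv> cov_feature \<mu> A \<sigma> \<beta> \<psi> \<theta>"
  defines "Y \<equiv> \<lambda>n \<omega>. sqrt (real n) *\<^sub>R (empirical_feature \<psi> n (\<lambda>i. y i \<omega>) - mean_feature \<mu> A \<sigma> \<beta> \<psi> \<theta>)"
  assumes inv: "invertible C"
  shows "pd_matrix (matrix_inv C)" "C ** matrix_inv C = mat 1" "\<And>n. Y n \<in> borel_measurable P"
    "\<exists>\<nu>. is_normal_vec 0 ((*v) C) \<nu> \<and> weak_conv_vec (\<lambda>n. distr P borel (Y n)) \<nu>"
proof -
  let ?N = "obs_law \<mu> A \<sigma> \<beta> \<theta>"
  define m where "m = mean_feature \<mu> A \<sigma> \<beta> \<psi> \<theta>"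
  interpret P: prob_space P by fact
  have \<psi>m: "\<psi> \<in> borel_measurable borel" unfolding \<psi>_def by (rule feature_measurable)
  have i1: "integrable ?N (\<lambda>y. \<psi> y $ \<kappa>)" and i2: "integrable ?N (\<lambda>y. \<psi> y $ \<kappa> * \<psi> y $ \<kappa>')" for \<kappa> \<kappa>'
    unfolding \<psi>_def by (rule feature_integrable)+
  note cm = covariance_matrix_inner[OF prob_space_obs_law i1 i2
      m_def[unfolded mean_feature_def] C_def[THEN meta_eq_to_obj_eq, unfolded cov_feature_def, folded m_def]]
  have sym: "u \<bullet> (C *v v) = (C *v u) \<bullet> v" for u v
    using cm(4)[of u v] cm(4)[of v u] by (simp add: mult.commute inner_commute)
  have psd: "0 \<le> u \<bullet> (C *v u)" for u
    using cm(4)[of u u, symmetric] by (simp add: integral_nonneg)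
  note pd = pd_matrix_inverse[OF inv sym psd]
  show "pd_matrix (matrix_inv C)" "C ** matrix_inv C = mat 1" using pd by blast+
  have ym: "y i \<in> borel_measurable P" if "1 \<le> i" for i
    using distributed_measurable[OF dens[OF that]] by simp
  have yl: "distr P lborel (y i) = ?N" if "1 \<le> i" for i
    using distributed_distr_eq_density[OF dens[OF that]] by (simp add: obs_law_def)
  define Z where "Z i \<omega> = \<psi> (y (Suc i) \<omega>) - m" for i \<omega>
  have Zm: "Z i \<in> borel_measurable P" for i
    unfolding Z_def by (intro borel_measurable_diff measurable_compose[OF ym \<psi>m]) auto
  have gm: "(\<lambda>x. \<psi> x - m) \<in> borel_measurable borel"
    using \<psi>m by simp
  have tr: "(\<integral>\<omega>. g (Z i \<omega>) \<partial>P) = (\<integral>x. g (\<psi> x - m) \<partial>?N)" "integrable P (\<lambda>\<omega>. g (Z i \<omega>)) \<longleftrightarrow> integrable ?N (\<lambda>x. g (\<psi> x - m))"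
    if "g \<in> borel_measurable borel" for g :: "real^'k \<Rightarrow> real" and i
  proof -
    have "(\<lambda>x. g (\<psi> x - m)) \<in> borel_measurable lborel"
      using measurable_compose[OF gm that] by simp
    moreover have "y (Suc i) \<in> P \<rightarrow>\<^sub>M lborel" using ym[of "Suc i"] by simp
    ultimately show "(\<integral>\<omega>. g (Z i \<omega>) \<partial>P) = (\<integral>x. g (\<psi> x - m) \<partial>?N)" "integrable P (\<lambda>\<omega>. g (Z i \<omega>)) \<longleftrightarrow> integrable ?N (\<lambda>x. g (\<psi> x - m))"
      unfolding Z_def yl[of "Suc i", simplified, symmetric] by (simp_all add: integral_distr integrable_distr_eq)
  qed
  \<comment> \<open>At \<open>n = 0\<close> both sides are zero, by the factor \<open>sqrt 0\<close>
    on the left and the empty sum on the right.\<close>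
  have Yeq: "Y n = (\<lambda>\<omega>. (1 / sqrt n) *\<^sub>R (\<Sum>i<n. Z i \<omega>))" for n
  proof (cases "n = 0")
    case False
    have "sqrt n *\<^sub>R ((1 / n) *\<^sub>R (\<Sum>i<n. \<psi> (y (Suc i) \<omega>)) - m) = (1 / sqrt n) *\<^sub>R ((\<Sum>i<n. \<psi> (y (Suc i) \<omega>)) - n *\<^sub>R m)" for \<omega>
    proof -
      have "sqrt n * (1 / n) = 1 / sqrt n" "1 / sqrt n * n = sqrt n"
        using False by (simp_all add: real_div_sqrt divide_simps)
      then show ?thesis by (simp add: scaleR_diff_right)
    qed
    then show ?thesis
      by (simp add: Y_def Z_def empirical_feature_def m_def[symmetric] sum.atLeast1_atMost_eq sum_subtractf sum_constant_scaleR del: sum_constant)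
  qed (simp add: Y_def fun_eq_iff)
  show "Y n \<in> borel_measurable P" for n
    unfolding Yeq using Zm by measurable
  have indZ: "P.indep_vars (\<lambda>_. borel) Z UNIV"
  proof -
    have "P.indep_vars (\<lambda>_. borel) (\<lambda>i \<omega>. \<psi> (y i \<omega>) - m) {1..}"
      by (rule P.indep_vars_compose2[OF indep]) (rule gm)
    moreover have "{1..} = range Suc" by (auto simp: image_iff Suc_le_eq gr0_conv_Suc)
    ultimately show ?thesis
      unfolding Z_def[abs_def] using P.indep_vars_reindex[of Suc UNIV "\<lambda>_. borel" "\<lambda>i \<omega>. \<psi> (y i \<omega>) - m"] by simp
  qed
  obtain \<nu> where "is_normal_vec 0 ((*v) C) \<nu>"
    "weak_conv_vec (\<lambda>n. distr P borel (\<lambda>\<omega>. (1 / sqrt n) *\<^sub>R (\<Sum>i<n. Z i \<omega>))) \<nu>"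
  proof (rule P.CLT_vec[OF indZ])
    show "distr P borel (Z i) = distr ?N borel (\<lambda>x. \<psi> x - m)" for i
    proof -
      have "distr ?N borel (\<lambda>x. \<psi> x - m) = distr (distr P lborel (y (Suc i))) borel (\<lambda>x. \<psi> x - m)"
        using yl[of "Suc i"] by simp
      also have "\<dots> = distr P borel (Z i)"
        using ym[of "Suc i"] gm by (subst distr_distr) (auto simp: comp_def Z_def[abs_def])
      finally show ?thesis ..
    qed
    show "P.expectation (\<lambda>\<omega>. u \<bullet> Z i \<omega>) = 0" for i u
      using tr(1)[of "\<lambda>x. u \<bullet> x" i] cm(2)[of u] by simp
    show "integrable P (\<lambda>\<omega>. (u \<bullet> Z i \<omega>)\<^sup>2)" for i u
      using tr(2)[of "\<lambda>x. (u \<bullet> x)\<^sup>2" i] cm(3)[of u u] by (simp add: power2_eq_square)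
    show "P.expectation (\<lambda>\<omega>. (u \<bullet> Z i \<omega>)\<^sup>2) = u \<bullet> (C *v u)" for i u
      using tr(1)[of "\<lambda>x. (u \<bullet> x)\<^sup>2" i] cm(4)[of u u] by (simp add: power2_eq_square)
    show "u \<bullet> (C *v v) = (C *v u) \<bullet> v" for u v by (rule sym)
    show "0 < u \<bullet> (C *v u)" if "u \<noteq> 0" for u using that by (rule pd(1))
  qed (auto intro: that)
  then show "\<exists>\<nu>. is_normal_vec 0 ((*v) C) \<nu> \<and> weak_conv_vec (\<lambda>n. distr P borel (Y n)) \<nu>"
    unfolding Yeq by blast
qed

end

section \<open>Asymptotic normality\<close>

theorem theorem4p6:
  fixes \<mu> :: "'z measure" and P :: "'w measure"
    and A :: "'z \<Rightarrow> real^'m^'d" and \<sigma> \<beta> :: real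
    and \<Theta> :: "(real^'m) set" and \<theta>s :: "real^'m"
    and L :: nat and ord :: "'k::finite \<Rightarrow> nat" and e :: "'k \<Rightarrow> 'd tensor"
    and y :: "nat \<Rightarrow> 'w \<Rightarrow> real^'d"
    and \<Omega> :: "nat \<Rightarrow> 'w \<Rightarrow> real^'k^'k"
    and \<theta>h :: "nat \<Rightarrow> 'w \<Rightarrow> real^'m"
  assumes model: "model_assms \<mu> A \<sigma> \<Theta> \<theta>s"
    and R: "condition_R \<mu> A \<Theta>"
    and Q: "condition_Q \<mu> A \<sigma> \<beta> \<Theta> \<theta>s"
    and L: "1 \<le> L"
    and bases: "sym_tensor_bases L ord e"
    and beta: "0 < \<beta>"
    and cov_inv: "invertible (cov_feature \<mu> A \<sigma> \<beta> (feature \<sigma> ord e) \<theta>s)"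
    and P: "prob_space P"
    and indep: "prob_space.indep_vars P (\<lambda>_. borel) y {1..}"
    and dens: "\<And>i. 1 \<le> i \<Longrightarrow>
      distributed P lborel (y i) (\<lambda>x. ennreal (obs_density \<mu> A \<sigma> \<beta> \<theta>s x))"
    and weight_meas: "\<And>n. 1 \<le> n \<Longrightarrow> \<Omega> n \<in> borel_measurable P"
    and weight_psd: "\<And>n \<omega>. 1 \<le> n \<Longrightarrow> \<omega> \<in> space P \<Longrightarrow> psd_matrix (\<Omega> n \<omega>)"
    and weight_conv:
      "conv_in_prob P \<Omega> (matrix_inv (cov_feature \<mu> A \<sigma> \<beta> (feature \<sigma> ord e) \<theta>s))"
    and est_meas: "\<And>n. 1 \<le> n \<Longrightarrow> \<theta>h n \<in> borel_measurable P"
    and est_min: "\<And>n \<omega>. 1 \<le> n \<Longrightarrow> \<omega> \<in> space P \<Longrightarrow>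
      is_arg_min (gmom_objective \<mu> A \<sigma> \<beta> (feature \<sigma> ord e) (\<Omega> n \<omega>) n (\<lambda>i. y i \<omega>))
        (\<lambda>\<theta>. \<theta> \<in> \<Theta>) (\<theta>h n \<omega>)"
    and order: "local_order \<mu> A \<sigma> \<beta> \<Theta> \<theta>s \<le> enat L"
    and representative: "\<exists>\<theta>r. convergent_representative P \<mu> A \<sigma> \<beta> \<Theta> \<theta>s \<theta>h \<theta>r"
  shows "let W = transversal_space \<mu> A \<sigma> \<beta> \<Theta> \<theta>s; \<psi> = feature \<sigma> ord e in
    bij_betw (gmom_information \<mu> A \<sigma> \<beta> \<psi> W \<theta>s) W W \<and>
    (\<exists>\<theta>r. convergent_representative P \<mu> A \<sigma> \<beta> \<Theta> \<theta>s \<theta>h \<theta>r \<and>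
       conv_to_normal P (\<lambda>n \<omega>. sqrt (real n) *\<^sub>R orth_proj W (\<theta>r n \<omega> - \<theta>s))
         0 (gmom_covariance \<mu> A \<sigma> \<beta> \<psi> W \<theta>s))"
proof -

  \<comment> \<open>Linearization data and the limit of the empirical moments\<close>
  define W where "W = transversal_space \<mu> A \<sigma> \<beta> \<Theta> \<theta>s"
  define \<psi> where "\<psi> = feature \<sigma> ord e"
  define M where "M = mean_feature \<mu> A \<sigma> \<beta> \<psi>"
  define C where "C = cov_feature \<mu> A \<sigma> \<beta> \<psi> \<theta>s"
  define S where "S = matrix_inv C"
  define a where "a n \<omega> = empirical_feature \<psi> n (\<lambda>i. y i \<omega>) - M \<theta>s" for n \<omega>
  define Y where "Y n \<omega> = sqrt (real n) *\<^sub>R a n \<omega>" for n \<omega>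
  obtain amax where amax: "AE z in \<mu>. onorm ((*v) (A z)) \<le> amax"
    using R unfolding condition_R_def by blast
  interpret signal_model \<mu> A \<sigma> amax
    using model amax by (simp add: model_assms_def signal_model_def signal_model_axioms_def)
  interpret P: prob_space P by fact
  note clt = empirical_feature_CLT[where e = e and ord = ord, OF P indep dens cov_inv]
  have S: "pd_matrix S" "C ** S = mat 1"
    unfolding S_def C_def \<psi>_def using clt(1,2) by simp_all
  have Y_def': "Y n = (\<lambda>\<omega>. sqrt (real n) *\<^sub>R (empirical_feature (feature \<sigma> ord e) n (\<lambda>i. y i \<omega>) -
      mean_feature \<mu> A \<sigma> \<beta> (feature \<sigma> ord e) \<theta>s))" for n
    by (rule ext) (simp add: Y_def a_def M_def \<psi>_def)
  have Ym: "Y n \<in> borel_measurable P" for n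
    unfolding Y_def' using clt(3)[of n] by simp
  obtain \<nu> where \<nu>: "is_normal_vec 0 ((*v) C) \<nu>" "weak_conv_vec (\<lambda>n. distr P borel (Y n)) \<nu>"
    unfolding Y_def' C_def \<psi>_def using clt(4) by auto
  have \<nu>s: "prob_space \<nu>" "sets \<nu> = sets borel" using \<nu>(1) by (simp_all add: is_normal_vec_def)
  obtain DM :: "real^'m \<Rightarrow> (real^'m) \<Rightarrow>\<^sub>L (real^'k)" where DM: "\<And>\<theta>. (M has_derivative blinfun_apply (DM \<theta>)) (at \<theta>)" "continuous_on UNIV DM"
    using mean_feature_C1[of \<beta> ord e] unfolding M_def \<psi>_def by blast
  define D where "D = blinfun_apply (DM \<theta>s)"
  have dM: "(M has_derivative D) (at \<theta>s)" unfolding D_def by (rule DM(1))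
  obtain N s U where N: "open N" "\<theta>s \<in> N" "continuous_on N s" "s \<theta>s = \<theta>s" "U \<subseteq> \<Theta>" "open U"
    and s: "\<And>x. x \<in> N \<Longrightarrow> s x \<in> U \<and> param_equiv \<mu> A \<sigma> \<beta> (s x) x \<and> s x - \<theta>s \<in> W"
    and D_inj: "\<And>h. h \<in> W \<Longrightarrow> D h = 0 \<Longrightarrow> h = 0"
    by (rule transversal_slice[OF Q bases order beta dM[unfolded M_def \<psi>_def], folded W_def]) (assumption | rule that)+
  have W: "subspace W" unfolding W_def transversal_space_def by (rule subspace_orthogonal_comp)
  interpret G: restricted_gls W D S
    using W S(1) D_inj has_derivative_linear[OF dM] by (simp add: restricted_gls_def)
  have fd: "frechet_derivative (mean_feature \<mu> A \<sigma> \<beta> \<psi>) (at \<theta>s) = D"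
    using frechet_derivative_at[OF dM] by (simp add: M_def)
  have info: "gmom_information \<mu> A \<sigma> \<beta> \<psi> W \<theta>s = G.info"
    by (rule ext) (simp add: gmom_information_def G.info_def fd flip: S_def C_def)
  have cov: "gmom_covariance \<mu> A \<sigma> \<beta> \<psi> W \<theta>s = G.cov"
    by (rule ext) (simp add: gmom_covariance_def G.cov_def info)

  \<comment> \<open>Moving the given representative into the slice\<close>
  obtain \<theta>r where \<theta>r: "convergent_representative P \<mu> A \<sigma> \<beta> \<Theta> \<theta>s \<theta>h \<theta>r"
    using representative by blast
  have \<theta>r_meas: "\<theta>r n \<in> borel_measurable P"
    and \<theta>r_class: "\<And>\<omega>. \<omega> \<in> space P \<Longrightarrow> \<theta>r n \<omega> \<in> param_class \<mu> A \<sigma> \<beta> \<Theta> (\<theta>h n \<omega>)" if "1 \<le> n" for n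
    using \<theta>r that unfolding convergent_representative_def by blast+
  have \<theta>r_conv: "(\<lambda>n. measure P {\<omega> \<in> space P. \<epsilon> < dist (\<theta>r n \<omega>) \<theta>s}) \<longlonglongrightarrow> 0" if "\<epsilon> > 0" for \<epsilon>
    using \<theta>r that unfolding convergent_representative_def conv_in_prob_def by blast
  \<comment> \<open>Outside \<open>N\<close> the given representative is kept, so that the new one
    lies in the class at every \<open>\<omega>\<close>; this case has vanishing probability and does
    not affect the limit.\<close>
  define s' where "s' x = (if x \<in> N then s x else x)" for x
  define \<theta>t where "\<theta>t n \<omega> = s' (\<theta>r n \<omega>)" for n \<omega>
  have s'_meas: "s' \<in> borel_measurable borel"
    unfolding s'_def[abs_def]
    by (rule borel_measurable_continuous_on_if) (use N in \<open>auto intro!: continuous_intros\<close>)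
  have \<theta>t_meas: "\<theta>t n \<in> borel_measurable P" if "1 \<le> n" for n
    unfolding \<theta>t_def[abs_def] by (rule measurable_compose[OF \<theta>r_meas[OF that] s'_meas])
  have \<theta>t_class: "\<theta>t n \<omega> \<in> param_class \<mu> A \<sigma> \<beta> \<Theta> (\<theta>h n \<omega>)" if "1 \<le> n" "\<omega> \<in> space P" for n \<omega>
  proof (cases "\<theta>r n \<omega> \<in> N")
    case True
    have "param_equiv \<mu> A \<sigma> \<beta> (s (\<theta>r n \<omega>)) (\<theta>h n \<omega>)"
      using s[OF True] \<theta>r_class[OF that] by (auto simp: param_class_def intro: param_equiv_trans)
    then show ?thesis using s[OF True] N(5) True by (auto simp: \<theta>t_def s'_def param_class_def)
  next
    case False
    then show ?thesis using \<theta>r_class[OF that] by (simp add: \<theta>t_def s'_def)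
  qed
  have near: "\<exists>r>0. \<forall>x. dist x \<theta>s < r \<longrightarrow> x \<in> N \<and> dist (s x) \<theta>s < \<delta>" if "\<delta> > 0" for \<delta>
  proof -
    obtain r1 where r1: "r1 > 0" "\<And>x. dist x \<theta>s < r1 \<Longrightarrow> x \<in> N"
      using N(1,2) unfolding open_dist by blast
    obtain r2 where r2: "r2 > 0" "\<And>x. x \<in> N \<Longrightarrow> dist x \<theta>s < r2 \<Longrightarrow> dist (s x) (s \<theta>s) < \<delta>"
      using N(3)[unfolded continuous_on_iff, rule_format, OF N(2) \<open>\<delta> > 0\<close>] by blast
    show ?thesis
      using r1 r2 N(4) by (intro exI[of _ "min r1 r2"]) auto
  qed
  have \<theta>t_conv: "conv_in_prob P \<theta>t \<theta>s"
    unfolding conv_in_prob_def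
  proof (intro allI impI)
    fix \<epsilon> :: real assume "\<epsilon> > 0"
    then obtain r where r: "r > 0" "\<And>x. dist x \<theta>s < r \<Longrightarrow> x \<in> N \<and> dist (s x) \<theta>s < \<epsilon>"
      using near by blast
    \<comment> \<open>Halving turns \<open>dist \<ge> r\<close> into the strict inequality used by
      \<open>conv_in_prob\<close>.\<close>
    have le: "measure P {\<omega> \<in> space P. \<epsilon> < dist (\<theta>t n \<omega>) \<theta>s} \<le> measure P {\<omega> \<in> space P. r / 2 < dist (\<theta>r n \<omega>) \<theta>s}"
      if "1 \<le> n" for n
    proof (rule P.finite_measure_mono)
      show "{\<omega> \<in> space P. \<epsilon> < dist (\<theta>t n \<omega>) \<theta>s} \<subseteq> {\<omega> \<in> space P. r / 2 < dist (\<theta>r n \<omega>) \<theta>s}"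
      proof safe
        fix \<omega> assume "\<epsilon> < dist (\<theta>t n \<omega>) \<theta>s"
        then have "\<not> dist (\<theta>r n \<omega>) \<theta>s < r"
          using r(2)[of "\<theta>r n \<omega>"] by (auto simp: \<theta>t_def s'_def)
        then show "r / 2 < dist (\<theta>r n \<omega>) \<theta>s" using r(1) by simp
      qed
      show "{\<omega> \<in> space P. r / 2 < dist (\<theta>r n \<omega>) \<theta>s} \<in> P.events"
        using \<theta>r_meas[OF that] by measurable
    qed
    show "(\<lambda>n. measure P {\<omega> \<in> space P. \<epsilon> < dist (\<theta>t n \<omega>) \<theta>s}) \<longlonglongrightarrow> 0"
    proof (rule tendsto_sandwich[OF _ _ tendsto_const \<theta>r_conv[of "r / 2"]])
      show "eventually (\<lambda>n. measure P {\<omega> \<in> space P. \<epsilon> < dist (\<theta>t n \<omega>) \<theta>s} \<le> measure P {\<omega> \<in> space P. r / 2 < dist (\<theta>r n \<omega>) \<theta>s}) sequentially"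
        using le by (intro eventually_sequentiallyI[of 1])
    qed (use r in auto)
  qed
  have rep: "convergent_representative P \<mu> A \<sigma> \<beta> \<Theta> \<theta>s \<theta>h \<theta>t"
    unfolding convergent_representative_def using \<theta>t_meas \<theta>t_class \<theta>t_conv by blast
  \<comment> \<open>The estimator itself may be far from \<open>\<theta>s\<close>; its moved
    representative has the same value of \<open>M\<close>, hence also minimizes, and lies in the
    open set \<open>U\<close> inside \<open>\<Theta>\<close>.\<close>
  have first_order: "DM (\<theta>t n \<omega>) w \<bullet> (\<Omega> n \<omega> *v (a n \<omega> - (M (\<theta>t n \<omega>) - M \<theta>s))) = 0"
    if n: "1 \<le> n" and \<omega>: "\<omega> \<in> space P" and "\<theta>r n \<omega> \<in> N" for n \<omega> w
  proof -
    define b where "b = empirical_feature \<psi> n (\<lambda>i. y i \<omega>)"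
    have obj: "gmom_objective \<mu> A \<sigma> \<beta> \<psi> (\<Omega> n \<omega>) n (\<lambda>i. y i \<omega>) \<theta> = (b - M \<theta>) \<bullet> (\<Omega> n \<omega> *v (b - M \<theta>))" for \<theta>
      by (simp add: gmom_objective_def b_def M_def)
    have "M (\<theta>t n \<omega>) = M (\<theta>h n \<omega>)"
      unfolding M_def using \<theta>t_class[OF n \<omega>] by (intro mean_feature_equiv) (simp add: param_class_def)
    then have "(b - M (\<theta>t n \<omega>)) \<bullet> (\<Omega> n \<omega> *v (b - M (\<theta>t n \<omega>))) \<le> (b - M z) \<bullet> (\<Omega> n \<omega> *v (b - M z))" if "z \<in> U" for z
      using est_min[OF n \<omega>] that N(5) unfolding is_arg_min_def \<psi>_def[symmetric] obj by (auto simp: not_less)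
    moreover have "\<theta>t n \<omega> \<in> U" using s[OF that(3)] that(3) by (simp add: \<theta>t_def s'_def)
    moreover have "transpose (\<Omega> n \<omega>) = \<Omega> n \<omega>" using weight_psd[OF n \<omega>] by (simp add: psd_matrix_def)
    ultimately have "DM (\<theta>t n \<omega>) w \<bullet> (\<Omega> n \<omega> *v (b - M (\<theta>t n \<omega>))) = 0"
      by (intro weighted_square_first_order[OF N(6) _ _ DM(1)])
    then show ?thesis by (simp add: a_def b_def)
  qed

  \<comment> \<open>Comparison with the linear estimator\<close>
  define X where "X n \<omega> = sqrt (real n) *\<^sub>R orth_proj W (\<theta>t n \<omega> - \<theta>s)" for n \<omega>
  have lin_meas: "f \<in> borel_measurable borel" if "linear f" for f :: "'b::euclidean_space \<Rightarrow> 'c::euclidean_space"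
    using that by (intro borel_measurable_continuous_onI linear_continuous_on) (simp add: linear_conv_bounded_linear)
  \<comment> \<open>Nothing is known about \<open>\<theta>t 0\<close>, but the factor
    \<open>sqrt 0\<close> makes \<open>X 0\<close> constant.\<close>
  have X_meas: "X n \<in> borel_measurable P" for n
  proof (cases "n = 0")
    case False
    then have "(\<lambda>\<omega>. \<theta>t n \<omega> - \<theta>s) \<in> borel_measurable P" using \<theta>t_meas[of n] by simp
    from measurable_compose[OF this lin_meas[OF linear_orth_proj[OF W]]]
    show ?thesis unfolding X_def[abs_def] by simp
  qed (simp add: X_def[abs_def])
  have EY_meas: "(\<lambda>\<omega>. G.est (Y n \<omega>)) \<in> borel_measurable P" for n
    by (rule measurable_compose[OF Ym lin_meas[OF G.linear_est]])
  have diff: "(\<lambda>n. P.prob {\<omega> \<in> space P. norm (X n \<omega> - G.est (Y n \<omega>)) > \<epsilon>}) \<longlonglongrightarrow> 0" if "\<epsilon> > 0" for \<epsilon>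
  proof (rule order_tendstoI)
    fix \<rho> :: real assume "0 < \<rho>"
    obtain k where k: "k > 0" "eventually (\<lambda>n. P.prob {\<omega>\<in>space P. norm (Y n \<omega>) > k} < \<rho> / 3) sequentially"
      using P.weak_conv_vec_tight[OF Ym \<nu>(2) \<nu>s, of "\<rho> / 3"] \<open>0 < \<rho>\<close> by auto
    have DMc: "isCont DM \<theta>s" using DM(2) by (simp add: continuous_on_eq_continuous_at)
    \<comment> \<open>With the relative error \<open>\<epsilon> / k\<close>, scaling by
      \<open>sqrt n\<close> gives \<open>\<epsilon> / k * norm (Y n \<omega>)\<close>, at most
      \<open>\<epsilon>\<close> off the event \<open>E1 n\<close>.\<close>
    have "0 < \<epsilon> / k" using \<open>\<epsilon> > 0\<close> k(1) by simp
    note G.first_order_estimate[OF dM DMc D_def[symmetric] this]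
    then obtain \<delta> where \<delta>: "\<delta> > 0"
      "\<And>x O' a. norm (x - \<theta>s) < \<delta> \<Longrightarrow> x - \<theta>s \<in> W \<Longrightarrow> norm (O' - S) < \<delta> \<Longrightarrow>
        (\<And>w. w \<in> W \<Longrightarrow> DM x w \<bullet> (O' *v (a - (M x - M \<theta>s))) = 0) \<Longrightarrow> norm (x - \<theta>s - G.est a) \<le> \<epsilon> / k * norm a"
      by blast
    obtain r where r: "r > 0" "\<And>x. dist x \<theta>s < r \<Longrightarrow> x \<in> N \<and> dist (s x) \<theta>s < \<delta>"
      using near[OF \<delta>(1)] by blast
    \<comment> \<open>The three ways to fail: large empirical error, representative not near
      \<open>\<theta>s\<close>, weight not near its limit. Each eventually has probability below
      \<open>\<rho> / 3\<close>.\<close>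
    define E1 where "E1 n = {\<omega>\<in>space P. norm (Y n \<omega>) > k}" for n
    define E2 where "E2 n = {\<omega>\<in>space P. r / 2 < dist (\<theta>r n \<omega>) \<theta>s}" for n
    define E3 where "E3 n = {\<omega>\<in>space P. \<delta> / 2 < dist (\<Omega> n \<omega>) S}" for n
    have sub: "{\<omega> \<in> space P. norm (X n \<omega> - G.est (Y n \<omega>)) > \<epsilon>} \<subseteq> E1 n \<union> (E2 n \<union> E3 n)" if n: "1 \<le> n" for n
    proof
      fix \<omega> assume \<omega>: "\<omega> \<in> {\<omega> \<in> space P. norm (X n \<omega> - G.est (Y n \<omega>)) > \<epsilon>}"
      show "\<omega> \<in> E1 n \<union> (E2 n \<union> E3 n)"
      proof (rule ccontr)
        assume "\<omega> \<notin> E1 n \<union> (E2 n \<union> E3 n)"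
        then have Yk: "norm (Y n \<omega>) \<le> k" and dr: "dist (\<theta>r n \<omega>) \<theta>s < r" and d\<Omega>: "norm (\<Omega> n \<omega> - S) < \<delta>"
          using \<omega> r(1) \<delta>(1) by (auto simp: E1_def E2_def E3_def dist_norm)
        have rN: "\<theta>r n \<omega> \<in> N" using r(2)[OF dr] by simp
        then have \<theta>t: "\<theta>t n \<omega> = s (\<theta>r n \<omega>)" by (simp add: \<theta>t_def s'_def)
        have tW: "\<theta>t n \<omega> - \<theta>s \<in> W" using s[OF rN] by (simp add: \<theta>t)
        have "norm (\<theta>t n \<omega> - \<theta>s) < \<delta>" using r(2)[OF dr] by (simp add: \<theta>t dist_norm)
        from \<delta>(2)[OF this tW d\<Omega> first_order[OF n _ rN]] \<omega>
        have est: "norm (\<theta>t n \<omega> - \<theta>s - G.est (a n \<omega>)) \<le> \<epsilon> / k * norm (a n \<omega>)" by blast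
        \<comment> \<open>On the slice \<open>orth_proj W\<close> acts as the identity on the
          displacement, so nothing is lost by projecting.\<close>
        have "X n \<omega> - G.est (Y n \<omega>) = sqrt (real n) *\<^sub>R (\<theta>t n \<omega> - \<theta>s - G.est (a n \<omega>))"
          by (simp add: X_def Y_def orth_proj_id[OF W tW] linear_scale[OF G.linear_est] scaleR_diff_right)
        then have "norm (X n \<omega> - G.est (Y n \<omega>)) = sqrt (real n) * norm (\<theta>t n \<omega> - \<theta>s - G.est (a n \<omega>))" by simp
        also have "\<dots> \<le> sqrt (real n) * (\<epsilon> / k * norm (a n \<omega>))" using est by (intro mult_left_mono) auto
        also have "\<dots> = \<epsilon> / k * norm (Y n \<omega>)" by (simp add: Y_def)
        also have "\<dots> \<le> \<epsilon> / k * k" using Yk \<open>\<epsilon> > 0\<close> k(1) by (intro mult_left_mono) auto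
        also have "\<dots> = \<epsilon>" using k(1) by simp
        finally show False using \<omega> by simp
      qed
    qed
    have Em: "E1 n \<in> P.events" "E2 n \<in> P.events" "E3 n \<in> P.events" if "1 \<le> n" for n
    proof -
      show "E1 n \<in> P.events" unfolding E1_def using Ym[of n] by measurable
      show "E2 n \<in> P.events" unfolding E2_def using \<theta>r_meas[OF that] by measurable
      show "E3 n \<in> P.events" unfolding E3_def using weight_meas[OF that] by measurable
    qed
    have "(\<lambda>n. P.prob (E3 n)) \<longlonglongrightarrow> 0"
      unfolding E3_def S_def C_def \<psi>_def
      by (rule weight_conv[unfolded conv_in_prob_def, rule_format]) (simp add: \<delta>(1))
    then have e3: "eventually (\<lambda>n. P.prob (E3 n) < \<rho> / 3) sequentially"
      using \<open>0 < \<rho>\<close> by (intro order_tendstoD(2)) auto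
    have e2: "eventually (\<lambda>n. P.prob (E2 n) < \<rho> / 3) sequentially"
      unfolding E2_def using \<theta>r_conv[of "r / 2"] r(1) \<open>0 < \<rho>\<close> by (intro order_tendstoD(2)) auto
    have e1: "eventually (\<lambda>n. P.prob (E1 n) < \<rho> / 3) sequentially"
      using k(2) by (simp add: E1_def)
    show "eventually (\<lambda>n. P.prob {\<omega> \<in> space P. norm (X n \<omega> - G.est (Y n \<omega>)) > \<epsilon>} < \<rho>) sequentially"
      using e1 e2 e3 eventually_ge_at_top[of 1]
    proof eventually_elim
      case (elim n)
      have "P.prob {\<omega> \<in> space P. norm (X n \<omega> - G.est (Y n \<omega>)) > \<epsilon>} \<le> P.prob (E1 n \<union> (E2 n \<union> E3 n))"
        using Em[OF elim(4)] by (intro P.finite_measure_mono sub[OF elim(4)]) auto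
      also have "\<dots> \<le> P.prob (E1 n) + (P.prob (E2 n) + P.prob (E3 n))"
        using measure_Un_le[of "E1 n" P "E2 n \<union> E3 n"] measure_Un_le[of "E2 n" P "E3 n"] Em[OF elim(4)]
        by auto
      finally show ?case using elim by linarith
    qed
  qed (auto intro: eventuallyI less_le_trans measure_nonneg)
  have "is_normal_vec 0 G.cov (distr \<nu> borel G.est)"
    by (rule is_normal_vec_linear_image[OF \<nu>(1) G.linear_est G.est_covariance[OF S(2)]])
  moreover have "weak_conv_vec (\<lambda>n. distr P borel (X n)) (distr \<nu> borel G.est)"
  proof (rule P.weak_conv_vec_Slutsky[OF X_meas EY_meas])
    show "weak_conv_vec (\<lambda>n. distr P borel (\<lambda>\<omega>. G.est (Y n \<omega>))) (distr \<nu> borel G.est)"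
      by (rule weak_conv_vec_linear_image[OF Ym \<nu>(2) \<nu>s(2) G.linear_est])
    show "prob_space (distr \<nu> borel G.est)" using calculation by (simp add: is_normal_vec_def)
  qed (use diff in auto)
  ultimately have "conv_to_normal P X 0 (gmom_covariance \<mu> A \<sigma> \<beta> \<psi> W \<theta>s)"
    unfolding conv_to_normal_def cov by blast
  then show ?thesis
    unfolding Let_def W_def[symmetric] \<psi>_def[symmetric] info
    using G.info_bij rep unfolding X_def[abs_def] by blast
qed

end
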